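(* Let $M^n$ be a smooth manifold. Suppose $(g_t,H_t)$, with $g_t$ Riemannian metrics and $H_t=\bigoplus_{k=1}^nH_k$ closed sections of $\Lambda^*T^*M$ ($H_k$ being the degree $k$ component), is a solution of $$\frac{\partial}{\partial t}g=-2\mathrm{Rc}+\tfrac12H^2,\qquad\frac{\partial}{\partial t}H=\Delta_dH,$$ and suppose $\phi_t$ is a solution of $$\square\phi=\tfrac14\sum_{k=1}^n\tfrac{k-1}{k}|H_k|^2 .$$ Then, with $R^{H,\phi}=R-\frac14\sum_{k=1}^n\frac1k|H_k|^2+2\Delta\phi-|\nabla\phi|^2$, one has $$\square R^{H,\phi}=2\,\Bigl|\mathrm{Rc}-\tfrac14H^2+\nabla^2\phi\Bigr|^2+\tfrac12\bigl|d^*_gH+i_{\nabla\phi}H\bigr|^2 .$$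
   Context: Conventions: inner products and norms of tensors and forms are full tensor contractions in each degree, e.g. $|H_k|^2=(H_k)_{i_1\dots i_k}(H_k)^{i_1\dots i_k}$, and components of different degrees are orthogonal. $H^2(X,Y)=\langle i_XH,i_YH\rangle$. $\mathrm{Rc}$, $R$ are the Ricci tensor and scalar curvature of $g$; $\Delta=\mathrm{tr}_g\nabla^2$ on functions; $\square=\frac{\partial}{\partial t}-\Delta$; $d^*_g$ is the codifferential, $(d^*_gH_k)_{i_2\dots i_k}=-\nabla^{i_1}(H_k)_{i_1i_2\dots i_k}$; $\Delta_d=-(dd^*_g+d^*_gd)$. *)

theory Defs
  imports "HOL-Analysis.Analysis"
begin

section \<open>Smooth functions\<close>

text \<open>The derivatives are taken within \<open>S\<close>, so that \<open>S\<close> may be a product of a time interval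
  containing some of its endpoints with an open set.  For such \<open>S\<close> the derivative \<open>f'\<close> is unique.\<close>

primrec Ck_on :: "nat \<Rightarrow> 'a::euclidean_space set \<Rightarrow> ('a \<Rightarrow> 'b::real_normed_vector) \<Rightarrow> bool" where
  "Ck_on 0 S f \<longleftrightarrow> continuous_on S f"
| "Ck_on (Suc k) S f \<longleftrightarrow>
     (\<exists>f'. (\<forall>x\<in>S. (f has_derivative f' x) (at x within S)) \<and> (\<forall>v. Ck_on k S (\<lambda>x. f' x v)))"

definition smooth_on :: "'a::euclidean_space set \<Rightarrow> ('a \<Rightarrow> 'b::real_normed_vector) \<Rightarrow> bool" where
  "smooth_on S f \<longleftrightarrow> (\<forall>k. Ck_on k S f)"


section \<open>Smooth manifolds, tangent spaces and tensor fields\<close>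

text \<open>A chart is a pair of its domain \<open>U\<close> and its coordinate map, which is only relevant on \<open>U\<close>.\<close>

type_synonym ('m, 'n) chart = "'m set \<times> ('m \<Rightarrow> real ^ 'n)"

definition chart_image :: "('m, 'n::finite) chart \<Rightarrow> (real ^ 'n) set" where
  "chart_image c = snd c ` fst c"

definition chart_inv :: "('m, 'n::finite) chart \<Rightarrow> real ^ 'n \<Rightarrow> 'm" where
  "chart_inv c = inv_into (fst c) (snd c)"

text \<open>The atlas is not required to be maximal: a smooth structure is given by any of its atlases.\<close>

definition smooth_manifold :: "'m topology \<Rightarrow> ('m, 'n::finite) chart set \<Rightarrow> bool" where
  "smooth_manifold M A \<longleftrightarrow>
     Hausdorff_space M \<and> second_countable M \<and>
     (\<Union>c\<in>A. fst c) = topspace M \<and>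
     (\<forall>c\<in>A. openin M (fst c) \<and> open (chart_image c) \<and>
        homeomorphic_map (subtopology M (fst c)) (top_of_set (chart_image c)) (snd c)) \<and>
     (\<forall>c\<in>A. \<forall>d\<in>A. smooth_on (snd c ` (fst c \<inter> fst d)) (snd d \<circ> chart_inv c))"

definition smooth_near :: "('m, 'n::finite) chart set \<Rightarrow> 'm \<Rightarrow> ('m \<Rightarrow> real) \<Rightarrow> bool" where
  "smooth_near A p f \<longleftrightarrow>
     (\<forall>c\<in>A. p \<in> fst c \<longrightarrow>
        (\<exists>W. open W \<and> snd c p \<in> W \<and> W \<subseteq> chart_image c \<and> smooth_on W (f \<circ> chart_inv c)))"

text \<open>Tangent vectors at \<open>p\<close> are the derivations at \<open>p\<close> of the functions that are smooth near \<open>p\<close>.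
  (Such a derivation depends only on the germ at \<open>p\<close>, by the Leibniz rule applied to the indicator
  function of a neighbourhood of \<open>p\<close>.)  They are normalised to be \<open>0\<close> on all other functions, so
  that equality of tangent vectors is equality of functionals.\<close>

type_synonym 'm tvec = "('m \<Rightarrow> real) \<Rightarrow> real"

definition tangent_space :: "('m, 'n::finite) chart set \<Rightarrow> 'm \<Rightarrow> 'm tvec set" where
  "tangent_space A p =
     {D. (\<forall>f. \<not> smooth_near A p f \<longrightarrow> D f = 0) \<and>
         (\<forall>f h a b. smooth_near A p f \<longrightarrow> smooth_near A p h \<longrightarrow>
            D (\<lambda>q. a * f q + b * h q) = a * D f + b * D h) \<and>
         (\<forall>f h. smooth_near A p f \<longrightarrow> smooth_near A p h \<longrightarrow>
            D (\<lambda>q. f q * h q) = f p * D h + h p * D f)}"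

definition tcomb :: "real \<Rightarrow> 'm tvec \<Rightarrow> real \<Rightarrow> 'm tvec \<Rightarrow> 'm tvec" where
  "tcomb a v b w = (\<lambda>f. a * v f + b * w f)"

definition pd :: "'n::finite \<Rightarrow> (real ^ 'n \<Rightarrow> real) \<Rightarrow> real ^ 'n \<Rightarrow> real" where
  "pd i f x = frechet_derivative f (at x) (axis i 1)"

definition coord_vec ::
    "('m, 'n::finite) chart set \<Rightarrow> ('m, 'n) chart \<Rightarrow> 'm \<Rightarrow> 'n \<Rightarrow> 'm tvec" where
  "coord_vec A c p i =
     (\<lambda>f. if smooth_near A p f then pd i (f \<circ> chart_inv c) (snd c p) else 0)"

definition inner_product_on :: "'m tvec set \<Rightarrow> ('m tvec \<Rightarrow> 'm tvec \<Rightarrow> real) \<Rightarrow> bool" where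
  "inner_product_on T b \<longleftrightarrow>
     (\<forall>u\<in>T. \<forall>v\<in>T. \<forall>w\<in>T. \<forall>r s. b (tcomb r u s v) w = r * b u w + s * b v w) \<and>
     (\<forall>u\<in>T. \<forall>v\<in>T. b u v = b v u) \<and>
     (\<forall>v\<in>T. v \<noteq> (\<lambda>f. 0) \<longrightarrow> b v v > 0)"

text \<open>An element of the exterior algebra of the dual of \<open>T\<close> is a function on lists of vectors; its
  component of degree \<open>k\<close> is its restriction to the lists of length \<open>k\<close>.  It vanishes automatically
  on lists of vectors of length greater than the dimension.\<close>

definition alternating_form_on :: "'m tvec set \<Rightarrow> ('m tvec list \<Rightarrow> real) \<Rightarrow> bool" where
  "alternating_form_on T \<omega> \<longleftrightarrow>
     (\<forall>vs r v w a b. set vs \<subseteq> T \<and> r < length vs \<and> v \<in> T \<and> w \<in> T \<longrightarrow>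
        \<omega> (vs[r := tcomb a v b w]) = a * \<omega> (vs[r := v]) + b * \<omega> (vs[r := w])) \<and>
     (\<forall>vs r s. set vs \<subseteq> T \<and> r < s \<and> s < length vs \<and> vs ! r = vs ! s \<longrightarrow> \<omega> vs = 0)"

text \<open>Components in a chart \<open>c\<close>, as functions of the coordinates.\<close>

definition scalar_in :: "('m, 'n::finite) chart \<Rightarrow> ('m \<Rightarrow> real) \<Rightarrow> real ^ 'n \<Rightarrow> real" where
  "scalar_in c f x = f (chart_inv c x)"

definition metric_in ::
    "('m, 'n::finite) chart set \<Rightarrow> ('m, 'n) chart \<Rightarrow> ('m \<Rightarrow> 'm tvec \<Rightarrow> 'm tvec \<Rightarrow> real)
       \<Rightarrow> real ^ 'n \<Rightarrow> real ^ 'n ^ 'n" where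
  "metric_in A c g x =
     (\<chi> i j. g (chart_inv c x) (coord_vec A c (chart_inv c x) i) (coord_vec A c (chart_inv c x) j))"

definition form_in ::
    "('m, 'n::finite) chart set \<Rightarrow> ('m, 'n) chart \<Rightarrow> ('m \<Rightarrow> 'm tvec list \<Rightarrow> real)
       \<Rightarrow> real ^ 'n \<Rightarrow> 'n list \<Rightarrow> real" where
  "form_in A c \<omega> x is = \<omega> (chart_inv c x) (map (coord_vec A c (chart_inv c x)) is)"

text \<open>Families of fields depending on a time in \<open>I\<close>, smooth jointly in space and time.\<close>

definition smooth_function_family ::
    "('m, 'n::finite) chart set \<Rightarrow> real set \<Rightarrow> (real \<Rightarrow> 'm \<Rightarrow> real) \<Rightarrow> bool" where
  "smooth_function_family A I f \<longleftrightarrow>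
     (\<forall>c\<in>A. smooth_on (I \<times> chart_image c) (\<lambda>(t, x). scalar_in c (f t) x))"

definition smooth_metric_family ::
    "'m topology \<Rightarrow> ('m, 'n::finite) chart set \<Rightarrow> real set
       \<Rightarrow> (real \<Rightarrow> 'm \<Rightarrow> 'm tvec \<Rightarrow> 'm tvec \<Rightarrow> real) \<Rightarrow> bool" where
  "smooth_metric_family M A I g \<longleftrightarrow>
     (\<forall>t\<in>I. \<forall>p\<in>topspace M. inner_product_on (tangent_space A p) (g t p)) \<and>
     (\<forall>c\<in>A. \<forall>i j. smooth_on (I \<times> chart_image c) (\<lambda>(t, x). metric_in A c (g t) x $ i $ j))"

definition smooth_form_family ::
    "'m topology \<Rightarrow> ('m, 'n::finite) chart set \<Rightarrow> real set
       \<Rightarrow> (real \<Rightarrow> 'm \<Rightarrow> 'm tvec list \<Rightarrow> real) \<Rightarrow> bool" where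
  "smooth_form_family M A I \<omega> \<longleftrightarrow>
     (\<forall>t\<in>I. \<forall>p\<in>topspace M. alternating_form_on (tangent_space A p) (\<omega> t p)) \<and>
     (\<forall>c\<in>A. \<forall>is. smooth_on (I \<times> chart_image c) (\<lambda>(t, x). form_in A c (\<omega> t) x is))"


section \<open>Riemannian geometry in local coordinates\<close>

text \<open>In this section \<open>g\<close>, \<open>T\<close>, \<open>\<omega>\<close>, \<open>f\<close> are the components of a metric, a covariant tensor (of mixed
  degree), a differential form (of mixed degree) and a function in some chart.\<close>

type_synonym 'n lmetric = "real ^ 'n \<Rightarrow> real ^ 'n ^ 'n"
type_synonym 'n ltensor = "real ^ 'n \<Rightarrow> 'n list \<Rightarrow> real"

definition christoffel ::
    "'n::finite lmetric \<Rightarrow> 'n \<Rightarrow> 'n \<Rightarrow> 'n \<Rightarrow> real ^ 'n \<Rightarrow> real" where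
  \<comment> \<open>\<open>\<Gamma>\<close> with upper index \<open>k\<close> and lower indices \<open>i\<close>, \<open>j\<close>\<close>
  "christoffel g k i j x =
     (1/2) * (\<Sum>l\<in>UNIV. matrix_inv (g x) $ k $ l *
        (pd i (\<lambda>y. g y $ j $ l) x + pd j (\<lambda>y. g y $ i $ l) x - pd l (\<lambda>y. g y $ i $ j) x))"

definition riemann ::
    "'n::finite lmetric \<Rightarrow> 'n \<Rightarrow> 'n \<Rightarrow> 'n \<Rightarrow> 'n \<Rightarrow> real ^ 'n \<Rightarrow> real" where
  \<comment> \<open>component \<open>l\<close> of \<open>\<nabla>\<^sub>i \<nabla>\<^sub>j \<partial>\<^sub>k - \<nabla>\<^sub>j \<nabla>\<^sub>i \<partial>\<^sub>k\<close>\<close>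
  "riemann g l i j k x =
     pd i (christoffel g l j k) x - pd j (christoffel g l i k) x
     + (\<Sum>m\<in>UNIV. christoffel g l i m x * christoffel g m j k x
                - christoffel g l j m x * christoffel g m i k x)"

definition ricci :: "'n::finite lmetric \<Rightarrow> real ^ 'n \<Rightarrow> 'n \<Rightarrow> 'n \<Rightarrow> real" where
  "ricci g x j k = (\<Sum>i\<in>UNIV. riemann g i i j k x)"

definition scalar_curvature :: "'n::finite lmetric \<Rightarrow> real ^ 'n \<Rightarrow> real" where
  "scalar_curvature g x = (\<Sum>i\<in>UNIV. \<Sum>j\<in>UNIV. matrix_inv (g x) $ i $ j * ricci g x i j)"

definition hessian :: "'n::finite lmetric \<Rightarrow> (real ^ 'n \<Rightarrow> real) \<Rightarrow> real ^ 'n \<Rightarrow> 'n \<Rightarrow> 'n \<Rightarrow> real" where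
  "hessian g f x i j = pd i (pd j f) x - (\<Sum>l\<in>UNIV. christoffel g l i j x * pd l f x)"

definition laplacian :: "'n::finite lmetric \<Rightarrow> (real ^ 'n \<Rightarrow> real) \<Rightarrow> real ^ 'n \<Rightarrow> real" where
  "laplacian g f x = (\<Sum>i\<in>UNIV. \<Sum>j\<in>UNIV. matrix_inv (g x) $ i $ j * hessian g f x i j)"

definition gradient :: "'n::finite lmetric \<Rightarrow> (real ^ 'n \<Rightarrow> real) \<Rightarrow> real ^ 'n \<Rightarrow> real ^ 'n" where
  "gradient g f x = (\<chi> i. \<Sum>j\<in>UNIV. matrix_inv (g x) $ i $ j * pd j f x)"

definition vec_normsq :: "real ^ 'n ^ 'n \<Rightarrow> real ^ 'n::finite \<Rightarrow> real" where
  "vec_normsq G X = (\<Sum>i\<in>UNIV. \<Sum>j\<in>UNIV. G $ i $ j * X $ i * X $ j)"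

text \<open>Full contraction, with respect to the metric \<open>G\<close> at a point, of the degree \<open>k\<close> components of
  two tensors at that point.\<close>

definition tensor_inner ::
    "real ^ 'n ^ 'n \<Rightarrow> nat \<Rightarrow> ('n::finite list \<Rightarrow> real) \<Rightarrow> ('n list \<Rightarrow> real) \<Rightarrow> real" where
  "tensor_inner G k S T =
     (\<Sum>is | length is = k. \<Sum>js | length js = k.
        (\<Prod>r<k. matrix_inv G $ (is ! r) $ (js ! r)) * S is * T js)"

definition form_inner ::
    "real ^ 'n ^ 'n \<Rightarrow> ('n::finite list \<Rightarrow> real) \<Rightarrow> ('n list \<Rightarrow> real) \<Rightarrow> real" where
  "form_inner G S T = (\<Sum>k\<le>CARD('n). tensor_inner G k S T)"

definition interior_product ::
    "real ^ 'n::finite \<Rightarrow> ('n list \<Rightarrow> real) \<Rightarrow> 'n list \<Rightarrow> real" where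
  "interior_product X T is = (\<Sum>i\<in>UNIV. X $ i * T (i # is))"

definition form_square ::
    "real ^ 'n ^ 'n \<Rightarrow> ('n::finite list \<Rightarrow> real) \<Rightarrow> 'n \<Rightarrow> 'n \<Rightarrow> real" where
  "form_square G T i j =
     form_inner G (interior_product (axis i 1) T) (interior_product (axis j 1) T)"

definition cov_deriv ::
    "'n::finite lmetric \<Rightarrow> 'n ltensor \<Rightarrow> real ^ 'n \<Rightarrow> 'n \<Rightarrow> 'n list \<Rightarrow> real" where
  "cov_deriv g T x m is =
     pd m (\<lambda>y. T y is) x
     - (\<Sum>r<length is. \<Sum>l\<in>UNIV. christoffel g l m (is ! r) x * T x (is[r := l]))"

definition ext_deriv :: "'n::finite ltensor \<Rightarrow> 'n ltensor" where
  "ext_deriv \<omega> x is =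
     (\<Sum>r<length is. (-1) ^ r * pd (is ! r) (\<lambda>y. \<omega> y (take r is @ drop (Suc r) is)) x)"

definition codiff :: "'n::finite lmetric \<Rightarrow> 'n ltensor \<Rightarrow> 'n ltensor" where
  "codiff g \<omega> x is =
     - (\<Sum>a\<in>UNIV. \<Sum>b\<in>UNIV. matrix_inv (g x) $ a $ b * cov_deriv g \<omega> x a (b # is))"

definition hodge_laplacian :: "'n::finite lmetric \<Rightarrow> 'n ltensor \<Rightarrow> 'n ltensor" where
  "hodge_laplacian g \<omega> x is =
     - (ext_deriv (codiff g \<omega>) x is + codiff g (ext_deriv \<omega>) x is)"

text \<open>The operator \<open>\<partial>/\<partial>t - \<Delta>\<close> of a family of metrics \<open>g t\<close>; the time derivative is one-sided at an
  endpoint of \<open>I\<close> belonging to \<open>I\<close>.\<close>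

definition heat_operator ::
    "real set \<Rightarrow> (real \<Rightarrow> 'n::finite lmetric) \<Rightarrow> (real \<Rightarrow> real ^ 'n \<Rightarrow> real) \<Rightarrow> real \<Rightarrow> real ^ 'n \<Rightarrow> real" where
  "heat_operator I g u t x =
     vector_derivative (\<lambda>s. u s x) (at t within I) - laplacian (g t) (u t) x"

text \<open>The scalar curvature \<open>R\<close> twisted by the form \<open>\<omega>\<close> and the function \<open>f\<close>.\<close>

definition twisted_scalar_curvature ::
    "'n::finite lmetric \<Rightarrow> 'n ltensor \<Rightarrow> (real ^ 'n \<Rightarrow> real) \<Rightarrow> real ^ 'n \<Rightarrow> real" where
  "twisted_scalar_curvature g \<omega> f x =
     scalar_curvature g x
     - (1/4) * (\<Sum>k=1..CARD('n). (1 / real k) * tensor_inner (g x) k (\<omega> x) (\<omega> x))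
     + 2 * laplacian g f x - vec_normsq (g x) (gradient g f x)"

end

theory Submission
  imports Defs
begin

text \<open>Work at a point of a chart. The coordinate components of \<open>g\<close>, \<open>g\<^sup>-\<^sup>1\<close>, \<open>H\<close> and \<open>\<phi>\<close> have
  formal Taylor series in space and time there, which live in a commutative algebra with commuting
  derivations. In this algebra tensor calculus needs no differentiability hypotheses, and the theorem
  becomes an identity that is evaluated at the constant term.

  With \<open>h = \<partial>\<^sub>t g\<close> one has \<open>\<partial>\<^sub>t R = div div h - \<Delta> tr h - \<langle>h, Rc\<rangle>\<close>. Closedness of \<open>H\<close> gives
  \<open>div H\<^sup>2 = - \<langle>d\<^sup>*H, H\<rangle> + \<Sum>\<^sub>k \<nabla>|H\<^sub>k|\<^sup>2 / 2k\<close> and \<open>\<partial>\<^sub>t H = - d d\<^sup>*H\<close>, so that neither the curvature term of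
  the Weitzenboeck formula nor a Bochner formula for \<open>|H|\<^sup>2\<close> is needed. Combining this with
  the contracted Bianchi identity and the Bochner formula for \<open>\<phi>\<close>, all terms with two derivatives of
  \<open>|H\<^sub>k|\<^sup>2\<close> cancel and the rest is a sum of two squares.\<close>


section \<open>Derivations and contraction with a metric\<close>

text \<open>An equation that holds at all times and points of a chart gives equality of all
  derivatives, hence of jets; this is how the flow equations enter the algebra, where they can be
  differentiated further. Time is one more derivation commuting with the spatial ones, and the
  inverse metric is a second family of elements whose derivatives follow from its product with the
  metric.

  The constants in the theorem are those that the cancellation demands. In degree k, contracting an
  antisymmetrized tensor with an alternating one produces k equal terms, so the time derivative of
  |H_k|^2 contains 2k times the contraction of \<nabla> div H with H, while div div of H^2/2
  contains it with factor 1/2; the weight 1/(4k) makes the two cancel. The Laplacian of |H_k|^2 has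
  coefficient 1/(4k) - 1/2 in the time derivative of R, and subtracting the Laplacian of the whole
  quantity adds another 1/(4k). So the time derivative of 2 \<Delta> \<phi> must contribute 1/2 -
  1/(2k), which is twice the source coefficient (k-1)/(4k).\<close>

definition derivation :: "('a::{comm_ring_1,real_algebra_1} \<Rightarrow> 'a) \<Rightarrow> bool" where
  "derivation d \<longleftrightarrow> (\<forall>x y. d (x + y) = d x + d y) \<and> (\<forall>x y. d (x * y) = d x * y + x * d y) \<and>
     (\<forall>c x. d (c *\<^sub>R x) = c *\<^sub>R d x)"

lemma derivation_add: "derivation d \<Longrightarrow> d (x + y) = d x + d y"
  and derivation_mult: "derivation d \<Longrightarrow> d (x * y) = d x * y + x * d y"
  and derivation_scaleR: "derivation d \<Longrightarrow> d (c *\<^sub>R x) = c *\<^sub>R d x"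
  by (auto simp: derivation_def)

lemma derivation_0: "derivation d \<Longrightarrow> d 0 = 0"
  using derivation_add[of d 0 0] by simp

lemma derivation_1: "derivation d \<Longrightarrow> d 1 = 0"
  using derivation_mult[of d 1 1] by simp

lemma derivation_minus: "derivation d \<Longrightarrow> d (- x) = - d x"
  using derivation_add[of d x "- x"] derivation_0[of d] by (simp add: eq_neg_iff_add_eq_0 add.commute)

lemma derivation_diff: "derivation d \<Longrightarrow> d (x - y) = d x - d y"
  using derivation_add[of d x "- y"] derivation_minus[of d y] by simp

lemma derivation_sum: "derivation d \<Longrightarrow> d (sum f S) = (\<Sum>i\<in>S. d (f i))"
  by (induction S rule: infinite_finite_induct) (auto simp: derivation_0 derivation_add)

lemmas derivation_rules = derivation_add derivation_mult derivation_scaleR derivation_0 derivation_1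
  derivation_minus derivation_diff derivation_sum

text \<open>\<open>g\<close> and \<open>q\<close> play the metric and its inverse in coordinates.
  Real scalars provide factors such as 1/2 and allow \<open>x = 0\<close> to be concluded from
  \<open>2 *\<^sub>R x = 0\<close>.\<close>

locale metric_algebra =
  fixes D :: "'n::finite \<Rightarrow> 'a::{comm_ring_1,real_algebra_1} \<Rightarrow> 'a" and g q :: "'n \<Rightarrow> 'n \<Rightarrow> 'a"
  assumes D: "derivation (D i)"
    and D_commute: "D i (D j x) = D j (D i x)"
    and g_sym: "g i j = g j i"
    and q_sym: "q i j = q j i"
    and q_g: "(\<Sum>k\<in>UNIV. q i k * g k j) = (if i = j then 1 else 0)"
begin

lemmas D_rules = derivation_rules[OF D]

definition contract :: "('n \<Rightarrow> 'n \<Rightarrow> 'a) \<Rightarrow> 'a" where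
  "contract F = (\<Sum>i\<in>UNIV. \<Sum>j\<in>UNIV. q i j * F i j)"

lemma contract_cong: "(\<And>i j. F i j = G i j) \<Longrightarrow> contract F = contract G"
  by (simp add: contract_def)

lemma contract_add: "contract (\<lambda>i j. F i j + G i j) = contract F + contract G"
  by (simp add: contract_def distrib_left sum.distrib)

lemma contract_diff: "contract (\<lambda>i j. F i j - G i j) = contract F - contract G"
  by (simp add: contract_def right_diff_distrib sum_subtractf)

lemma contract_minus: "contract (\<lambda>i j. - F i j) = - contract F"
  by (simp add: contract_def sum_negf)

lemma contract_0: "contract (\<lambda>i j. 0) = 0"
  by (simp add: contract_def)

lemma contract_mult: "contract (\<lambda>i j. c * F i j) = c * contract F"
  by (simp add: contract_def sum_distrib_left mult.left_commute)

lemma contract_mult_right: "contract (\<lambda>i j. F i j * c) = contract F * c"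
  by (simp add: contract_def sum_distrib_right mult.assoc)

lemma contract_scaleR: "contract (\<lambda>i j. c *\<^sub>R F i j) = c *\<^sub>R contract F"
  by (simp add: contract_def scaleR_sum_right)

lemma contract_sum: "contract (\<lambda>i j. \<Sum>l\<in>S. F l i j) = (\<Sum>l\<in>S. contract (F l))"
proof -
  have "contract (\<lambda>i j. \<Sum>l\<in>S. F l i j) = (\<Sum>i\<in>UNIV. \<Sum>l\<in>S. \<Sum>j\<in>UNIV. q i j * F l i j)"
    unfolding contract_def sum_distrib_left by (intro sum.cong refl sum.swap)
  then show ?thesis
    unfolding contract_def by (subst (asm) sum.swap) simp
qed

lemma contract_transpose: "contract (\<lambda>i j. F j i) = contract F"
  unfolding contract_def by (subst sum.swap) (simp add: q_sym)

lemma contract_swap: "contract (\<lambda>i j. contract (\<lambda>k l. F i j k l)) = contract (\<lambda>k l. contract (\<lambda>i j. F i j k l))"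
proof -
  have "contract (\<lambda>i j. contract (\<lambda>k l. F i j k l)) = (\<Sum>k\<in>UNIV. \<Sum>l\<in>UNIV. contract (\<lambda>i j. q k l * F i j k l))"
    by (subst (2) contract_def) (simp only: contract_sum)
  then show ?thesis
    by (simp add: contract_mult) (simp add: contract_def)
qed

lemma sum_delta_mult: "(\<Sum>k\<in>UNIV. (if k = j then 1 else 0) * F k) = (F (j::'n) :: 'a)"
  "(\<Sum>k\<in>UNIV. (if j = k then 1 else 0) * F k) = (F (j::'n) :: 'a)"
  by (simp_all add: if_distrib[of "\<lambda>x. x * _"] cong: if_cong)

lemma contract_g: "contract (\<lambda>a b. g a m * X b) = X m"
proof -
  have "contract (\<lambda>a b. g a m * X b) = (\<Sum>b\<in>UNIV. (\<Sum>a\<in>UNIV. q b a * g a m) * X b)"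
    unfolding contract_def by (subst sum.swap) (simp add: sum_distrib_right mult.assoc q_sym)
  then show ?thesis by (simp add: q_g sum_delta_mult)
qed

lemma contract_g': "contract (\<lambda>a b. g b m * X a) = X m"
  using contract_transpose[of "\<lambda>a b. g a m * X b"] by (simp add: contract_g)

lemma sum_qg: "(\<Sum>l\<in>UNIV. (\<Sum>a\<in>UNIV. q l a * X a) * g l i) = X i"
proof -
  have "(\<Sum>l\<in>UNIV. (\<Sum>a\<in>UNIV. q l a * X a) * g l i) = contract (\<lambda>l a. g l i * X a)"
    unfolding contract_def by (simp add: sum_distrib_left sum_distrib_right mult_ac)
  then show ?thesis by (simp add: contract_g)
qed

lemma sum_gq: "(\<Sum>a\<in>UNIV. q l a * (\<Sum>k\<in>UNIV. g a k * X k)) = X l"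
proof -
  have "(\<Sum>a\<in>UNIV. q l a * (\<Sum>k\<in>UNIV. g a k * X k)) = (\<Sum>k\<in>UNIV. (\<Sum>a\<in>UNIV. q l a * g a k) * X k)"
    unfolding sum_distrib_left sum_distrib_right by (subst sum.swap) (simp add: mult.assoc)
  then show ?thesis by (simp add: q_g sum_delta_mult)
qed

text \<open>Differentiating \<open>q_g\<close> moves the derivation from \<open>q\<close> to
  \<open>g\<close> with a sign; multiplying by \<open>q\<close> once more isolates the derivative of
  \<open>q\<close>.\<close>

lemma derivation_q:
  assumes "derivation d"
  shows "d (q i j) = - (\<Sum>a\<in>UNIV. \<Sum>b\<in>UNIV. q i a * q j b * d (g a b))"
proof -
  note r = derivation_rules[OF assms]
  have e: "(\<Sum>k\<in>UNIV. d (q i k) * g k b) = - (\<Sum>k\<in>UNIV. q i k * d (g k b))" for b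
  proof -
    have "d (\<Sum>k\<in>UNIV. q i k * g k b) = 0"
      by (simp add: q_g r)
    then show ?thesis
      by (simp add: r sum.distrib eq_neg_iff_add_eq_0)
  qed
  have "d (q i j) = (\<Sum>b\<in>UNIV. q j b * (\<Sum>k\<in>UNIV. g b k * d (q i k)))"
    by (simp add: sum_gq)
  also have "\<dots> = (\<Sum>b\<in>UNIV. q j b * (\<Sum>k\<in>UNIV. d (q i k) * g k b))"
    by (simp add: mult.commute g_sym)
  also have "\<dots> = - (\<Sum>b\<in>UNIV. \<Sum>a\<in>UNIV. q i a * q j b * d (g a b))"
    unfolding e by (simp add: sum_negf sum_distrib_left mult_ac)
  also have "\<dots> = - (\<Sum>a\<in>UNIV. \<Sum>b\<in>UNIV. q i a * q j b * d (g a b))"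
    by (subst sum.swap) (rule refl)
  finally show ?thesis .
qed

text \<open>The last term comes from the derivative of \<open>q\<close>. It is the inner product of
  the 2-tensors \<open>d g\<close> and \<open>F\<close>, and its arrangement of indices returns as
  \<open>pair\<close>.\<close>

lemma derivation_contract:
  assumes "derivation d"
  shows "d (contract F) = contract (\<lambda>i j. d (F i j)) - contract (\<lambda>i a. contract (\<lambda>j b. d (g a b) * F i j))"
proof -
  note r = derivation_rules[OF assms]
  have "(\<Sum>i\<in>UNIV. \<Sum>j\<in>UNIV. d (q i j) * F i j)
      = - (\<Sum>i\<in>UNIV. \<Sum>j\<in>UNIV. \<Sum>a\<in>UNIV. \<Sum>b\<in>UNIV. q i a * q j b * d (g a b) * F i j)"
    by (simp add: derivation_q[OF assms] sum_negf sum_distrib_right)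
  also have "\<dots> = - (\<Sum>i\<in>UNIV. \<Sum>a\<in>UNIV. \<Sum>j\<in>UNIV. \<Sum>b\<in>UNIV. q i a * q j b * d (g a b) * F i j)"
    by (intro arg_cong[of _ _ uminus] sum.cong refl sum.swap)
  also have "\<dots> = - contract (\<lambda>i a. contract (\<lambda>j b. d (g a b) * F i j))"
    unfolding contract_def sum_distrib_left by (simp add: mult.assoc)
  finally have e: "(\<Sum>i\<in>UNIV. \<Sum>j\<in>UNIV. d (q i j) * F i j) = - contract (\<lambda>i a. contract (\<lambda>j b. d (g a b) * F i j))" .
  have "d (contract F) = (\<Sum>i\<in>UNIV. \<Sum>j\<in>UNIV. d (q i j) * F i j) + contract (\<lambda>i j. d (F i j))"
    by (simp add: contract_def r sum.distrib)
  then show ?thesis by (simp add: e)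
qed

section \<open>Christoffel symbols and metric compatibility\<close>

definition Gam :: "'n \<Rightarrow> 'n \<Rightarrow> 'n \<Rightarrow> 'a" where
  "Gam k i j = (1/2) *\<^sub>R (\<Sum>l\<in>UNIV. q k l * (D i (g j l) + D j (g i l) - D l (g i j)))"

lemma Gam_sym: "Gam k i j = Gam k j i"
  unfolding Gam_def by (simp add: add.commute g_sym)

lemma Gam_lower: "(\<Sum>l\<in>UNIV. Gam l i j * g l m) = (1/2) *\<^sub>R (D i (g j m) + D j (g i m) - D m (g i j))"
  unfolding Gam_def by (simp only: mult_scaleR_left scaleR_sum_right[symmetric] sum_qg)

text \<open>The two lowered symbols carry the cross terms with opposite signs, so their sum leaves
  only the derivative of \<open>g i j\<close>. This is \<nabla> g = 0.\<close>

lemma D_g: "D m (g i j) = (\<Sum>l\<in>UNIV. Gam l m i * g l j) + (\<Sum>l\<in>UNIV. Gam l m j * g i l)"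
proof -
  have "(\<Sum>l\<in>UNIV. Gam l m j * g i l) = (\<Sum>l\<in>UNIV. Gam l m j * g l i)"
    by (simp add: g_sym)
  moreover have "D m (g i j) = (1/2) *\<^sub>R (D m (g i j) + D i (g m j) - D j (g m i)) + (1/2) *\<^sub>R (D m (g j i) + D j (g m i) - D i (g m j))"
    by (simp add: g_sym[of j i] scaleR_add_right[symmetric] scaleR_half_double)
  ultimately show ?thesis
    by (simp only: Gam_lower)
qed

text \<open>Insert \<open>D_g\<close> into \<open>derivation_contract\<close>: each of its two
  summands contains a \<open>g\<close> that cancels a \<open>q\<close>, leaving one connection term
  for each index of \<open>F\<close>. So the trace commutes with covariant differentiation.\<close>

lemma D_contract: "D m (contract F) = contract (\<lambda>i j. D m (F i j) - (\<Sum>l\<in>UNIV. Gam l m i * F l j) - (\<Sum>l\<in>UNIV. Gam l m j * F i l))"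
proof -
  have 1: "contract (\<lambda>i a. contract (\<lambda>j b. (\<Sum>l\<in>UNIV. Gam l m a * g l b) * F i j)) = contract (\<lambda>i a. \<Sum>l\<in>UNIV. Gam l m a * F i l)"
  proof (intro contract_cong)
    fix i a
    have "contract (\<lambda>j b. (\<Sum>l\<in>UNIV. Gam l m a * g l b) * F i j) = contract (\<lambda>j b. \<Sum>l\<in>UNIV. Gam l m a * (g l b * F i j))"
      by (simp add: sum_distrib_right mult.assoc)
    also have "\<dots> = (\<Sum>l\<in>UNIV. Gam l m a * contract (\<lambda>j b. g b l * F i j))"
      by (simp add: contract_sum contract_mult g_sym)
    also have "\<dots> = (\<Sum>l\<in>UNIV. Gam l m a * F i l)"
      by (simp add: contract_g contract_g')
    finally show "contract (\<lambda>j b. (\<Sum>l\<in>UNIV. Gam l m a * g l b) * F i j) = (\<Sum>l\<in>UNIV. Gam l m a * F i l)" .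
  qed
  have 2: "contract (\<lambda>i a. contract (\<lambda>j b. (\<Sum>l\<in>UNIV. Gam l m b * g a l) * F i j)) = contract (\<lambda>j b. \<Sum>l\<in>UNIV. Gam l m b * F l j)"
  proof (subst contract_swap, intro contract_cong)
    fix j b
    have "contract (\<lambda>i a. (\<Sum>l\<in>UNIV. Gam l m b * g a l) * F i j) = contract (\<lambda>i a. \<Sum>l\<in>UNIV. Gam l m b * (g a l * F i j))"
      by (simp add: sum_distrib_right mult.assoc)
    also have "\<dots> = (\<Sum>l\<in>UNIV. Gam l m b * contract (\<lambda>i a. g a l * F i j))"
      by (simp add: contract_sum contract_mult)
    also have "\<dots> = (\<Sum>l\<in>UNIV. Gam l m b * F l j)"
      by (simp add: contract_g contract_g')
    finally show "contract (\<lambda>i a. (\<Sum>l\<in>UNIV. Gam l m b * g a l) * F i j) = (\<Sum>l\<in>UNIV. Gam l m b * F l j)" .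
  qed
  have 3: "contract (\<lambda>j b. \<Sum>l\<in>UNIV. Gam l m b * F l j) = contract (\<lambda>i j. \<Sum>l\<in>UNIV. Gam l m i * F l j)"
    by (rule contract_transpose)
  show ?thesis
    unfolding derivation_contract[OF D] D_g distrib_right contract_add contract_diff 1 2 3 by (simp add: algebra_simps)
qed

end

section \<open>Covariant derivatives and curvature\<close>

context metric_algebra begin

text \<open>A covariant tensor is the family of its components, indexed by lists. \<open>act A\<close> is the action of an
  endomorphism \<open>A\<close> as a derivation of the tensor algebra; \<open>cov m\<close> is the covariant derivative in
  direction \<open>m\<close>, and \<open>nabla\<close> puts the direction of differentiation in front.\<close>

primrec act :: "('n \<Rightarrow> 'n \<Rightarrow> 'a) \<Rightarrow> ('n list \<Rightarrow> 'a) \<Rightarrow> 'n list \<Rightarrow> 'a" where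
  "act A T [] = 0"
| "act A T (i # v) = act A (\<lambda>v. T (i # v)) v + (\<Sum>l\<in>UNIV. A l i * T (l # v))"

definition cov :: "'n \<Rightarrow> ('n list \<Rightarrow> 'a) \<Rightarrow> 'n list \<Rightarrow> 'a" where
  "cov m T v = D m (T v) - act (\<lambda>l i. Gam l m i) T v"

lemma act_add: "act A (\<lambda>v. S v + T v) v = act A S v + act A T v"
  by (induction v arbitrary: S T) (simp_all add: distrib_left sum.distrib)

lemma act_mult: "act A (\<lambda>v. c * T v) v = c * act A T v"
  by (induction v arbitrary: T) (simp_all add: distrib_left sum_distrib_left mult.left_commute)

lemma act_0: "act A (\<lambda>v. 0) v = 0"
  by (induction v) simp_all

lemma act_sum: "act A (\<lambda>v. \<Sum>i\<in>S. T i v) v = (\<Sum>i\<in>S. act A (T i) v)"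
  by (induction S rule: infinite_finite_induct) (simp_all add: act_0 act_add)

lemma act_minus: "act A (\<lambda>v. - T v) v = - act A T v"
  using act_mult[of A "- 1" T v] by simp

lemma cov_Nil: "cov m T [] = D m (T [])"
  by (simp add: cov_def)

lemma cov_Cons: "cov m T (i # v) = cov m (\<lambda>v. T (i # v)) v - (\<Sum>l\<in>UNIV. Gam l m i * T (l # v))"
  by (simp add: cov_def)

lemma cov_add: "cov m (\<lambda>v. S v + T v) v = cov m S v + cov m T v"
  by (simp add: cov_def act_add D_rules)

lemma cov_mult: "cov m (\<lambda>v. c * T v) v = D m c * T v + c * cov m T v"
  by (simp add: cov_def act_mult D_rules algebra_simps)

lemma cov_0: "cov m (\<lambda>v. 0) v = 0"
  by (simp add: cov_def act_0 D_rules)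

lemma cov_sum: "cov m (\<lambda>v. \<Sum>i\<in>S. T i v) v = (\<Sum>i\<in>S. cov m (T i) v)"
  by (simp add: cov_def act_sum D_rules sum_subtractf)

lemma cov_minus: "cov m (\<lambda>v. - T v) v = - cov m T v"
  by (simp add: cov_def act_minus D_rules)

lemma cov_diff: "cov m (\<lambda>v. S v - T v) v = cov m S v - cov m T v"
  using cov_add[of m S "\<lambda>v. - T v" v] by (simp add: cov_minus)

lemma cov_scaleR: "cov m (\<lambda>v. c *\<^sub>R T v) v = c *\<^sub>R cov m T v"
  using cov_mult[of m "c *\<^sub>R 1" T v] by (simp add: D_rules)

primrec nabla :: "('n list \<Rightarrow> 'a) \<Rightarrow> 'n list \<Rightarrow> 'a" where
  "nabla T [] = 0"
| "nabla T (m # v) = cov m T v"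

text \<open>The derivative of \<open>q\<close> supplies exactly the connection terms of the two
  contracted indices. It is read off from \<open>D_contract\<close> with the remaining indices
  \<open>v\<close> held fixed.\<close>

lemma cov_contract: "cov m (\<lambda>v. contract (\<lambda>i j. T (i # j # v))) v = contract (\<lambda>i j. cov m T (i # j # v))"
proof -
  have "cov m (\<lambda>v. contract (\<lambda>i j. T (i # j # v))) v =
    (\<Sum>i\<in>UNIV. \<Sum>j\<in>UNIV. D m (q i j) * T (i # j # v)) + contract (\<lambda>i j. cov m (\<lambda>v. T (i # j # v)) v)"
    unfolding contract_def by (simp add: cov_sum cov_mult sum.distrib)
  moreover have "(\<Sum>i\<in>UNIV. \<Sum>j\<in>UNIV. D m (q i j) * T (i # j # v)) =
     - contract (\<lambda>i j. (\<Sum>l\<in>UNIV. Gam l m i * T (l # j # v)) + (\<Sum>l\<in>UNIV. Gam l m j * T (i # l # v)))"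
  proof -
    have "(\<Sum>i\<in>UNIV. \<Sum>j\<in>UNIV. D m (q i j) * T (i # j # v)) = D m (contract (\<lambda>i j. T (i # j # v))) - contract (\<lambda>i j. D m (T (i # j # v)))"
      by (simp add: contract_def D_rules sum.distrib)
    then show ?thesis
      unfolding D_contract contract_diff contract_add by simp
  qed
  ultimately show ?thesis
    by (simp add: cov_Cons contract_diff contract_add)
qed

section \<open>Curvature, its symmetries and the Ricci identity\<close>

definition Riem :: "'n \<Rightarrow> 'n \<Rightarrow> 'n \<Rightarrow> 'n \<Rightarrow> 'a" where
  "Riem l i j k = D i (Gam l j k) - D j (Gam l i k)
     + (\<Sum>m\<in>UNIV. Gam l i m * Gam m j k - Gam l j m * Gam m i k)"

definition Ric :: "'n \<Rightarrow> 'n \<Rightarrow> 'a" where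
  "Ric j k = (\<Sum>i\<in>UNIV. Riem i i j k)"

lemma Riem_antisym: "Riem l i j k = - Riem l j i k"
  by (simp add: Riem_def sum_subtractf)

lemma Riem_cyclic: "Riem l i j k + Riem l j k i + Riem l k i j = 0"
  by (simp add: Riem_def sum_subtractf Gam_sym[of _ j i] Gam_sym[of _ k i] Gam_sym[of _ k j])

text \<open>Here \<open>b\<close> in \<open>cov b T\<close> is a label and not a tensor index, so
  these are derivatives along coordinate fields. Such fields commute, and the commutator is already
  the curvature operator.\<close>

lemma cov_cov_commutator:
  "cov a (cov b T) v - cov b (cov a T) v = - act (\<lambda>l i. Riem l a b i) T v"
proof (induction v arbitrary: T)
  case Nil
  then show ?case by (simp add: cov_Nil D_commute)
next
  case (Cons i v)
  have *: "cov a (cov b T) (i # v) = cov a (cov b (\<lambda>v. T (i # v))) v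
     - (\<Sum>l\<in>UNIV. D a (Gam l b i) * T (l # v)) - (\<Sum>l\<in>UNIV. Gam l b i * cov a (\<lambda>v. T (l # v)) v)
     - (\<Sum>l\<in>UNIV. Gam l a i * cov b (\<lambda>v. T (l # v)) v)
     + (\<Sum>l\<in>UNIV. (\<Sum>m\<in>UNIV. Gam l b m * Gam m a i) * T (l # v))" for a b
  proof -
    have "(\<Sum>l\<in>UNIV. Gam l a i * (\<Sum>p\<in>UNIV. Gam p b l * T (p # v))) =
        (\<Sum>l\<in>UNIV. (\<Sum>m\<in>UNIV. Gam l b m * Gam m a i) * T (l # v))"
      unfolding sum_distrib_left sum_distrib_right by (subst sum.swap) (simp add: mult_ac)
    then show ?thesis
      by (simp add: cov_Cons cov_diff cov_sum cov_mult sum.distrib right_diff_distrib sum_subtractf)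
  qed
  show ?case
    using Cons[of "\<lambda>v. T (i # v)"]
    by (simp add: * Riem_def sum_subtractf sum.distrib algebra_simps)
qed

text \<open>\<open>nabla\<close> treats the inner direction as an index; the additional connection
  term is symmetric in \<open>a\<close> and \<open>b\<close> and drops out.\<close>

lemma nabla_nabla_commutator:
  "nabla (nabla T) (a # b # v) - nabla (nabla T) (b # a # v) = - act (\<lambda>l i. Riem l a b i) T v"
  using cov_cov_commutator[of a b T v]
  by (simp add: cov_Cons Gam_sym[of _ b a])

text \<open>A 2-tensor given as a binary family \<open>F\<close> enters the calculus of lists as
  \<open>F (v ! 0) (v ! 1)\<close>; this encoding is used throughout.\<close>

lemma cov_g: "cov m (\<lambda>v. g (v ! 0) (v ! 1)) [i, j] = 0"
  using D_g[of m i j] by (simp add: cov_Cons cov_Nil)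

text \<open>Apply the commutator to the parallel tensor \<open>g\<close>: the left side vanishes and
  the right side is the sum of the two lowered curvatures.\<close>

lemma Riem_lower_antisym:
  "(\<Sum>l\<in>UNIV. Riem l a b i * g l j) = - (\<Sum>l\<in>UNIV. Riem l a b j * g l i)"
proof -
  have *: "cov a (cov b (\<lambda>v. g (v ! 0) (v ! 1))) [i, j] = 0" for a b
  proof -
    have "cov b (\<lambda>v. g (v ! 0) (v ! 1)) [i, j] = 0" for i j by (rule cov_g)
    then show ?thesis by (simp add: cov_Cons cov_Nil D_rules del: One_nat_def)
  qed
  show ?thesis
    using cov_cov_commutator[of a b "\<lambda>v. g (v ! 0) (v ! 1)" "[i, j]"]
    unfolding * by (simp add: g_sym)
qed

text \<open>By the cyclic identity the difference is the trace of the curvature as an endomorphism,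
  up to sign, and an antisymmetric endomorphism has trace 0.\<close>

lemma Ric_sym: "Ric j k = Ric k j"
proof -
  have *: "(\<Sum>i\<in>UNIV. Riem i j k i) = 0"
  proof -
    have "(\<Sum>i\<in>UNIV. Riem i j k i) = (\<Sum>i\<in>UNIV. \<Sum>a\<in>UNIV. q i a * (\<Sum>l\<in>UNIV. g a l * Riem l j k i))"
      by (simp only: sum_gq)
    then have e: "(\<Sum>i\<in>UNIV. Riem i j k i) = contract (\<lambda>i a. \<Sum>l\<in>UNIV. Riem l j k i * g l a)"
      by (simp add: contract_def mult.commute g_sym)
    also have "\<dots> = - contract (\<lambda>i a. \<Sum>l\<in>UNIV. Riem l j k a * g l i)"
      unfolding contract_minus[symmetric] by (intro contract_cong Riem_lower_antisym)
    also have "\<dots> = - contract (\<lambda>i a. \<Sum>l\<in>UNIV. Riem l j k i * g l a)"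
      by (subst contract_transpose) (rule refl)
    finally have "2 *\<^sub>R (\<Sum>i\<in>UNIV. Riem i j k i) = 0"
      using e by (simp add: scaleR_2 eq_neg_iff_add_eq_0)
    then show ?thesis by simp
  qed
  have "Ric j k - Ric k j = (\<Sum>i\<in>UNIV. Riem i i j k - Riem i i k j)"
    by (simp add: Ric_def sum_subtractf)
  also have "\<dots> = (\<Sum>i\<in>UNIV. - Riem i j k i)"
  proof (rule sum.cong[OF refl])
    fix i show "Riem i i j k - Riem i i k j = - Riem i j k i"
      using Riem_cyclic[of i i j k] Riem_antisym[of i k i j] by (simp add: algebra_simps eq_neg_iff_add_eq_0)
  qed
  finally show ?thesis using * by (simp add: sum_negf)
qed

text \<open>The trace over the direction \<open>a\<close> and the argument \<open>b\<close> is not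
  the one that defines \<open>Ric\<close>. Antisymmetry of the lowered curvature exchanges the
  argument with the upper index, which costs the sign.\<close>

lemma contract_Riem: "contract (\<lambda>a b. \<Sum>l\<in>UNIV. Riem l a i b * X l) = - contract (\<lambda>l p. Ric i p * X l)"
proof -
  have *: "(\<Sum>l\<in>UNIV. Riem l a i b * X l) = contract (\<lambda>l p. (\<Sum>m\<in>UNIV. Riem m a i b * g m p) * X l)" for a b
  proof -
    have "(\<Sum>l\<in>UNIV. Riem l a i b * X l) = (\<Sum>l\<in>UNIV. (\<Sum>p\<in>UNIV. q l p * (\<Sum>m\<in>UNIV. g p m * Riem m a i b)) * X l)"
      by (simp only: sum_gq)
    then show ?thesis
      unfolding contract_def by (simp add: sum_distrib_right mult.assoc mult.commute[of "g _ _"] g_sym)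
  qed
  have "contract (\<lambda>a b. \<Sum>l\<in>UNIV. Riem l a i b * X l) = - contract (\<lambda>a b. contract (\<lambda>l p. (\<Sum>m\<in>UNIV. Riem m a i p * g m b) * X l))"
    unfolding * contract_minus[symmetric]
    by (intro contract_cong) (subst Riem_lower_antisym, simp)
  also have "\<dots> = - contract (\<lambda>l p. contract (\<lambda>a b. (\<Sum>m\<in>UNIV. Riem m a i p * g m b)) * X l)"
    by (subst contract_swap) (simp add: contract_mult_right)
  also have "\<dots> = - contract (\<lambda>l p. Ric i p * X l)"
  proof -
    have "contract (\<lambda>a b. (\<Sum>m\<in>UNIV. Riem m a i p * g m b)) = Ric i p" for p
    proof -
      have "contract (\<lambda>a b. (\<Sum>m\<in>UNIV. Riem m a i p * g m b)) = (\<Sum>a\<in>UNIV. \<Sum>b\<in>UNIV. q a b * (\<Sum>m\<in>UNIV. g b m * Riem m a i p))"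
        by (simp add: contract_def mult_ac g_sym)
      then show ?thesis by (simp only: sum_gq Ric_def)
    qed
    then show ?thesis by simp
  qed
  finally show ?thesis .
qed

end

section \<open>Variation formulas, Bianchi identity and Bochner formula\<close>

context metric_algebra begin

text \<open>The sign is that of the divergence, so the codifferential is
  \<open>- divg\<close>.\<close>

definition divg :: "('n list \<Rightarrow> 'a) \<Rightarrow> 'n list \<Rightarrow> 'a" where
  "divg T v = contract (\<lambda>a b. nabla T (a # b # v))"

definition Lap :: "'a \<Rightarrow> 'a" where
  "Lap f = divg (nabla (\<lambda>v. f)) []"

definition Scal :: 'a where
  "Scal = contract Ric"

lemma cov_cong: "(\<And>w. length w = length v \<Longrightarrow> S w = T w) \<Longrightarrow> cov m S v = cov m T v"
proof (induction v arbitrary: S T)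
  case Nil
  then show ?case by (simp add: cov_Nil)
next
  case (Cons i v)
  have "cov m (\<lambda>v. S (i # v)) v = cov m (\<lambda>v. T (i # v)) v"
    by (rule Cons.IH) (simp add: Cons.prems)
  then show ?case by (simp add: cov_Cons Cons.prems)
qed

lemma nabla_const: "nabla (\<lambda>v. f) [i] = D i f"
  by (simp add: cov_def)

lemma D_contract_tensor: "D m (contract (\<lambda>i j. T [i, j])) = contract (\<lambda>i j. nabla T [m, i, j])"
  using cov_contract[of m T "[]"] by (simp add: cov_Nil)

lemma nabla_divg: "nabla (divg T) (m # v) = contract (\<lambda>a b. nabla (nabla T) (m # a # b # v))"
  unfolding divg_def using cov_contract[of m "nabla T" v] by simp

lemma divg_divg: "divg (divg T) v = contract (\<lambda>a b. contract (\<lambda>c e. nabla (nabla T) (a # c # e # b # v)))"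
  by (simp add: divg_def[of "divg T"] nabla_divg del: nabla.simps)

lemma divg_cong: "(\<And>w. length w = Suc (length v) \<Longrightarrow> S w = T w) \<Longrightarrow> divg S v = divg T v"
  unfolding divg_def by (intro contract_cong) (auto intro: cov_cong)

lemma divg_add: "divg (\<lambda>v. S v + T v) v = divg S v + divg T v"
  by (simp add: divg_def cov_add contract_add)

lemma divg_scaleR: "divg (\<lambda>v. c *\<^sub>R T v) v = c *\<^sub>R divg T v"
  by (simp add: divg_def cov_scaleR contract_scaleR)

lemma divg_minus: "divg (\<lambda>v. - T v) v = - divg T v"
  by (simp add: divg_def cov_minus contract_minus)

lemma Lap_add: "Lap (x + y) = Lap x + Lap y"
  by (simp add: Lap_def divg_def contract_add[symmetric] cov_Cons cov_Nil D_rules algebra_simps sum.distrib)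

lemma Lap_scaleR: "Lap (c *\<^sub>R x) = c *\<^sub>R Lap x"
  by (simp add: Lap_def divg_def contract_scaleR[symmetric] cov_Cons cov_Nil D_rules algebra_simps scaleR_sum_right)

lemma Lap_0: "Lap 0 = 0"
  using Lap_scaleR[of 0 0] by simp

lemma Lap_sum: "Lap (sum f S) = (\<Sum>i\<in>S. Lap (f i))"
  by (induction S rule: infinite_finite_induct) (simp_all add: Lap_0 Lap_add)

text \<open>Commuting the two derivatives under the trace leaves \<open>contract_Riem\<close>. It is
  applied to the differential of a function in the Bochner formula and to a lowered coordinate field
  in the Bianchi identity.\<close>

lemma Ricci_identity_contracted:
  "contract (\<lambda>a b. nabla (nabla X) [a, i, b]) = D i (contract (\<lambda>a b. nabla X [a, b])) + contract (\<lambda>l p. Ric i p * X [l])"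
proof -
  have "contract (\<lambda>a b. nabla (nabla X) [a, i, b]) - contract (\<lambda>a b. nabla (nabla X) [i, a, b])
      = - contract (\<lambda>a b. \<Sum>l\<in>UNIV. Riem l a i b * X [l])"
    unfolding contract_diff[symmetric] contract_minus[symmetric] nabla_nabla_commutator by simp
  then show ?thesis
    unfolding contract_Riem D_contract_tensor by (simp add: algebra_simps)
qed

lemma nabla_nabla_transpose:
  "nabla (nabla (\<lambda>v. T [v ! 1, v ! 0])) [a, b, i, j] = nabla (nabla T) [a, b, j, i]"
proof -
  have *: "cov b (\<lambda>v. T [v ! 1, v ! 0]) [i, j] = cov b T [j, i]" for b i j
    by (simp add: cov_Cons cov_Nil)
  show ?thesis
    by (simp add: cov_Cons[of a] cov_Nil * algebra_simps del: One_nat_def)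
qed

text \<open>Exchanging the two derivatives costs one curvature term for each index of
  \<open>T\<close>. After tracing, both become contractions of \<open>T\<close> with the Ricci
  tensor, with opposite signs, and they agree because \<open>Ric\<close> is symmetric.\<close>

lemma divg_divg_transpose: "divg (divg (\<lambda>v. T [v ! 1, v ! 0])) [] = divg (divg T) []"
proof -
  have "contract (\<lambda>a b. contract (\<lambda>c e. nabla (nabla T) [a, c, b, e])) = contract (\<lambda>c e. contract (\<lambda>a b. nabla (nabla T) [a, c, b, e]))"
    by (rule contract_swap)
  then have "divg (divg T) [] - divg (divg (\<lambda>v. T [v ! 1, v ! 0])) [] =
     contract (\<lambda>a b. contract (\<lambda>c e. nabla (nabla T) [a, c, e, b] - nabla (nabla T) [c, a, e, b]))"
    by (simp only: divg_divg nabla_nabla_transpose contract_diff)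
  also have "\<dots> = contract (\<lambda>a b. contract (\<lambda>c e. - (\<Sum>l\<in>UNIV. Riem l a c e * T [l, b]) - (\<Sum>l\<in>UNIV. Riem l a c b * T [e, l])))"
    by (simp only: nabla_nabla_commutator) (simp add: minus_diff_commute)
  also have "\<dots> = contract (\<lambda>a b. contract (\<lambda>c e. \<Sum>l\<in>UNIV. Riem l c a e * T [l, b])) - contract (\<lambda>c e. contract (\<lambda>a b. \<Sum>l\<in>UNIV. Riem l a c b * T [e, l]))"
  proof -
    have "- (\<Sum>l\<in>UNIV. Riem l a c e * T [l, b]) = (\<Sum>l\<in>UNIV. Riem l c a e * T [l, b])" for a b c e
      unfolding Riem_antisym[of _ a c] by (simp add: sum_negf)
    then show ?thesis
      unfolding contract_diff by (subst (3) contract_swap) simp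
  qed
  also have "\<dots> = contract (\<lambda>c e. contract (\<lambda>l p. Ric c p * T [e, l])) - contract (\<lambda>a b. contract (\<lambda>l p. Ric a p * T [l, b]))"
    unfolding contract_Riem by (simp add: contract_minus)
  also have "contract (\<lambda>a b. contract (\<lambda>l p. Ric a p * T [l, b])) = contract (\<lambda>l p. contract (\<lambda>a b. Ric a p * T [l, b]))"
    by (rule contract_swap)
  also have "\<dots> = contract (\<lambda>l p. contract (\<lambda>b a. Ric a p * T [l, b]))"
    by (intro contract_cong contract_transpose[symmetric])
  also have "\<dots> = contract (\<lambda>c e. contract (\<lambda>l p. Ric c p * T [e, l]))"
    by (subst contract_transpose[symmetric]) (simp add: Ric_sym)
  finally show ?thesis by simp
qed

end

section \<open>First variation of the connection, the Ricci tensor, the scalar curvature and the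
  Laplacian\<close>

locale metric_variation = metric_algebra D g q
  for D :: "'n::finite \<Rightarrow> 'a::{comm_ring_1,real_algebra_1} \<Rightarrow> 'a" and g q :: "'n \<Rightarrow> 'n \<Rightarrow> 'a" +
  fixes d :: "'a \<Rightarrow> 'a"
  assumes d: "derivation d" and d_D: "d (D i x) = D i (d x)"
begin

lemmas d_rules = derivation_rules[OF d]

text \<open>The variation of the connection is a tensor. Its upper index is lowered to
  \<open>m\<close> because \<open>nabla\<close> acts on covariant tensors only.\<close>

definition dGam_lower :: "'n \<Rightarrow> 'n \<Rightarrow> 'n \<Rightarrow> 'a" where
  "dGam_lower m i j = (\<Sum>l\<in>UNIV. g m l * d (Gam l i j))"

definition dGam_trace :: "'n \<Rightarrow> 'a" where
  "dGam_trace k = (\<Sum>i\<in>UNIV. d (Gam i i k))"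

definition dGam_contr :: "'n \<Rightarrow> 'a" where
  "dGam_contr m = contract (\<lambda>a b. dGam_lower m a b)"

lemma dGam_lower_sym: "dGam_lower m i j = dGam_lower m j i"
  by (simp add: dGam_lower_def Gam_sym)

lemma dGam_raise: "d (Gam l i j) = (\<Sum>a\<in>UNIV. q l a * dGam_lower a i j)"
  by (simp add: dGam_lower_def sum_gq)

text \<open>This is the variation of \<nabla> g = 0: the terms of \<open>D_g\<close> in which
  \<open>g\<close> varies combine with the derivative of \<open>d g\<close>, and those in which the
  symbols vary remain.\<close>

lemma nabla_dg: "nabla (\<lambda>v. d (g (v ! 0) (v ! 1))) [m, i, j] = dGam_lower j m i + dGam_lower i m j"
proof -
  have "D m (d (g i j)) = d (D m (g i j))" by (simp add: d_D)
  then show ?thesis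
    unfolding D_g by (simp add: cov_Cons cov_Nil d_rules sum.distrib dGam_lower_def g_sym algebra_simps)
qed

lemma contract_dGam_lower: "contract (\<lambda>a b. dGam_lower b a m) = dGam_trace m"
  by (simp add: dGam_trace_def dGam_raise contract_def)

lemma D_trace_dg: "D m (contract (\<lambda>i j. d (g i j))) = 2 *\<^sub>R dGam_trace m"
proof -
  have "D m (contract (\<lambda>i j. d (g i j))) = contract (\<lambda>i j. dGam_lower j m i + dGam_lower i m j)"
    using D_contract_tensor[of m "\<lambda>v. d (g (v ! 0) (v ! 1))"] unfolding nabla_dg by simp
  also have "\<dots> = contract (\<lambda>i j. dGam_lower j i m) + contract (\<lambda>i j. dGam_lower i j m)"
    unfolding contract_add by (simp add: dGam_lower_sym)
  also have "contract (\<lambda>i j. dGam_lower i j m) = contract (\<lambda>i j. dGam_lower j i m)"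
    by (rule contract_transpose)
  finally show ?thesis by (simp add: contract_dGam_lower scaleR_2)
qed

lemma divg_dg: "divg (\<lambda>v. d (g (v ! 0) (v ! 1))) [m] = dGam_contr m + dGam_trace m"
  unfolding divg_def nabla_dg contract_add dGam_contr_def contract_dGam_lower ..

text \<open>The Palatini identity: the curvature is varied by the antisymmetrized covariant
  derivative of the variation of the connection. The lowered index is put last in the list so that
  \<open>cov_contract\<close> can later trace over the first two.\<close>

lemma d_Ric: "d (Ric j k) = contract (\<lambda>i p. nabla (\<lambda>v. dGam_lower (v ! 2) (v ! 0) (v ! 1)) [i, j, k, p])
     - nabla (\<lambda>v. dGam_trace (v ! 0)) [j, k]"
proof -
  let ?G = "\<lambda>l i j. d (Gam l i j)"
  have 1: "contract (\<lambda>i p. nabla (\<lambda>v. dGam_lower (v ! 2) (v ! 0) (v ! 1)) [i, j, k, p]) =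
     (\<Sum>i\<in>UNIV. D i (?G i j k) + (\<Sum>m\<in>UNIV. Gam i i m * ?G m j k) - (\<Sum>m\<in>UNIV. Gam m i j * ?G i m k)
         - (\<Sum>m\<in>UNIV. Gam m i k * ?G i j m))"
  proof -
    \<comment> \<open>The derivative of a component with one raised index. A Kronecker delta turns
      the single sum into a full contraction, to which \<open>D_contract\<close> applies.\<close>
    have D_raise: "D m (\<Sum>p\<in>UNIV. q i p * X p) = (\<Sum>p\<in>UNIV. q i p * (D m (X p) - (\<Sum>l\<in>UNIV. Gam l m p * X l)))
         - (\<Sum>l\<in>UNIV. Gam i m l * (\<Sum>p\<in>UNIV. q l p * X p))" for m i X
    proof -
      have "D m (\<Sum>p\<in>UNIV. q i p * X p) = D m (contract (\<lambda>k p. (if i = k then 1 else 0) * X p))"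
      proof -
        have "contract (\<lambda>k p. (if i = k then 1 else 0) * X p) = (\<Sum>p\<in>UNIV. \<Sum>k\<in>UNIV. (if i = k then 1 else 0) * (q k p * X p))"
          unfolding contract_def by (subst sum.swap) (simp add: mult.left_commute)
        then show ?thesis unfolding sum_delta_mult by simp
      qed
      also have "\<dots> = contract (\<lambda>k p. (if i = k then 1 else 0) * (D m (X p) - (\<Sum>l\<in>UNIV. Gam l m p * X l))) - contract (\<lambda>k p. Gam i m k * X p)"
        unfolding D_contract contract_diff[symmetric]
        by (intro contract_cong) (simp add: D_rules right_diff_distrib sum_distrib_left sum_delta_mult
            mult.left_commute[of "Gam _ _ _"] if_distrib[of "D m"] cong: if_cong)
      also have "contract (\<lambda>k p. (if i = k then 1 else 0) * Y p) = (\<Sum>p\<in>UNIV. q i p * Y p)" for Y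
      proof -
        have "contract (\<lambda>k p. (if i = k then 1 else 0) * Y p) = (\<Sum>p\<in>UNIV. \<Sum>k\<in>UNIV. (if i = k then 1 else 0) * (q k p * Y p))"
          unfolding contract_def by (subst sum.swap) (simp add: mult.left_commute)
        then show ?thesis unfolding sum_delta_mult .
      qed
      finally show ?thesis
        by (simp add: contract_def sum_distrib_left mult.left_commute)
    qed
    have "D i (?G i j k) + (\<Sum>m\<in>UNIV. Gam i i m * ?G m j k) =
        (\<Sum>p\<in>UNIV. q i p * (D i (dGam_lower p j k) - (\<Sum>l\<in>UNIV. Gam l i p * dGam_lower l j k)))" for i
      unfolding dGam_raise D_raise by simp
    moreover have "(\<Sum>m\<in>UNIV. Gam m i j * ?G i m k) = (\<Sum>p\<in>UNIV. q i p * (\<Sum>m\<in>UNIV. Gam m i j * dGam_lower p m k))" for i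
      unfolding dGam_raise sum_distrib_left by (subst sum.swap) (simp add: mult.left_commute)
    moreover have "(\<Sum>m\<in>UNIV. Gam m i k * ?G i j m) = (\<Sum>p\<in>UNIV. q i p * (\<Sum>m\<in>UNIV. Gam m i k * dGam_lower p j m))" for i
      unfolding dGam_raise sum_distrib_left by (subst sum.swap) (simp add: mult.left_commute)
    ultimately show ?thesis
      by (simp add: contract_def cov_Cons cov_Nil right_diff_distrib sum_subtractf)
  qed
  have 2: "nabla (\<lambda>v. dGam_trace (v ! 0)) [j, k] = (\<Sum>i\<in>UNIV. D j (?G i i k)) - (\<Sum>i\<in>UNIV. \<Sum>m\<in>UNIV. Gam m j k * ?G i i m)"
    unfolding dGam_trace_def by (simp add: cov_Cons cov_Nil D_rules sum_distrib_left) (rule sum.swap)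
  have 3: "(\<Sum>i\<in>UNIV. \<Sum>m\<in>UNIV. Gam m i j * ?G i m k) = (\<Sum>i\<in>UNIV. \<Sum>m\<in>UNIV. Gam i j m * ?G m i k)"
    by (subst sum.swap) (simp add: Gam_sym)
  show ?thesis
    unfolding 1 2 Ric_def Riem_def
    by (simp add: d_rules d_D sum.distrib sum_subtractf 3 Gam_sym[of _ j] algebra_simps)
qed

text \<open>The traced Palatini identity is div of \<open>dGam_contr\<close> minus div of
  \<open>dGam_trace\<close>. The double divergence of \<open>d g\<close> is the sum of these two
  terms, and the Laplacian of its trace is twice the second.\<close>

lemma d_Scal: "d Scal = divg (divg (\<lambda>v. d (g (v ! 0) (v ! 1)))) [] - Lap (contract (\<lambda>i j. d (g i j)))
     - contract (\<lambda>i a. contract (\<lambda>j b. d (g a b) * Ric i j))"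
proof -
  have 1: "contract (\<lambda>j k. d (Ric j k)) = divg (\<lambda>v. dGam_contr (v ! 0)) [] - divg (\<lambda>v. dGam_trace (v ! 0)) []"
  proof -
    have "contract (\<lambda>j k. contract (\<lambda>i p. nabla (\<lambda>v. dGam_lower (v ! 2) (v ! 0) (v ! 1)) [i, j, k, p])) =
      contract (\<lambda>i p. cov i (\<lambda>v. contract (\<lambda>j k. dGam_lower (v ! 0) j k)) [p])"
      using cov_contract[of _ "\<lambda>v. dGam_lower (v ! 2) (v ! 0) (v ! 1)" "[_]"]
      by (subst contract_swap) simp
    then show ?thesis
      unfolding d_Ric contract_diff by (simp add: divg_def dGam_contr_def)
  qed
  have 2: "divg (divg (\<lambda>v. d (g (v ! 0) (v ! 1)))) [] = divg (\<lambda>v. dGam_contr (v ! 0)) [] + divg (\<lambda>v. dGam_trace (v ! 0)) []"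
    unfolding divg_add[symmetric]
  proof (rule divg_cong)
    fix w :: "'n list" assume "length w = Suc (length [])"
    then obtain m where "w = [m]" by (cases w) auto
    then show "divg (\<lambda>v. d (g (v ! 0) (v ! 1))) w = dGam_contr (w ! 0) + dGam_trace (w ! 0)"
      using divg_dg by simp
  qed
  have 3: "Lap (contract (\<lambda>i j. d (g i j))) = 2 *\<^sub>R divg (\<lambda>v. dGam_trace (v ! 0)) []"
    unfolding divg_scaleR[symmetric] Lap_def
  proof (rule divg_cong)
    fix w :: "'n list" assume "length w = Suc (length [])"
    then obtain m where "w = [m]" by (cases w) auto
    then show "nabla (\<lambda>v. contract (\<lambda>i j. d (g i j))) w = 2 *\<^sub>R dGam_trace (w ! 0)"
      using D_trace_dg by (simp add: nabla_const del: nabla.simps)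
  qed
  show ?thesis
    unfolding Scal_def derivation_contract[OF d] 1 2 3 by (simp add: scaleR_2)
qed

text \<open>The function itself, the inverse metric and the Christoffel symbols vary. The last
  contribute \<open>dGam_contr\<close>, which \<open>divg_dg\<close> and \<open>D_trace_dg\<close>
  express as div of \<open>d g\<close> minus half the differential of its trace.\<close>

lemma d_Lap: "d (Lap f) = Lap (d f)
    - contract (\<lambda>i a. contract (\<lambda>j b. d (g a b) * nabla (nabla (\<lambda>v. f)) [i, j]))
    - contract (\<lambda>l p. (divg (\<lambda>v. d (g (v ! 0) (v ! 1))) [p] - (1/2) *\<^sub>R D p (contract (\<lambda>i j. d (g i j)))) * D l f)"
proof -
  have "contract (\<lambda>i j. d (nabla (nabla (\<lambda>v. f)) [i, j])) = Lap (d f) - contract (\<lambda>i j. \<Sum>l\<in>UNIV. d (Gam l i j) * D l f)"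
    unfolding Lap_def divg_def contract_diff[symmetric]
    by (intro contract_cong) (simp add: cov_Cons cov_Nil d_rules d_D sum.distrib sum_subtractf)
  also have "contract (\<lambda>i j. \<Sum>l\<in>UNIV. d (Gam l i j) * D l f) = contract (\<lambda>i j. contract (\<lambda>l p. dGam_lower p i j * D l f))"
    unfolding dGam_raise by (simp add: contract_def[of "\<lambda>l p. dGam_lower p _ _ * D l f"] sum_distrib_right mult.assoc)
  also have "\<dots> = contract (\<lambda>l p. dGam_contr p * D l f)"
    unfolding dGam_contr_def contract_mult_right[symmetric] by (rule contract_swap)
  finally show ?thesis
    unfolding divg_dg D_trace_dg Lap_def[of f] divg_def[of "nabla (\<lambda>v. f)"] derivation_contract[OF d] by simp
qed

end

section \<open>Contracted Bianchi identity and Bochner formula\<close>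

context metric_algebra begin

text \<open>Apply the variation formula for the scalar curvature to the variation \<open>D m\<close>: here the variation of
  the metric is the symmetrized covariant derivative of the one-form dual to the coordinate field \<open>m\<close>
  (its Lie derivative), and commuting derivatives leaves only the divergence of the Ricci tensor.\<close>

lemma contracted_Bianchi: "2 *\<^sub>R divg (\<lambda>v. Ric (v ! 0) (v ! 1)) [m] = D m Scal"
proof -
  interpret metric_variation D g q "D m"
    by unfold_locales (simp_all add: D D_commute)
  define X where "X = (\<lambda>v. g (v ! 0) m)"
  define Y where "Y = nabla X"
  let ?th = "contract (\<lambda>a b. Y [a, b])"
  have Y: "Y [i, j] = (\<Sum>l\<in>UNIV. Gam l m i * g l j)" for i j
    by (simp add: Y_def X_def cov_Cons cov_Nil D_g[of i j m] g_sym Gam_sym)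
  have h: "D m (g i j) = Y [i, j] + Y [j, i]" for i j
    unfolding Y D_g by (simp add: g_sym)
  have div: "divg (divg (\<lambda>v. D m (g (v ! 0) (v ! 1)))) [] = 2 *\<^sub>R divg (divg (\<lambda>v. Y [v ! 1, v ! 0])) []"
  proof -
    have "divg (divg (\<lambda>v. D m (g (v ! 0) (v ! 1)))) [] = divg (divg (\<lambda>v. Y [v ! 0, v ! 1])) [] + divg (divg (\<lambda>v. Y [v ! 1, v ! 0])) []"
      unfolding h divg_add[symmetric] by (intro divg_cong) (simp add: divg_add)
    also have "divg (divg (\<lambda>v. Y [v ! 0, v ! 1])) [] = divg (divg Y) []"
    proof (intro divg_cong)
      fix w u :: "'n list" assume "length w = Suc (length ([] :: 'n list))" "length u = Suc (length w)"
      then show "Y [u ! 0, u ! 1] = Y u"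
        by (cases u; cases "tl u") auto
    qed
    finally show ?thesis using divg_divg_transpose[of Y] by (simp add: scaleR_2)
  qed
  have dvY: "divg (\<lambda>v. Y [v ! 1, v ! 0]) [j] = D j ?th + Ric j m" for j
  proof -
    have "divg (\<lambda>v. Y [v ! 1, v ! 0]) [j] = contract (\<lambda>a b. nabla (nabla X) [a, j, b])"
      unfolding divg_def by (intro contract_cong) (simp add: Y_def cov_Cons cov_Nil)
    also have "\<dots> = D j ?th + contract (\<lambda>l p. g l m * Ric j p)"
      unfolding Ricci_identity_contracted by (simp add: Y_def X_def mult.commute)
    finally show ?thesis by (simp add: contract_g)
  qed
  have "divg (divg (\<lambda>v. Y [v ! 1, v ! 0])) [] = Lap ?th + divg (\<lambda>v. Ric (v ! 0) m) []"
    unfolding Lap_def divg_add[symmetric]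
  proof (rule divg_cong)
    fix w :: "'n list" assume "length w = Suc (length ([] :: 'n list))"
    then obtain j where w: "w = [j]" by (cases w) auto
    show "divg (\<lambda>v. Y [v ! 1, v ! 0]) w = nabla (\<lambda>v. ?th) w + Ric (w ! 0) m"
      unfolding w nabla_const dvY by simp
  qed
  \<comment> \<open>On the left \<open>m\<close> is a label, on the right an index of the tensor.
    The resulting connection term is the one that \<open>RY\<close> cancels at the end.\<close>
  also have "divg (\<lambda>v. Ric (v ! 0) m) [] = divg (\<lambda>v. Ric (v ! 0) (v ! 1)) [m]
     + contract (\<lambda>a b. \<Sum>l\<in>UNIV. Gam l a m * Ric b l)"
    unfolding divg_def contract_add[symmetric] by (intro contract_cong) (simp add: cov_Cons cov_Nil)
  also have "contract (\<lambda>a b. \<Sum>l\<in>UNIV. Gam l a m * Ric b l) = contract (\<lambda>a b. contract (\<lambda>j e. Y [a, j] * Ric b e))"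
  proof (intro contract_cong)
    fix a b
    have "(\<Sum>l\<in>UNIV. Gam l a m * Ric b l) = (\<Sum>l\<in>UNIV. (\<Sum>j\<in>UNIV. q l j * (\<Sum>p\<in>UNIV. g j p * Gam p m a)) * Ric b l)"
      unfolding sum_gq by (simp add: Gam_sym)
    also have "\<dots> = (\<Sum>l\<in>UNIV. \<Sum>j\<in>UNIV. q l j * (Y [a, j] * Ric b l))"
    proof -
      have "Y [a, j] = (\<Sum>p\<in>UNIV. g j p * Gam p m a)" for j
        unfolding Y by (simp add: mult.commute g_sym)
      then show ?thesis by (simp only: sum_distrib_right mult.assoc)
    qed
    also have "\<dots> = contract (\<lambda>e j. Y [a, j] * Ric b e)"
      by (simp add: contract_def)
    also have "\<dots> = contract (\<lambda>j e. Y [a, j] * Ric b e)"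
      by (rule contract_transpose)
    finally show "(\<Sum>l\<in>UNIV. Gam l a m * Ric b l) = contract (\<lambda>j e. Y [a, j] * Ric b e)" .
  qed
  finally have dd: "divg (divg (\<lambda>v. Y [v ! 1, v ! 0])) [] = Lap ?th + (divg (\<lambda>v. Ric (v ! 0) (v ! 1)) [m]
     + contract (\<lambda>a b. contract (\<lambda>j e. Y [a, j] * Ric b e)))" .
  have tr: "contract (\<lambda>i j. D m (g i j)) = 2 *\<^sub>R ?th"
    unfolding h contract_add by (subst (2) contract_transpose) (simp add: scaleR_2)
  have RY: "contract (\<lambda>i a. contract (\<lambda>j b. D m (g a b) * Ric i j)) = 2 *\<^sub>R contract (\<lambda>a b. contract (\<lambda>j e. Y [a, j] * Ric b e))"
  proof -
    have "contract (\<lambda>a b. contract (\<lambda>j e. Y [a, j] * Ric b e)) = contract (\<lambda>i a. contract (\<lambda>j e. Y [a, j] * Ric i e))"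
      by (rule contract_transpose[symmetric])
    also have "\<dots> = contract (\<lambda>i a. contract (\<lambda>j b. Y [a, b] * Ric i j))"
      by (rule contract_cong) (rule contract_transpose[symmetric])
    finally have 1: "contract (\<lambda>i a. contract (\<lambda>j b. Y [a, b] * Ric i j)) = contract (\<lambda>a b. contract (\<lambda>j e. Y [a, j] * Ric b e))"
      by (rule sym)
    have "contract (\<lambda>i a. contract (\<lambda>j b. Y [b, a] * Ric i j)) = contract (\<lambda>j b. contract (\<lambda>i a. Y [b, a] * Ric j i))"
      by (subst contract_swap) (simp add: Ric_sym)
    then have 2: "contract (\<lambda>i a. contract (\<lambda>j b. Y [b, a] * Ric i j)) = contract (\<lambda>a b. contract (\<lambda>j e. Y [a, j] * Ric b e))"
      using 1 by simp
    show ?thesis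
      unfolding h distrib_right contract_add 1 2 by (simp add: scaleR_2)
  qed
  show ?thesis
    using d_Scal unfolding div dd tr RY Lap_scaleR by (simp add: scaleR_add_right)
qed

text \<open>The gradient of |\<nabla> f|^2 is twice the Hessian applied to \<nabla> f. In its
  divergence the derivative of the Hessian is reordered by symmetry of the Hessian, and
  \<open>Ricci_identity_contracted\<close> turns its trace into the differential of \<Delta> f plus
  a Ricci term.\<close>

lemma Bochner:
  "Lap (contract (\<lambda>i j. D i f * D j f)) = 2 *\<^sub>R contract (\<lambda>a b. contract (\<lambda>i j. nabla (nabla (\<lambda>v. f)) [a, i] * nabla (nabla (\<lambda>v. f)) [b, j]))
     + 2 *\<^sub>R contract (\<lambda>i j. D i (Lap f) * D j f) + 2 *\<^sub>R contract (\<lambda>i j. contract (\<lambda>l p. Ric i p * D l f) * D j f)"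
proof -
  define Hs where "Hs = nabla (nabla (\<lambda>v. f))"
  have Hs_sym: "Hs [i, j] = Hs [j, i]" for i j
    using D_commute by (simp add: Hs_def cov_Cons cov_Nil Gam_sym)
  have 1: "D a (contract (\<lambda>i j. D i f * D j f)) = 2 *\<^sub>R contract (\<lambda>i j. Hs [a, i] * D j f)" for a
  proof -
    have "D a (contract (\<lambda>i j. D i f * D j f)) = contract (\<lambda>i j. Hs [a, i] * D j f + Hs [a, j] * D i f)"
      unfolding D_contract by (intro contract_cong) (simp add: Hs_def cov_Cons cov_Nil D_rules sum_distrib_left sum_distrib_right algebra_simps)
    then show ?thesis
      unfolding contract_add by (subst (asm) (2) contract_transpose) (simp add: scaleR_2)
  qed
  have "Lap (contract (\<lambda>i j. D i f * D j f)) = 2 *\<^sub>R divg (\<lambda>v. contract (\<lambda>i j. Hs [v ! 0, i] * D j f)) []"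
    unfolding Lap_def divg_scaleR[symmetric]
  proof (rule divg_cong)
    fix w :: "'n list" assume "length w = Suc (length ([] :: 'n list))"
    then obtain j where w: "w = [j]" by (cases w) auto
    show "nabla (\<lambda>v. contract (\<lambda>i j. D i f * D j f)) w = 2 *\<^sub>R contract (\<lambda>i j. Hs [w ! 0, i] * D j f)"
      unfolding w nabla_const 1 by simp
  qed
  also have "divg (\<lambda>v. contract (\<lambda>i j. Hs [v ! 0, i] * D j f)) [] =
     contract (\<lambda>a b. contract (\<lambda>i j. nabla Hs [a, b, i] * D j f + Hs [b, i] * Hs [a, j]))"
  proof (unfold divg_def, intro contract_cong)
    fix a b
    have "nabla (\<lambda>v. contract (\<lambda>i j. Hs [v ! 0, i] * D j f)) [a, b] = contract (\<lambda>i j. cov a (\<lambda>v. Hs [v ! 2, v ! 0] * D (v ! 1) f) [i, j, b])"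
      using cov_contract[of a "\<lambda>v. Hs [v ! 2, v ! 0] * D (v ! 1) f" "[b]"] by simp
    also have "\<dots> = contract (\<lambda>i j. nabla Hs [a, b, i] * D j f + Hs [b, i] * Hs [a, j])"
      unfolding Hs_def[symmetric]
      by (intro contract_cong) (simp add: cov_Cons[of a] cov_Nil D_rules sum_distrib_left sum_distrib_right Hs_def algebra_simps)
    finally show "nabla (\<lambda>v. contract (\<lambda>i j. Hs [v ! 0, i] * D j f)) [a, b] = contract (\<lambda>i j. nabla Hs [a, b, i] * D j f + Hs [b, i] * Hs [a, j])" .
  qed
  also have "\<dots> = contract (\<lambda>i j. contract (\<lambda>a b. nabla Hs [a, i, b]) * D j f) + contract (\<lambda>a b. contract (\<lambda>i j. Hs [a, i] * Hs [b, j]))"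
  proof -
    have "nabla Hs [a, b, i] = nabla Hs [a, i, b]" for a b i
      using Hs_sym by (simp add: cov_Cons cov_Nil)
    moreover have "contract (\<lambda>a b. contract (\<lambda>i j. Hs [b, i] * Hs [a, j])) = contract (\<lambda>a b. contract (\<lambda>i j. Hs [a, i] * Hs [b, j]))"
      by (subst contract_transpose[symmetric]) (rule refl)
    moreover have "contract (\<lambda>a b. contract (\<lambda>i j. nabla Hs [a, i, b] * D j f)) = contract (\<lambda>i j. contract (\<lambda>a b. nabla Hs [a, i, b]) * D j f)"
      by (subst contract_swap) (simp add: contract_mult_right)
    ultimately show ?thesis by (simp add: contract_add)
  qed
  also have "contract (\<lambda>i j. contract (\<lambda>a b. nabla Hs [a, i, b]) * D j f) =
    contract (\<lambda>i j. D i (Lap f) * D j f) + contract (\<lambda>i j. contract (\<lambda>l p. Ric i p * D l f) * D j f)"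
    unfolding Hs_def Ricci_identity_contracted nabla_const Lap_def divg_def distrib_right contract_add ..
  finally show ?thesis
    by (simp add: scaleR_add_right Hs_def)
qed

end

section \<open>Alternating forms\<close>

context metric_algebra begin

text \<open>The full contraction in degree \<open>k\<close>, written as a recursion so that proofs
  can peel off one pair of indices at a time.\<close>

primrec form_dot :: "nat \<Rightarrow> ('n list \<Rightarrow> 'a) \<Rightarrow> ('n list \<Rightarrow> 'a) \<Rightarrow> 'a" where
  "form_dot 0 S T = S [] * T []"
| "form_dot (Suc k) S T = contract (\<lambda>i j. form_dot k (\<lambda>v. S (i # v)) (\<lambda>v. T (j # v)))"

text \<open>\<open>wedge B\<close> antisymmetrizes a one-form \<open>B\<close> with values in forms, as in the definition of the exterior
  derivative.\<close>

primrec wedge :: "('n \<Rightarrow> 'n list \<Rightarrow> 'a) \<Rightarrow> 'n list \<Rightarrow> 'a" where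
  "wedge B [] = 0"
| "wedge B (i # v) = B i v - wedge (\<lambda>l w. B l (i # w)) v"

text \<open>Adjacent transpositions at any position: the property passes to
  \<open>T (i # _)\<close>, as the inductions on the degree require.\<close>

definition alternating :: "('n list \<Rightarrow> 'a) \<Rightarrow> bool" where
  "alternating T \<longleftrightarrow> (\<forall>u i j v. T (u @ i # j # v) = - T (u @ j # i # v))"

lemma alternating_Cons: "alternating T \<Longrightarrow> alternating (\<lambda>v. T (i # v))"
  unfolding alternating_def by (metis append_Cons)

lemma alternating_swap: "alternating T \<Longrightarrow> T (i # j # v) = - T (j # i # v)"
  unfolding alternating_def by (metis append_Nil)

lemma form_dot_sym: "form_dot k S T = form_dot k T S"
proof (induction k arbitrary: S T)
  case (Suc k)
  have "form_dot (Suc k) S T = contract (\<lambda>i j. form_dot k (\<lambda>v. T (j # v)) (\<lambda>v. S (i # v)))"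
    by (simp add: Suc[of "\<lambda>v. S (_ # v)"])
  also have "\<dots> = form_dot (Suc k) T S"
    unfolding form_dot.simps by (rule contract_transpose)
  finally show ?case .
qed (simp add: mult.commute)

lemma form_dot_add: "form_dot k (\<lambda>v. S v + S' v) T = form_dot k S T + form_dot k S' T"
  by (induction k arbitrary: S S' T) (simp_all add: distrib_right contract_add)

lemma form_dot_mult: "form_dot k (\<lambda>v. c * S v) T = c * form_dot k S T"
  by (induction k arbitrary: S T) (simp_all add: mult.assoc contract_mult)

lemma form_dot_minus: "form_dot k (\<lambda>v. - S v) T = - form_dot k S T"
  using form_dot_mult[of k "- 1" S T] by simp

lemma form_dot_diff: "form_dot k (\<lambda>v. S v - S' v) T = form_dot k S T - form_dot k S' T"
  using form_dot_add[of k S "\<lambda>v. - S' v" T] by (simp add: form_dot_minus)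

lemma form_dot_0: "form_dot k (\<lambda>v. 0) T = 0"
  using form_dot_mult[of k 0 T T] by simp

lemma form_dot_sum: "form_dot k (\<lambda>v. \<Sum>i\<in>I. S i v) T = (\<Sum>i\<in>I. form_dot k (S i) T)"
  by (induction I rule: infinite_finite_induct) (simp_all add: form_dot_0 form_dot_add)

lemma form_dot_contract: "form_dot k (\<lambda>v. contract (\<lambda>i j. S i j v)) T = contract (\<lambda>i j. form_dot k (S i j) T)"
  by (simp add: contract_def form_dot_sum form_dot_mult)

lemma form_dot_add_right: "form_dot k T (\<lambda>v. S v + S' v) = form_dot k T S + form_dot k T S'"
  and form_dot_mult_right: "form_dot k T (\<lambda>v. c * S v) = c * form_dot k T S"
  and form_dot_minus_right: "form_dot k T (\<lambda>v. - S v) = - form_dot k T S"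
  and form_dot_diff_right: "form_dot k T (\<lambda>v. S v - S' v) = form_dot k T S - form_dot k T S'"
  and form_dot_sum_right: "form_dot k T (\<lambda>v. \<Sum>i\<in>I. U i v) = (\<Sum>i\<in>I. form_dot k T (U i))"
  and form_dot_contract_right: "form_dot k T (\<lambda>v. contract (\<lambda>i j. V i j v)) = contract (\<lambda>i j. form_dot k T (V i j))"
  unfolding form_dot_sym[of k T] by (rule form_dot_add form_dot_mult form_dot_minus form_dot_diff form_dot_sum form_dot_contract)+

lemma form_dot_cong: "(\<And>v. length v = k \<Longrightarrow> S v = S' v) \<Longrightarrow> (\<And>v. length v = k \<Longrightarrow> T v = T' v) \<Longrightarrow> form_dot k S T = form_dot k S' T'"
proof (induction k arbitrary: S T S' T')
  case (Suc k)
  show ?case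
    unfolding form_dot.simps by (intro contract_cong Suc.IH) (simp_all add: Suc.prems)
qed simp

lemma D_form_dot: "D m (form_dot k S T) = form_dot k (cov m S) T + form_dot k S (cov m T)"
proof (induction k arbitrary: S T)
  case 0
  then show ?case by (simp add: cov_Nil D_rules)
next
  case (Suc k)
  show ?case
    by (simp add: D_contract Suc cov_Cons form_dot_diff form_dot_diff_right form_dot_sum form_dot_sum_right form_dot_mult form_dot_mult_right
        contract_add[symmetric]) (simp add: algebra_simps)
qed

text \<open>Each of the \<open>Suc k\<close> slots in which \<open>A\<close> can act contributes
  equally: moving the slot to the front changes the sign of both forms.\<close>

lemma form_dot_act:
  assumes "alternating S" "alternating T"
  shows "form_dot (Suc k) (act A S) T =
    real (Suc k) *\<^sub>R contract (\<lambda>i j. \<Sum>l\<in>UNIV. A l i * form_dot k (\<lambda>v. S (l # v)) (\<lambda>v. T (j # v)))"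
  using assms
proof (induction k arbitrary: S T)
  case 0
  then show ?case by (simp add: sum_distrib_right mult.assoc)
next
  case (Suc k)
  let ?B = "contract (\<lambda>i j. \<Sum>l\<in>UNIV. A l i * form_dot (Suc k) (\<lambda>v. S (l # v)) (\<lambda>v. T (j # v)))"
  have "form_dot (Suc (Suc k)) (act A S) T = contract (\<lambda>i j. form_dot (Suc k) (act A (\<lambda>v. S (i # v))) (\<lambda>v. T (j # v))) + ?B"
    unfolding form_dot.simps(2)[of "Suc k"] act.simps form_dot_add form_dot_sum form_dot_mult contract_add ..
  also have "contract (\<lambda>i j. form_dot (Suc k) (act A (\<lambda>v. S (i # v))) (\<lambda>v. T (j # v))) =
     real (Suc k) *\<^sub>R contract (\<lambda>i j. contract (\<lambda>a b. \<Sum>l\<in>UNIV. A l a * form_dot k (\<lambda>v. S (i # l # v)) (\<lambda>v. T (j # b # v))))"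
    by (simp only: Suc.IH alternating_Cons Suc.prems contract_scaleR)
  also have "contract (\<lambda>i j. contract (\<lambda>a b. \<Sum>l\<in>UNIV. A l a * form_dot k (\<lambda>v. S (i # l # v)) (\<lambda>v. T (j # b # v)))) = ?B"
  proof -
    have "form_dot k (\<lambda>v. S (i # l # v)) (\<lambda>v. T (j # b # v)) = form_dot k (\<lambda>v. S (l # i # v)) (\<lambda>v. T (b # j # v))" for i j l b
      unfolding alternating_swap[OF Suc.prems(1), of i l] alternating_swap[OF Suc.prems(2), of j b]
      by (simp add: form_dot_minus form_dot_minus_right)
    then show ?thesis
      by (subst contract_swap) (simp add: contract_sum contract_mult)
  qed
  finally show ?case
    by (simp only: of_nat_Suc[of "Suc k"] scaleR_add_left scaleR_one scaleR_minus_right diff_minus_eq_add add.commute)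
qed

text \<open>All \<open>Suc k\<close> summands of the antisymmetrization contribute equally: the sign
  in \<open>wedge\<close> is undone by a swap of arguments of \<open>T\<close>.\<close>

lemma form_dot_wedge:
  assumes "alternating T"
  shows "form_dot (Suc k) (wedge B) T = real (Suc k) *\<^sub>R contract (\<lambda>i j. form_dot k (B i) (\<lambda>v. T (j # v)))"
  using assms
proof (induction k arbitrary: B T)
  case 0
  then show ?case by simp
next
  case (Suc k)
  let ?B = "contract (\<lambda>i j. form_dot (Suc k) (B i) (\<lambda>v. T (j # v)))"
  have "form_dot (Suc (Suc k)) (wedge B) T = ?B - contract (\<lambda>i j. form_dot (Suc k) (wedge (\<lambda>l v. B l (i # v))) (\<lambda>v. T (j # v)))"
    unfolding form_dot.simps(2)[of "Suc k"] wedge.simps form_dot_diff contract_diff ..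
  also have "contract (\<lambda>i j. form_dot (Suc k) (wedge (\<lambda>l v. B l (i # v))) (\<lambda>v. T (j # v))) =
     real (Suc k) *\<^sub>R contract (\<lambda>i j. contract (\<lambda>a b. form_dot k (\<lambda>v. B a (i # v)) (\<lambda>v. T (j # b # v))))"
    by (simp only: Suc.IH alternating_Cons Suc.prems contract_scaleR)
  also have "contract (\<lambda>i j. contract (\<lambda>a b. form_dot k (\<lambda>v. B a (i # v)) (\<lambda>v. T (j # b # v)))) = - ?B"
  proof -
    have "form_dot k (\<lambda>v. B a (i # v)) (\<lambda>v. T (j # b # v)) = - form_dot k (\<lambda>v. B a (i # v)) (\<lambda>v. T (b # j # v))" for i j a b
      unfolding alternating_swap[OF Suc.prems(1), of j b] by (simp add: form_dot_minus_right)
    then have "contract (\<lambda>i j. contract (\<lambda>a b. form_dot k (\<lambda>v. B a (i # v)) (\<lambda>v. T (j # b # v)))) =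
       contract (\<lambda>i j. contract (\<lambda>a b. - form_dot k (\<lambda>v. B a (i # v)) (\<lambda>v. T (b # j # v))))"
      by (intro contract_cong)
    also have "\<dots> = - contract (\<lambda>a b. contract (\<lambda>i j. form_dot k (\<lambda>v. B a (i # v)) (\<lambda>v. T (b # j # v))))"
      unfolding contract_minus by (rule arg_cong[OF contract_swap])
    finally show ?thesis by simp
  qed
  finally show ?case
    by (simp only: of_nat_Suc[of "Suc k"] scaleR_add_left scaleR_one scaleR_minus_right diff_minus_eq_add add.commute)
qed

text \<open>The Christoffel symbols are symmetric and drop out of antisymmetrized covariant derivatives. After
  contraction with an alternating tensor this holds without any assumption on \<open>S\<close>.\<close>

lemma form_dot_act_Gam:
  assumes "alternating T"
  shows "contract (\<lambda>i j. form_dot k (act (\<lambda>l a. Gam l i a) S) (\<lambda>v. T (j # v))) = 0"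
  using assms
proof (induction k arbitrary: S T)
  case 0
  then show ?case by (simp add: contract_0)
next
  case (Suc k)
  let ?X = "contract (\<lambda>i j. contract (\<lambda>a b. \<Sum>l\<in>UNIV. Gam l i a * form_dot k (\<lambda>v. S (l # v)) (\<lambda>v. T (j # b # v))))"
  have "contract (\<lambda>i j. form_dot (Suc k) (act (\<lambda>l a. Gam l i a) S) (\<lambda>v. T (j # v))) =
     contract (\<lambda>i j. contract (\<lambda>a b. form_dot k (act (\<lambda>l a. Gam l i a) (\<lambda>v. S (a # v))) (\<lambda>v. T (j # b # v)))) + ?X"
    unfolding form_dot.simps act.simps form_dot_add form_dot_sum form_dot_mult contract_add ..
  \<comment> \<open>Swapping the first two arguments of \<open>T\<close> makes (i, j) the inner
    contraction, to which the induction hypothesis applies for fixed \<open>a\<close> and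
    \<open>b\<close>.\<close>
  also have "contract (\<lambda>i j. contract (\<lambda>a b. form_dot k (act (\<lambda>l a. Gam l i a) (\<lambda>v. S (a # v))) (\<lambda>v. T (j # b # v)))) =
     - contract (\<lambda>a b. contract (\<lambda>i j. form_dot k (act (\<lambda>l a. Gam l i a) (\<lambda>v. S (a # v))) (\<lambda>v. T (b # j # v))))"
  proof -
    have "form_dot k U (\<lambda>v. T (j # b # v)) = - form_dot k U (\<lambda>v. T (b # j # v))" for U j b
      unfolding alternating_swap[OF Suc.prems(1), of j b] by (simp add: form_dot_minus_right)
    then have "contract (\<lambda>i j. contract (\<lambda>a b. form_dot k (act (\<lambda>l a. Gam l i a) (\<lambda>v. S (a # v))) (\<lambda>v. T (j # b # v)))) =
       contract (\<lambda>i j. contract (\<lambda>a b. - form_dot k (act (\<lambda>l a. Gam l i a) (\<lambda>v. S (a # v))) (\<lambda>v. T (b # j # v))))"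
      by (intro contract_cong)
    then show ?thesis
      unfolding contract_minus by (rule trans) (rule arg_cong[OF contract_swap])
  qed
  also have "\<dots> = 0"
    using Suc.IH[OF alternating_Cons[OF Suc.prems]] by (simp add: contract_0)
  also have "?X = 0"
  proof -
    have "?X = - contract (\<lambda>i j. contract (\<lambda>a b. \<Sum>l\<in>UNIV. Gam l a i * form_dot k (\<lambda>v. S (l # v)) (\<lambda>v. T (b # j # v))))"
    proof -
      have "(\<Sum>l\<in>UNIV. Gam l i a * form_dot k (\<lambda>v. S (l # v)) (\<lambda>v. T (j # b # v))) =
        - (\<Sum>l\<in>UNIV. Gam l a i * form_dot k (\<lambda>v. S (l # v)) (\<lambda>v. T (b # j # v)))" for i j a b
        unfolding alternating_swap[OF Suc.prems(1), of j b] Gam_sym[of _ i a] by (simp add: form_dot_minus_right sum_negf)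
      then have "?X = contract (\<lambda>i j. contract (\<lambda>a b. - (\<Sum>l\<in>UNIV. Gam l a i * form_dot k (\<lambda>v. S (l # v)) (\<lambda>v. T (b # j # v)))))"
        by (intro contract_cong)
      then show ?thesis by (simp only: contract_minus)
    qed
    also have "\<dots> = - ?X"
      by (rule arg_cong[OF contract_swap])
    finally have "2 *\<^sub>R ?X = 0"
      unfolding scaleR_2 eq_neg_iff_add_eq_0 .
    then show ?thesis by simp
  qed
  finally show ?case by simp
qed

lemma form_dot_exterior_derivative:
  assumes "alternating T"
  shows "form_dot (Suc k) (wedge (\<lambda>l w. D l (S w))) T = real (Suc k) *\<^sub>R contract (\<lambda>i j. form_dot k (cov i S) (\<lambda>v. T (j # v)))"
proof -
  have "contract (\<lambda>i j. form_dot k (cov i S) (\<lambda>v. T (j # v))) = contract (\<lambda>i j. form_dot k (\<lambda>v. D i (S v)) (\<lambda>v. T (j # v)))"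
    unfolding cov_def form_dot_diff contract_diff form_dot_act_Gam[OF assms] by simp
  then show ?thesis
    unfolding form_dot_wedge[OF assms] by simp
qed

text \<open>Closedness evaluated on \<open>j # v\<close> says that the derivative of
  \<open>H\<close> in direction \<open>j\<close> is the exterior derivative of the contraction of
  \<open>H\<close> with the coordinate field \<open>j\<close>. Pairing this with \<open>H\<close>
  gives \<open>Suc k\<close> equal terms, and the connection terms of \<open>cov j\<close> supply
  the one missing for the index \<open>j\<close>, by symmetry of \<open>Gam\<close>.\<close>

lemma D_normsq_closed:
  assumes "alternating H" and closed: "\<And>v. wedge (\<lambda>l w. D l (H w)) v = 0"
  shows "D j (form_dot (Suc k) H H) = (2 * real (Suc k)) *\<^sub>R contract (\<lambda>a b. form_dot k (\<lambda>w. nabla H (a # j # w)) (\<lambda>w. H (b # w)))"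
proof -
  have Hj: "D j (H v) = wedge (\<lambda>l w. D l (H (j # w))) v" for v
    using closed[of "j # v"] by simp
  have "form_dot (Suc k) (cov j H) H = form_dot (Suc k) (wedge (\<lambda>l w. D l (H (j # w)))) H - form_dot (Suc k) (act (\<lambda>l a. Gam l j a) H) H"
    unfolding cov_def form_dot_diff Hj ..
  also have "\<dots> = real (Suc k) *\<^sub>R (contract (\<lambda>a b. form_dot k (cov a (\<lambda>w. H (j # w))) (\<lambda>w. H (b # w)))
      - contract (\<lambda>a b. \<Sum>l\<in>UNIV. Gam l j a * form_dot k (\<lambda>w. H (l # w)) (\<lambda>w. H (b # w))))"
    unfolding form_dot_act[OF assms(1) assms(1)] form_dot_exterior_derivative[OF assms(1)] by (simp add: scaleR_diff_right)
  also have "\<dots> = real (Suc k) *\<^sub>R contract (\<lambda>a b. form_dot k (\<lambda>w. nabla H (a # j # w)) (\<lambda>w. H (b # w)))"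
    unfolding nabla.simps cov_Cons[of _ H] form_dot_diff form_dot_sum form_dot_mult contract_diff by (simp add: Gam_sym[of _ j])
  finally show ?thesis
    unfolding D_form_dot form_dot_sym[of _ H "cov j H"] by (simp add: scaleR_2[symmetric])
qed

lemma nabla_form_dot_family:
  "nabla (\<lambda>v. form_dot k S (\<lambda>w. H (v ! 0 # w))) [a, j] = form_dot k (cov a S) (\<lambda>w. H (j # w)) + form_dot k S (\<lambda>w. nabla H (a # j # w))"
  by (simp add: cov_Cons cov_Nil D_form_dot form_dot_diff_right form_dot_sum_right form_dot_mult_right)

lemma nabla_form_dot_family2:
  "nabla (\<lambda>v. form_dot k (\<lambda>w. H (v ! 0 # w)) (\<lambda>w. H (v ! 1 # w))) [a, i, j] =
     form_dot k (\<lambda>w. nabla H (a # i # w)) (\<lambda>w. H (j # w)) + form_dot k (\<lambda>w. H (i # w)) (\<lambda>w. nabla H (a # j # w))"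
  by (simp add: cov_Cons cov_Nil D_form_dot form_dot_diff_right form_dot_sum_right form_dot_mult_right form_dot_diff form_dot_sum form_dot_mult)

text \<open>The derivative falls on either factor: on the first it forms \<open>divg H\<close>, on
  the second exactly the contraction of \<open>D_normsq_closed\<close>.\<close>

lemma divg_square_closed:
  assumes "alternating H" and closed: "\<And>v. wedge (\<lambda>l w. D l (H w)) v = 0"
  shows "divg (\<lambda>v. form_dot k (\<lambda>w. H (v ! 0 # w)) (\<lambda>w. H (v ! 1 # w))) [j] =
     form_dot k (divg H) (\<lambda>w. H (j # w)) + (1 / (2 * real (Suc k))) *\<^sub>R D j (form_dot (Suc k) H H)"
proof -
  have "divg (\<lambda>v. form_dot k (\<lambda>w. H (v ! 0 # w)) (\<lambda>w. H (v ! 1 # w))) [j] =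
     contract (\<lambda>a b. form_dot k (\<lambda>w. nabla H (a # b # w)) (\<lambda>w. H (j # w))) + contract (\<lambda>a b. form_dot k (\<lambda>w. H (b # w)) (\<lambda>w. nabla H (a # j # w)))"
    unfolding divg_def[of _ "[j]"] nabla_form_dot_family2 contract_add ..
  also have "contract (\<lambda>a b. form_dot k (\<lambda>w. nabla H (a # b # w)) (\<lambda>w. H (j # w))) = form_dot k (divg H) (\<lambda>w. H (j # w))"
    unfolding form_dot_contract[symmetric] divg_def ..
  also have "contract (\<lambda>a b. form_dot k (\<lambda>w. H (b # w)) (\<lambda>w. nabla H (a # j # w))) = (1 / (2 * real (Suc k))) *\<^sub>R D j (form_dot (Suc k) H H)"
    unfolding D_normsq_closed[OF assms] by (simp add: form_dot_sym[of k "\<lambda>w. H (_ # w)"])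
  finally show ?thesis .
qed

lemma divg_form_dot_divg:
  "divg (\<lambda>v. form_dot k (divg H) (\<lambda>w. H (v ! 0 # w))) [] = contract (\<lambda>a b. form_dot k (cov a (divg H)) (\<lambda>w. H (b # w))) + form_dot k (divg H) (divg H)"
  unfolding divg_def[of _ "[]"] nabla_form_dot_family contract_add form_dot_contract_right[symmetric] divg_def[of H, abs_def] ..

end

section \<open>Variation of contractions of forms\<close>

context metric_variation begin

lemma contract_raised_dg: "contract (\<lambda>i j. \<Sum>l\<in>UNIV. (\<Sum>a\<in>UNIV. q l a * d (g a i)) * X l j) = contract (\<lambda>i a. contract (\<lambda>j b. d (g a b) * X i j))"
proof -
  have "contract (\<lambda>i j. \<Sum>l\<in>UNIV. (\<Sum>a\<in>UNIV. q l a * d (g a i)) * X l j) = contract (\<lambda>i j. contract (\<lambda>l a. d (g a i) * X l j))"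
    by (simp add: contract_def[of "\<lambda>l a. d (g a _) * X l _"] sum_distrib_right mult.assoc)
  also have "\<dots> = contract (\<lambda>l a. contract (\<lambda>i j. d (g a i) * X l j))"
    by (rule contract_swap)
  also have "\<dots> = contract (\<lambda>i a. contract (\<lambda>j b. d (g a b) * X i j))"
    by (rule contract_cong) (rule contract_transpose[symmetric])
  finally show ?thesis .
qed

text \<open>Each of the \<open>k\<close> inverse metrics varies. Together these variations are the
  derivation action of the endomorphism obtained from \<open>d g\<close> by raising an
  index.\<close>

lemma d_form_dot: "d (form_dot k S T) = form_dot k (\<lambda>v. d (S v)) T + form_dot k S (\<lambda>v. d (T v))
    - form_dot k (act (\<lambda>l i. \<Sum>a\<in>UNIV. q l a * d (g a i)) S) T"
proof (induction k arbitrary: S T)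
  case 0
  then show ?case by (simp add: d_rules)
next
  case (Suc k)
  show ?case
    by (simp add: derivation_contract[OF d] Suc form_dot_add form_dot_sum form_dot_mult contract_add contract_diff contract_raised_dg)
qed

lemma d_normsq:
  assumes "alternating H"
  shows "d (form_dot (Suc k) H H) = 2 *\<^sub>R form_dot (Suc k) (\<lambda>v. d (H v)) H
    - real (Suc k) *\<^sub>R contract (\<lambda>i a. contract (\<lambda>j b. d (g a b) * form_dot k (\<lambda>v. H (i # v)) (\<lambda>v. H (j # v))))"
  unfolding d_form_dot form_dot_act[OF assms assms] form_dot_sym[of _ H "\<lambda>v. d (H v)"] by (simp add: scaleR_2 contract_raised_dg)

end

section \<open>The flow equations\<close>

text \<open>With d^*H = \<open>- divg H\<close>, the equation \<open>d_H\<close> is the Hodge heat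
  equation for a form with d H = 0. \<open>H_top\<close> matters because contractions run over all
  degrees up to \<open>n\<close>, and contracting \<open>H\<close> with a vector in degree
  \<open>n\<close> involves a component of degree \<open>n + 1\<close>.\<close>

locale generalized_flow = metric_variation D g q d
  for D :: "'n::finite \<Rightarrow> 'a::{comm_ring_1,real_algebra_1} \<Rightarrow> 'a" and g q :: "'n \<Rightarrow> 'n \<Rightarrow> 'a" and d :: "'a \<Rightarrow> 'a" +
  fixes H :: "'n list \<Rightarrow> 'a" and phi :: 'a and n :: nat
  assumes alternating_H: "alternating H"
    and closed_H: "wedge (\<lambda>l w. D l (H w)) v = 0"
    and H_top: "length v = Suc n \<Longrightarrow> H v = 0"
    and d_g: "d (g i j) = (- 2) *\<^sub>R Ric i j + (1/2) *\<^sub>R (\<Sum>k\<le>n. form_dot k (\<lambda>w. H (i # w)) (\<lambda>w. H (j # w)))"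
    and d_H: "d (H v) = - wedge (\<lambda>l w. D l (- divg H w)) v"
    and d_phi: "d phi - Lap phi = (1/4) *\<^sub>R (\<Sum>k=1..n. ((real k - 1) / real k) *\<^sub>R form_dot k H H)"
begin

declare form_dot.simps(2) [simp del]

text \<open>The tensor H^2. Here and in \<open>N\<close>, \<open>\<kappa>\<close> and
  \<open>Z\<close>, the index \<open>k\<close> is the degree after contraction with a vector, so it
  belongs to the component of \<open>H\<close> of degree \<open>k + 1\<close>.\<close>

definition Hsq :: "'n \<Rightarrow> 'n \<Rightarrow> 'a" where
  "Hsq i j = (\<Sum>k<n. form_dot k (\<lambda>w. H (i # w)) (\<lambda>w. H (j # w)))"

abbreviation N :: "nat \<Rightarrow> 'a" where "N k \<equiv> form_dot (Suc k) H H"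

abbreviation \<kappa> :: "nat \<Rightarrow> real" where "\<kappa> k \<equiv> 1 / real (Suc k)"

text \<open>The inner product of 2-tensors, with the arrangement of indices that
  \<open>derivation_contract\<close> produces.\<close>

definition pair :: "('n \<Rightarrow> 'n \<Rightarrow> 'a) \<Rightarrow> ('n \<Rightarrow> 'n \<Rightarrow> 'a) \<Rightarrow> 'a" where
  "pair A B = contract (\<lambda>i a. contract (\<lambda>j b. A a b * B i j))"

text \<open>By \<open>form_dot_exterior_derivative\<close>, \<open>Suc k\<close> times this is the
  pairing of the exterior derivative of div H with \<open>H\<close>. It is never evaluated, since it
  cancels in the end.\<close>

definition Z :: "nat \<Rightarrow> 'a" where
  "Z k = contract (\<lambda>i j. form_dot k (cov i (divg H)) (\<lambda>w. H (j # w)))"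

definition grad_dot :: "'a \<Rightarrow> 'a \<Rightarrow> 'a" where
  "grad_dot u v = contract (\<lambda>i j. D i u * D j v)"

text \<open>The interior product of \<open>H\<close> with the gradient of
  \<open>phi\<close>.\<close>

definition iota :: "'n list \<Rightarrow> 'a" where
  "iota w = contract (\<lambda>i j. D i phi * H (j # w))"

abbreviation Hess :: "'n \<Rightarrow> 'n \<Rightarrow> 'a" where
  "Hess i j \<equiv> nabla (nabla (\<lambda>v. phi)) [i, j]"

abbreviation dphi2 :: "'n \<Rightarrow> 'n \<Rightarrow> 'a" where
  "dphi2 i j \<equiv> D i phi * D j phi"

lemma pair_sym: "pair A B = pair B A"
proof -
  have "pair A B = contract (\<lambda>a i. contract (\<lambda>j b. A a b * B i j))"
    unfolding pair_def by (rule contract_transpose[symmetric])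
  also have "\<dots> = contract (\<lambda>a i. contract (\<lambda>b j. A a b * B i j))"
    by (rule contract_cong) (rule contract_transpose[symmetric])
  finally show ?thesis by (simp add: pair_def mult.commute)
qed

lemma pair_add: "pair (\<lambda>i j. A i j + A' i j) B = pair A B + pair A' B"
  by (simp add: pair_def distrib_right contract_add)

lemma pair_scaleR: "pair (\<lambda>i j. c *\<^sub>R A i j) B = c *\<^sub>R pair A B"
  by (simp add: pair_def contract_scaleR)

lemma pair_sum: "pair (\<lambda>i j. \<Sum>k\<in>K. F k i j) B = (\<Sum>k\<in>K. pair (F k) B)"
  by (simp add: pair_def sum_distrib_right contract_sum)

lemma pair_add_right: "pair B (\<lambda>i j. A i j + A' i j) = pair B A + pair B A'"
  and pair_scaleR_right: "pair B (\<lambda>i j. c *\<^sub>R A i j) = c *\<^sub>R pair B A"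
  unfolding pair_sym[of B] by (rule pair_add pair_scaleR)+

lemma grad_dot_add: "grad_dot (u + u') v = grad_dot u v + grad_dot u' v"
  by (simp add: grad_dot_def D_rules distrib_right contract_add)

lemma grad_dot_scaleR: "grad_dot (c *\<^sub>R u) v = c *\<^sub>R grad_dot u v"
  by (simp add: grad_dot_def D_rules contract_scaleR)

lemma grad_dot_sum: "grad_dot (\<Sum>k\<in>K. f k) v = (\<Sum>k\<in>K. grad_dot (f k) v)"
  by (simp add: grad_dot_def D_rules sum_distrib_right contract_sum)

lemma grad_dot_sym: "grad_dot u v = grad_dot v u"
proof -
  have "grad_dot u v = contract (\<lambda>i j. D j u * D i v)"
    unfolding grad_dot_def by (rule contract_transpose[symmetric])
  then show ?thesis by (simp add: grad_dot_def mult.commute)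
qed

lemma form_dot_n_zero: "form_dot n (\<lambda>w. H (i # w)) T = 0" "form_dot n (divg H) T = 0" "form_dot n iota T = 0"
proof -
  have *: "form_dot n S T = 0" if "\<And>v. length v = n \<Longrightarrow> S v = 0" for S
    using form_dot_cong[of n S "\<lambda>v. 0" T T] that by (simp add: form_dot_0)
  have "cov a H (b # v) = cov a (\<lambda>w. 0) (b # v)" if "length v = n" for a b v
    by (rule cov_cong) (simp add: H_top that)
  then show "form_dot n (\<lambda>w. H (i # w)) T = 0" "form_dot n (divg H) T = 0" "form_dot n iota T = 0"
    by (auto intro!: * simp: H_top divg_def cov_0 contract_0 iota_def)
qed

lemma atMost_lessThan: "{..n} = insert n {..<n}"
  by auto

lemma sum_1_n: "(\<Sum>k=1..n. f k) = (\<Sum>k<n. f (Suc k))" for f :: "nat \<Rightarrow> 'a"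
  by (rule sum.reindex_bij_witness[of _ Suc "\<lambda>k. k - 1"]) auto

section \<open>Evolution of the scalar curvature, the norms of H and the potential\<close>

lemma d_g': "d (g i j) = (- 2) *\<^sub>R Ric i j + (1/2) *\<^sub>R Hsq i j"
  unfolding d_g atMost_lessThan Hsq_def by (simp add: form_dot_n_zero)

lemma d_phi': "d phi = Lap phi + (1/4) *\<^sub>R (\<Sum>k<n. (1 - \<kappa> k) *\<^sub>R N k)"
proof -
  have "(real (Suc k) - 1) / real (Suc k) = 1 - \<kappa> k" for k
    by (simp add: field_simps)
  then show ?thesis
    using d_phi unfolding sum_1_n by (simp only: diff_eq_eq add.commute)
qed

lemma trace_Hsq: "contract Hsq = (\<Sum>k<n. N k)"
  unfolding Hsq_def[abs_def] contract_sum form_dot.simps(2) ..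

lemma trace_dg: "contract (\<lambda>i j. d (g i j)) = (- 2) *\<^sub>R Scal + (1/2) *\<^sub>R (\<Sum>k<n. N k)"
  unfolding d_g' contract_add contract_scaleR trace_Hsq Scal_def ..

text \<open>The Bianchi identity turns the divergence of -2 Rc into minus the differential of the
  scalar curvature; \<open>divg_square_closed\<close> handles H^2.\<close>

lemma divg_dg': "divg (\<lambda>v. d (g (v ! 0) (v ! 1))) [m] =
   - D m Scal + (1/2) *\<^sub>R (\<Sum>k<n. form_dot k (divg H) (\<lambda>w. H (m # w)) + (\<kappa> k / 2) *\<^sub>R D m (N k))"
proof -
  have "divg (\<lambda>v. Hsq (v ! 0) (v ! 1)) [m] = (\<Sum>k<n. form_dot k (divg H) (\<lambda>w. H (m # w)) + (\<kappa> k / 2) *\<^sub>R D m (N k))"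
  proof -
    have "divg (\<lambda>v. \<Sum>k<n. F k v) [m] = (\<Sum>k<n. divg (F k) [m])" for F
      by (simp add: divg_def cov_sum contract_sum)
    then show ?thesis
      unfolding Hsq_def by (simp only: divg_square_closed[OF alternating_H closed_H]) (simp add: mult.commute)
  qed
  moreover have "(- 2) *\<^sub>R divg (\<lambda>v. Ric (v ! 0) (v ! 1)) [m] = - D m Scal"
    using contracted_Bianchi[of m] by simp
  ultimately show ?thesis
    unfolding d_g' divg_add divg_scaleR by simp
qed

lemma divg_divg_dg: "divg (divg (\<lambda>v. d (g (v ! 0) (v ! 1)))) [] =
   - Lap Scal + (1/2) *\<^sub>R (\<Sum>k<n. Z k + form_dot k (divg H) (divg H) + (\<kappa> k / 2) *\<^sub>R Lap (N k))"
proof -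
  have "divg (divg (\<lambda>v. d (g (v ! 0) (v ! 1)))) [] = divg (\<lambda>v. - nabla (\<lambda>v. Scal) v +
     (1/2) *\<^sub>R (\<Sum>k<n. form_dot k (divg H) (\<lambda>w. H (v ! 0 # w)) + (\<kappa> k / 2) *\<^sub>R nabla (\<lambda>v. N k) v)) []"
  proof (rule divg_cong)
    fix w :: "'n list" assume "length w = Suc (length ([] :: 'n list))"
    then obtain m where w: "w = [m]" by (cases w) auto
    show "divg (\<lambda>v. d (g (v ! 0) (v ! 1))) w = - nabla (\<lambda>v. Scal) w +
     (1/2) *\<^sub>R (\<Sum>k<n. form_dot k (divg H) (\<lambda>v. H (w ! 0 # v)) + (\<kappa> k / 2) *\<^sub>R nabla (\<lambda>v. N k) w)"
      unfolding w divg_dg' nabla_const by simp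
  qed
  also have "\<dots> = - Lap Scal + (1/2) *\<^sub>R (\<Sum>k<n. divg (\<lambda>v. form_dot k (divg H) (\<lambda>w. H (v ! 0 # w))) [] + (\<kappa> k / 2) *\<^sub>R Lap (N k))"
  proof -
    have "divg (\<lambda>v. \<Sum>k<n. F k v) [] = (\<Sum>k<n. divg (F k) [])" for F
      by (simp add: divg_def cov_sum contract_sum)
    then show ?thesis
      unfolding divg_add divg_minus divg_scaleR Lap_def by (simp only: divg_add divg_scaleR)
  qed
  finally show ?thesis
    unfolding divg_form_dot_divg Z_def .
qed

text \<open>Both contributions carry a factor \<open>Suc k\<close>: one from pairing an exterior
  derivative with an alternating form, the other from the number of varying inverse metrics. The
  weight \<open>\<kappa> k\<close> removes both.\<close>

lemma d_N: "\<kappa> k *\<^sub>R d (N k) = 2 *\<^sub>R Z k - pair (\<lambda>i j. d (g i j)) (\<lambda>i j. form_dot k (\<lambda>w. H (i # w)) (\<lambda>w. H (j # w)))"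
proof -
  have "wedge (\<lambda>l w. - B l w) v = - wedge B v" for B and v :: "'n list"
    by (induction v arbitrary: B) simp_all
  then have dH: "d (H v) = wedge (\<lambda>l w. D l (divg H w)) v" for v
    unfolding d_H by (simp add: D_rules)
  show ?thesis
    unfolding d_normsq[OF alternating_H] dH form_dot_exterior_derivative[OF alternating_H] pair_def Z_def
    by (simp add: scaleR_diff_right) (simp add: field_simps)
qed

lemma iota_pair: "pair (\<lambda>i j. form_dot k (\<lambda>w. H (i # w)) (\<lambda>w. H (j # w))) dphi2 = form_dot k iota iota"
proof -
  have "form_dot k iota iota = contract (\<lambda>i a. contract (\<lambda>j b. D i phi * (D j phi * form_dot k (\<lambda>w. H (a # w)) (\<lambda>w. H (b # w)))))"
    unfolding iota_def[abs_def] form_dot_contract form_dot_contract_right form_dot_mult form_dot_mult_right contract_mult ..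
  then show ?thesis
    by (simp add: pair_def mult_ac)
qed

lemma iota_divg: "contract (\<lambda>l p. form_dot k (divg H) (\<lambda>w. H (p # w)) * D l phi) = form_dot k (divg H) iota"
  unfolding iota_def[abs_def] form_dot_contract_right form_dot_mult_right by (simp add: mult.commute)

text \<open>In the one-form div(d g) - (1/2) d(tr d g) the gradients of the scalar curvature cancel.
  What is left of the gradients of the norms carries the same coefficients
  \<open>1 - \<kappa> k\<close> as the source of \<open>phi\<close>.\<close>

lemma d_Lap_phi: "d (Lap phi) = Lap (Lap phi) + (1/4) *\<^sub>R (\<Sum>k<n. (1 - \<kappa> k) *\<^sub>R Lap (N k))
    - pair (\<lambda>i j. d (g i j)) Hess
    - (1/2) *\<^sub>R (\<Sum>k<n. form_dot k (divg H) iota) + (1/4) *\<^sub>R (\<Sum>k<n. (1 - \<kappa> k) *\<^sub>R grad_dot (N k) phi)"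
proof -
  have 1: "divg (\<lambda>v. d (g (v ! 0) (v ! 1))) [p] - (1/2) *\<^sub>R D p (contract (\<lambda>i j. d (g i j)))
      = (1/2) *\<^sub>R (\<Sum>k<n. form_dot k (divg H) (\<lambda>w. H (p # w))) - (1/4) *\<^sub>R (\<Sum>k<n. (1 - \<kappa> k) *\<^sub>R D p (N k))" for p
  proof -
    have "(\<kappa> k / 2) *\<^sub>R x - (1/2) *\<^sub>R x = - (1/2) *\<^sub>R (1 - \<kappa> k) *\<^sub>R x" for k and x :: 'a
      by (simp add: scaleR_left_diff_distrib[symmetric] field_simps)
    then have "(\<Sum>k<n. (\<kappa> k / 2) *\<^sub>R D p (N k)) - (1/2) *\<^sub>R (\<Sum>k<n. D p (N k)) = - (1/2) *\<^sub>R (\<Sum>k<n. (1 - \<kappa> k) *\<^sub>R D p (N k))"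
      unfolding scaleR_sum_right sum_subtractf[symmetric] by simp
    then have *: "(\<Sum>k<n. (\<kappa> k / 2) *\<^sub>R D p (N k)) = (1/2) *\<^sub>R (\<Sum>k<n. D p (N k)) - (1/2) *\<^sub>R (\<Sum>k<n. (1 - \<kappa> k) *\<^sub>R D p (N k))"
      by (simp add: algebra_simps)
    show ?thesis
      unfolding divg_dg' trace_dg D_rules sum.distrib *
      by (simp add: scaleR_add_right scaleR_diff_right)
  qed
  have 2: "contract (\<lambda>l p. (\<Sum>k<n. form_dot k (divg H) (\<lambda>w. H (p # w))) * D l phi) = (\<Sum>k<n. form_dot k (divg H) iota)"
    unfolding sum_distrib_right contract_sum iota_divg ..
  have 3: "contract (\<lambda>l p. D p u * D l phi) = grad_dot u phi" for u
    unfolding grad_dot_def by (rule contract_transpose)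
  have 4: "contract (\<lambda>l p. (\<Sum>k<n. (1 - \<kappa> k) *\<^sub>R D p (N k)) * D l phi) = (\<Sum>k<n. (1 - \<kappa> k) *\<^sub>R grad_dot (N k) phi)"
    unfolding sum_distrib_right contract_sum mult_scaleR_left contract_scaleR 3 ..
  have 5: "Lap (d phi) = Lap (Lap phi) + (1/4) *\<^sub>R (\<Sum>k<n. (1 - \<kappa> k) *\<^sub>R Lap (N k))"
    unfolding d_phi' Lap_add Lap_scaleR Lap_sum ..
  show ?thesis
    unfolding d_Lap 1 5 left_diff_distrib contract_diff mult_scaleR_left contract_scaleR 2 4 pair_def by simp
qed

lemma d_grad: "d (grad_dot phi phi) = 2 *\<^sub>R grad_dot (Lap phi) phi + (1/2) *\<^sub>R (\<Sum>k<n. (1 - \<kappa> k) *\<^sub>R grad_dot (N k) phi)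
    + 2 *\<^sub>R pair Ric dphi2 - (1/2) *\<^sub>R (\<Sum>k<n. form_dot k iota iota)"
proof -
  have 1: "pair (\<lambda>i j. d (g i j)) dphi2 = (- 2) *\<^sub>R pair Ric dphi2 + (1/2) *\<^sub>R (\<Sum>k<n. form_dot k iota iota)"
    unfolding d_g' pair_add pair_scaleR Hsq_def pair_sum iota_pair ..
  have "d (grad_dot phi phi) = contract (\<lambda>i j. d (D i phi * D j phi)) - pair (\<lambda>i j. d (g i j)) dphi2"
    unfolding grad_dot_def derivation_contract[OF d] pair_def ..
  also have "contract (\<lambda>i j. d (D i phi * D j phi)) = grad_dot (d phi) phi + grad_dot phi (d phi)"
    by (simp add: grad_dot_def d_rules d_D contract_add)
  also have "\<dots> = 2 *\<^sub>R grad_dot (d phi) phi"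
    by (simp add: grad_dot_sym[of phi "d phi"] scaleR_2)
  also have "\<dots> = 2 *\<^sub>R grad_dot (Lap phi) phi + (1/2) *\<^sub>R (\<Sum>k<n. (1 - \<kappa> k) *\<^sub>R grad_dot (N k) phi)"
    unfolding d_phi' grad_dot_add grad_dot_scaleR grad_dot_sum by (simp add: scaleR_add_right)
  finally show ?thesis
    unfolding 1 by (simp add: algebra_simps)
qed

lemma Lap_grad: "Lap (grad_dot phi phi) = 2 *\<^sub>R pair Hess Hess + 2 *\<^sub>R grad_dot (Lap phi) phi + 2 *\<^sub>R pair Ric dphi2"
proof -
  have 1: "contract (\<lambda>i j. contract (\<lambda>l p. Ric i p * D l phi) * D j phi) = pair Ric dphi2"
  proof -
    have "contract (\<lambda>i j. contract (\<lambda>l p. Ric i p * D l phi) * D j phi) = contract (\<lambda>i j. contract (\<lambda>l p. Ric j p * D l phi) * D i phi)"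
      by (rule contract_transpose[symmetric])
    then show ?thesis unfolding pair_def contract_mult_right[symmetric] by (simp add: mult_ac)
  qed
  have 2: "contract (\<lambda>a b. contract (\<lambda>i j. Hess a i * Hess b j)) = pair Hess Hess"
  proof -
    have "contract (\<lambda>a b. contract (\<lambda>i j. Hess a i * Hess b j)) = contract (\<lambda>a b. contract (\<lambda>i j. Hess a j * Hess b i))"
      by (rule contract_cong) (rule contract_transpose[symmetric])
    also have "\<dots> = pair Hess Hess"
      unfolding pair_def by (rule contract_transpose[symmetric])
    finally show ?thesis .
  qed
  show ?thesis
    unfolding grad_dot_def Bochner 1 2 ..
qed

section \<open>The twisted scalar curvature and the two squares\<close>

definition twisted :: 'a where
  "twisted = Scal - (1/4) *\<^sub>R (\<Sum>k=1..n. (1 / real k) *\<^sub>R form_dot k H H) + 2 *\<^sub>R Lap phi - grad_dot phi phi"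

definition soliton :: "'n list \<Rightarrow> 'a" where
  "soliton v = Ric (v ! 0) (v ! 1) - (1/4) *\<^sub>R (\<Sum>k\<le>n. form_dot k (\<lambda>w. H (v ! 0 # w)) (\<lambda>w. H (v ! 1 # w)))
     + Hess (v ! 0) (v ! 1)"

definition W :: "'n list \<Rightarrow> 'a" where
  "W v = - divg H v + iota v"

lemma form_dot_W: "form_dot k W W = form_dot k (divg H) (divg H) - 2 *\<^sub>R form_dot k (divg H) iota + form_dot k iota iota"
  unfolding W_def form_dot_add form_dot_add_right form_dot_minus form_dot_minus_right form_dot_sym[of k iota "divg H"]
  by (simp add: scaleR_2)

lemma form_dot_soliton: "form_dot 2 soliton soliton = pair Ric Ric - (1/2) *\<^sub>R pair Hsq Ric + (1/16) *\<^sub>R pair Hsq Hsq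
   + 2 *\<^sub>R pair Ric Hess - (1/2) *\<^sub>R pair Hsq Hess + pair Hess Hess"
proof -
  have s: "soliton [i, j] = Ric i j + (- 1/4) *\<^sub>R Hsq i j + Hess i j" for i j
    unfolding soliton_def atMost_lessThan Hsq_def by (simp add: form_dot_n_zero)
  have "form_dot 2 soliton soliton = contract (\<lambda>a b. contract (\<lambda>i j. soliton [a, i] * soliton [b, j]))"
    by (simp add: numeral_2_eq_2 form_dot.simps)
  also have "\<dots> = contract (\<lambda>a b. contract (\<lambda>i j. soliton [a, j] * soliton [b, i]))"
    by (rule contract_cong) (rule contract_transpose[symmetric])
  also have "\<dots> = pair (\<lambda>i j. soliton [i, j]) (\<lambda>i j. soliton [i, j])"
    unfolding pair_def by (rule contract_transpose[symmetric])
  also have "\<dots> = pair Ric Ric - (1/2) *\<^sub>R pair Hsq Ric + (1/16) *\<^sub>R pair Hsq Hsq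
   + 2 *\<^sub>R pair Ric Hess - (1/2) *\<^sub>R pair Hsq Hess + pair Hess Hess"
  proof -
    have q4: "x - (1/4) *\<^sub>R y - (1/4) *\<^sub>R y = x - (1/2) *\<^sub>R y" for x y :: 'a
      by (simp add: diff_diff_eq scaleR_add_left[symmetric])
    show ?thesis
      unfolding s pair_add pair_add_right pair_scaleR pair_scaleR_right
        pair_sym[of Ric Hsq] pair_sym[of Hess Hsq] pair_sym[of Hess Ric] 
      by (simp add: algebra_simps scaleR_2 q4)
  qed
  finally show ?thesis .
qed

text \<open>The identity is linear in the elementary contractions. A linear \<open>ev\<close> turns
  each of them into a real number, so that the scalars become ordinary coefficients and the
  comparison becomes real arithmetic.\<close>

theorem heat_operator_twisted:
  fixes ev :: "'a \<Rightarrow> real"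
  assumes ev_add: "\<And>x y. ev (x + y) = ev x + ev y" and ev_scaleR: "\<And>c x. ev (c *\<^sub>R x) = c * ev x"
  shows "ev (d twisted) - ev (Lap twisted) = 2 * ev (form_dot 2 soliton soliton) + (1/2) * ev (\<Sum>k\<le>n. form_dot k W W)"
proof -
  have ev_minus: "ev (- x) = - ev x" for x
    using ev_scaleR[of "- 1" x] by simp
  have ev_diff: "ev (x - y) = ev x - ev y" for x y
    using ev_add[of x "- y"] by (simp add: ev_minus)
  have ev_0: "ev 0 = 0"
    using ev_scaleR[of 0 0] by simp
  have ev_sum: "ev (sum f S) = (\<Sum>i\<in>S. ev (f i))" for f :: "nat \<Rightarrow> 'a" and S
    by (induction S rule: infinite_finite_induct) (simp_all add: ev_0 ev_add)
  note ev = ev_add ev_scaleR ev_minus ev_diff ev_sum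
  have tw: "twisted = Scal - (1/4) *\<^sub>R (\<Sum>k<n. \<kappa> k *\<^sub>R N k) + 2 *\<^sub>R Lap phi - grad_dot phi phi"
    unfolding twisted_def sum_1_n ..
  have pH: "(\<Sum>k<n. pair (\<lambda>i j. d (g i j)) (\<lambda>i j. form_dot k (\<lambda>w. H (i # w)) (\<lambda>w. H (j # w)))) =
      (- 2) *\<^sub>R pair Hsq Ric + (1/2) *\<^sub>R pair Hsq Hsq"
  proof -
    have "(\<Sum>k<n. pair (\<lambda>i j. d (g i j)) (\<lambda>i j. form_dot k (\<lambda>w. H (i # w)) (\<lambda>w. H (j # w)))) = pair Hsq (\<lambda>i j. d (g i j))"
      unfolding pair_sym[of "\<lambda>i j. d (g i j)"] Hsq_def pair_sum ..
    then show ?thesis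
      unfolding d_g' pair_add_right pair_scaleR_right .
  qed
  have "d Scal = - Lap Scal + (1/2) *\<^sub>R (\<Sum>k<n. Z k + form_dot k (divg H) (divg H) + (\<kappa> k / 2) *\<^sub>R Lap (N k))
      - ((- 2) *\<^sub>R Lap Scal + (1/2) *\<^sub>R (\<Sum>k<n. Lap (N k))) - ((- 2) *\<^sub>R pair Ric Ric + (1/2) *\<^sub>R pair Hsq Ric)"
    unfolding d_Scal divg_divg_dg trace_dg Lap_add Lap_scaleR Lap_sum pair_def[symmetric]
    \<comment> \<open>The flow equation is inserted only now, since \<open>divg_divg_dg\<close> and
      \<open>trace_dg\<close> are stated in terms of \<open>d (g i j)\<close>.\<close>
    unfolding d_g' pair_add pair_scaleR ..
  then have S: "ev (d Scal) = ev (Lap Scal) + (1/2) * ((\<Sum>k<n. ev (Z k)) + (\<Sum>k<n. ev (form_dot k (divg H) (divg H))) + (1/2) * (\<Sum>k<n. \<kappa> k * ev (Lap (N k))))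
      - (1/2) * (\<Sum>k<n. ev (Lap (N k))) + 2 * ev (pair Ric Ric) - (1/2) * ev (pair Hsq Ric)"
    by (simp add: ev sum.distrib sum_distrib_left) (simp add: mult.commute)
  have "d (\<Sum>k<n. \<kappa> k *\<^sub>R N k) = 2 *\<^sub>R (\<Sum>k<n. Z k) - ((- 2) *\<^sub>R pair Hsq Ric + (1/2) *\<^sub>R pair Hsq Hsq)"
    unfolding d_rules d_N sum_subtractf pH scaleR_sum_right[symmetric] ..
  then have NN: "ev (d (\<Sum>k<n. \<kappa> k *\<^sub>R N k)) = 2 * (\<Sum>k<n. ev (Z k)) + 2 * ev (pair Hsq Ric) - (1/2) * ev (pair Hsq Hsq)"
    by (simp add: ev)
  have P: "ev (d (Lap phi)) = ev (Lap (Lap phi)) + (1/4) * ((\<Sum>k<n. ev (Lap (N k))) - (\<Sum>k<n. \<kappa> k * ev (Lap (N k))))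
    + 2 * ev (pair Ric Hess) - (1/2) * ev (pair Hsq Hess)
    - (1/2) * (\<Sum>k<n. ev (form_dot k (divg H) iota)) + (1/4) * (\<Sum>k<n. (1 - \<kappa> k) * ev (grad_dot (N k) phi))"
    unfolding d_Lap_phi d_g' pair_add pair_scaleR
    by (simp add: ev left_diff_distrib sum_subtractf)
  have G: "ev (d (grad_dot phi phi)) = 2 * ev (grad_dot (Lap phi) phi) + (1/2) * (\<Sum>k<n. (1 - \<kappa> k) * ev (grad_dot (N k) phi))
    + 2 * ev (pair Ric dphi2) - (1/2) * (\<Sum>k<n. ev (form_dot k iota iota))"
    unfolding d_grad by (simp add: ev)
  have LG: "ev (Lap (grad_dot phi phi)) = 2 * ev (pair Hess Hess) + 2 * ev (grad_dot (Lap phi) phi) + 2 * ev (pair Ric dphi2)"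
    unfolding Lap_grad by (simp add: ev)
  have dU: "ev (d twisted) = ev (d Scal) - (1/4) * ev (d (\<Sum>k<n. \<kappa> k *\<^sub>R N k)) + 2 * ev (d (Lap phi)) - ev (d (grad_dot phi phi))"
    unfolding tw by (simp only: derivation_add[OF d] derivation_diff[OF d] derivation_scaleR[OF d] ev)
  have Lap_diff: "Lap (x - y) = Lap x - Lap y" for x y
    using Lap_add[of x "(- 1) *\<^sub>R y"] unfolding Lap_scaleR by simp
  have LU: "ev (Lap twisted) = ev (Lap Scal) - (1/4) * (\<Sum>k<n. \<kappa> k * ev (Lap (N k))) + 2 * ev (Lap (Lap phi)) - ev (Lap (grad_dot phi phi))"
    unfolding tw by (simp only: Lap_add Lap_diff Lap_scaleR Lap_sum ev)
  have Wn: "form_dot n W W = 0"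
    unfolding form_dot_W by (simp add: form_dot_n_zero)
  have WW: "ev (\<Sum>k\<le>n. form_dot k W W) = (\<Sum>k<n. ev (form_dot k (divg H) (divg H))) - 2 * (\<Sum>k<n. ev (form_dot k (divg H) iota)) + (\<Sum>k<n. ev (form_dot k iota iota))"
    unfolding ev_sum atMost_lessThan by (simp add: Wn ev_0) (simp add: form_dot_W ev sum.distrib sum_subtractf sum_distrib_left)
  have SS: "ev (form_dot 2 soliton soliton) = ev (pair Ric Ric) - (1/2) * ev (pair Hsq Ric) + (1/16) * ev (pair Hsq Hsq)
   + 2 * ev (pair Ric Hess) - (1/2) * ev (pair Hsq Hess) + ev (pair Hess Hess)"
    unfolding form_dot_soliton by (simp add: ev)
  \<comment> \<open>\<open>Z\<close> cancels between \<open>S\<close> and \<open>NN\<close>, the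
    products of gradients of the norms with that of \<open>phi\<close> between \<open>P\<close> and
    \<open>G\<close>, and the Ricci term of \<open>phi\<close> between \<open>G\<close> and
    \<open>LG\<close>. The remainder is the expansion of the squares in \<open>SS\<close> and
    \<open>WW\<close>.\<close>
  show ?thesis
    unfolding dU LU LG S NN P G WW SS by (simp add: algebra_simps)
qed

end

section \<open>Jets\<close>

text \<open>A jet is a family of iterated derivatives, indexed by the list of the directions of differentiation.
  By the Leibniz rule the product of jets is the shuffle product.\<close>

definition jet_symmetric :: "('d list \<Rightarrow> real) \<Rightarrow> bool" where
  "jet_symmetric a \<longleftrightarrow> (\<forall>u i j v. a (u @ i # j # v) = a (u @ j # i # v))"

lemma jet_symmetric_Cons: "jet_symmetric a \<Longrightarrow> jet_symmetric (\<lambda>v. a (i # v))"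
  unfolding jet_symmetric_def by (metis append_Cons)

lemma jet_symmetric_swap: "jet_symmetric a \<Longrightarrow> a (i # j # v) = a (j # i # v)"
  unfolding jet_symmetric_def by (metis append_Nil)

text \<open>Symmetry under reordering of the directions is what makes the derivations
  \<open>jet_deriv\<close> commute, as the locales above require.\<close>

typedef 'd jet = "{a :: 'd list \<Rightarrow> real. jet_symmetric a}"
  by (rule exI[of _ "\<lambda>_. 0"]) (simp add: jet_symmetric_def)

setup_lifting type_definition_jet

primrec shuffle :: "('d list \<Rightarrow> real) \<Rightarrow> ('d list \<Rightarrow> real) \<Rightarrow> 'd list \<Rightarrow> real" where
  "shuffle a b [] = a [] * b []"
| "shuffle a b (i # v) = shuffle (\<lambda>w. a (i # w)) b v + shuffle a (\<lambda>w. b (i # w)) v"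

lemma shuffle_commute: "shuffle a b v = shuffle b a v"
  by (induction v arbitrary: a b) (simp_all add: mult.commute add.commute)

lemma shuffle_add: "shuffle (\<lambda>w. a w + a' w) b v = shuffle a b v + shuffle a' b v"
  by (induction v arbitrary: a a' b) (simp_all add: distrib_right)

lemma shuffle_add_right: "shuffle a (\<lambda>w. b w + b' w) v = shuffle a b v + shuffle a b' v"
  by (simp only: shuffle_commute[of a] shuffle_add)

lemma shuffle_scale: "shuffle (\<lambda>w. c * a w) b v = c * shuffle a b v"
  by (induction v arbitrary: a b) (simp_all add: distrib_left mult.assoc)

lemma shuffle_assoc: "shuffle (shuffle a b) c v = shuffle a (shuffle b c) v"
  by (induction v arbitrary: a b c) (simp_all add: shuffle_add shuffle_add_right)

lemma shuffle_zero: "shuffle (\<lambda>w. 0) b v = 0"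
  using shuffle_scale[of 0 "\<lambda>w. 0" b v] by simp

lemma shuffle_one: "shuffle (\<lambda>w. if w = [] then 1 else 0) b v = b v"
  by (induction v arbitrary: b) (simp_all add: shuffle_zero)

lemma shuffle_symmetric:
  assumes "jet_symmetric a" "jet_symmetric b"
  shows "jet_symmetric (shuffle a b)"
proof -
  have "shuffle a b (u @ i # j # v) = shuffle a b (u @ j # i # v)" for u i j v
    using assms
  proof (induction u arbitrary: a b)
    case Nil
    have "(\<lambda>w. a (i # j # w)) = (\<lambda>w. a (j # i # w))" "(\<lambda>w. b (i # j # w)) = (\<lambda>w. b (j # i # w))"
      by (intro ext jet_symmetric_swap Nil)+
    then show ?case by simp
  next
    case (Cons k u)
    show ?case
      by (simp add: Cons.IH[OF jet_symmetric_Cons] Cons.IH[OF _ jet_symmetric_Cons] Cons.prems)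
  qed
  then show ?thesis by (simp add: jet_symmetric_def)
qed

instantiation jet :: (type) "{comm_ring_1, real_algebra_1}"
begin

lift_definition zero_jet :: "'a jet" is "\<lambda>_. 0" by (simp add: jet_symmetric_def)
lift_definition one_jet :: "'a jet" is "\<lambda>w. if w = [] then 1 else 0" by (simp add: jet_symmetric_def)
lift_definition plus_jet :: "'a jet \<Rightarrow> 'a jet \<Rightarrow> 'a jet" is "\<lambda>a b w. a w + b w"
  by (simp add: jet_symmetric_def)
lift_definition minus_jet :: "'a jet \<Rightarrow> 'a jet \<Rightarrow> 'a jet" is "\<lambda>a b w. a w - b w"
  by (simp add: jet_symmetric_def)
lift_definition uminus_jet :: "'a jet \<Rightarrow> 'a jet" is "\<lambda>a w. - a w"
  by (simp add: jet_symmetric_def)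
lift_definition times_jet :: "'a jet \<Rightarrow> 'a jet \<Rightarrow> 'a jet" is shuffle
  by (rule shuffle_symmetric)
lift_definition scaleR_jet :: "real \<Rightarrow> 'a jet \<Rightarrow> 'a jet" is "\<lambda>c a w. c * a w"
  by (simp add: jet_symmetric_def)

instance
proof
  fix a b c :: "'a jet" and r s :: real
  show "a + b + c = a + (b + c)" by transfer (simp add: add.assoc)
  show "a + b = b + a" by transfer (simp add: add.commute)
  show "0 + a = a" by transfer simp
  show "- a + a = 0" by transfer simp
  show "a - b = a + - b" by transfer simp
  show "a * b * c = a * (b * c)" by transfer (rule ext, rule shuffle_assoc)
  show "a * b = b * a" by transfer (rule ext, rule shuffle_commute)
  show "1 * a = a" by transfer (rule ext, rule shuffle_one)
  show "(a + b) * c = a * c + b * c" by transfer (rule ext, rule shuffle_add)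
  show "a * (b + c) = a * b + a * c" by transfer (rule ext, rule shuffle_add_right)
  show "a * 1 = a" by transfer (rule ext, simp only: shuffle_commute[of _ "\<lambda>w. if _ w then _ else _"] shuffle_one)
  show "(0 :: 'a jet) \<noteq> 1" by transfer (auto simp: fun_eq_iff)
  show "r *\<^sub>R (a + b) = r *\<^sub>R a + r *\<^sub>R b" by transfer (simp add: distrib_left)
  show "(r + s) *\<^sub>R a = r *\<^sub>R a + s *\<^sub>R a" by transfer (simp add: distrib_right)
  show "r *\<^sub>R s *\<^sub>R a = (r * s) *\<^sub>R a" by transfer (simp add: mult.assoc)
  show "1 *\<^sub>R a = a" by transfer simp
  show "r *\<^sub>R a * b = r *\<^sub>R (a * b)" by transfer (rule ext, rule shuffle_scale)
  show "a * r *\<^sub>R b = r *\<^sub>R (a * b)"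
    by transfer (rule ext, simp only: shuffle_commute[of _ "\<lambda>w. _ * _ w"] shuffle_scale shuffle_commute)
qed

end

lift_definition jet_deriv :: "'d \<Rightarrow> 'd jet \<Rightarrow> 'd jet" is "\<lambda>i a w. a (i # w)"
  by (rule jet_symmetric_Cons)

lift_definition jet_value :: "'d jet \<Rightarrow> real" is "\<lambda>a. a []" .

lemma derivation_jet_deriv: "derivation (jet_deriv i)"
  unfolding derivation_def by (intro conjI allI; transfer) simp_all

lemma jet_deriv_commute: "jet_deriv i (jet_deriv j a) = jet_deriv j (jet_deriv i a)"
  by transfer (simp add: jet_symmetric_swap)

lemma jet_value_add: "jet_value (a + b) = jet_value a + jet_value b"
  and jet_value_scaleR: "jet_value (c *\<^sub>R a) = c * jet_value a"
  by (transfer; simp)+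

section \<open>Smooth functions\<close>

lemma Ck_on_SucE:
  assumes "Ck_on (Suc k) S f"
  obtains f' where "\<And>x. x \<in> S \<Longrightarrow> (f has_derivative f' x) (at x within S)" "\<And>v. Ck_on k S (\<lambda>x. f' x v)"
  using assms unfolding Ck_on.simps by blast

lemma Ck_on_SucI:
  assumes "\<And>x. x \<in> S \<Longrightarrow> (f has_derivative f' x) (at x within S)" "\<And>v. Ck_on k S (\<lambda>x. f' x v)"
  shows "Ck_on (Suc k) S f"
  using assms unfolding Ck_on.simps by blast

lemma Ck_on_cong:
  assumes "Ck_on k S f" "\<And>x. x \<in> S \<Longrightarrow> f x = g x"
  shows "Ck_on k S g"
proof (cases k)
  case 0
  then show ?thesis using assms by (simp cong: continuous_on_cong)
next
  case (Suc m)
  then obtain f' where f': "\<And>x. x \<in> S \<Longrightarrow> (f has_derivative f' x) (at x within S)" "\<And>v. Ck_on m S (\<lambda>x. f' x v)"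
    using assms(1) by auto
  have "(g has_derivative f' x) (at x within S)" if "x \<in> S" for x
    using f'(1)[OF that] that assms(2) by (rule_tac has_derivative_transform) auto
  then show ?thesis using f'(2) Suc by auto
qed

lemma Ck_on_continuous: "Ck_on k S f \<Longrightarrow> continuous_on S f"
  by (cases k) (auto intro: has_derivative_continuous_on)

lemma Ck_on_SucD: "Ck_on (Suc k) S f \<Longrightarrow> Ck_on k S f"
proof (induction k arbitrary: f)
  case 0
  then have "continuous_on S f" by (rule Ck_on_continuous)
  then show ?case by simp
next
  case (Suc k)
  from Suc.prems obtain f' where f': "\<And>x. x \<in> S \<Longrightarrow> (f has_derivative f' x) (at x within S)"
      "\<And>v. Ck_on (Suc k) S (\<lambda>x. f' x v)"
    by (rule Ck_on_SucE) blast
  show ?case by (rule Ck_on_SucI[OF f'(1) Suc.IH[OF f'(2)]])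
qed

lemma Ck_on_const: "Ck_on k S (\<lambda>x. c)"
  by (induction k arbitrary: c) (auto intro!: exI[of _ "\<lambda>x v. 0"])

lemma Ck_on_add:
  "Ck_on k S f \<Longrightarrow> Ck_on k S g \<Longrightarrow> Ck_on k S (\<lambda>x. f x + g x)"
proof (induction k arbitrary: f g)
  case 0
  then show ?case by (auto intro: continuous_on_add)
next
  case (Suc k)
  obtain f' where f': "\<And>x. x \<in> S \<Longrightarrow> (f has_derivative f' x) (at x within S)" "\<And>v. Ck_on k S (\<lambda>x. f' x v)"
    using Suc.prems(1) by (rule Ck_on_SucE) blast
  obtain g' where g': "\<And>x. x \<in> S \<Longrightarrow> (g has_derivative g' x) (at x within S)" "\<And>v. Ck_on k S (\<lambda>x. g' x v)"
    using Suc.prems(2) by (rule Ck_on_SucE) blast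
  show ?case
    by (rule Ck_on_SucI[OF has_derivative_add[OF f'(1) g'(1)] Suc.IH[OF f'(2) g'(2)]])
qed

lemma Ck_on_mult:
  fixes f g :: "'a::euclidean_space \<Rightarrow> real"
  shows "Ck_on k S f \<Longrightarrow> Ck_on k S g \<Longrightarrow> Ck_on k S (\<lambda>x. f x * g x)"
proof (induction k arbitrary: f g)
  case 0
  then show ?case by (auto intro: continuous_on_mult)
next
  case (Suc k)
  obtain f' where f': "\<And>x. x \<in> S \<Longrightarrow> (f has_derivative f' x) (at x within S)" "\<And>v. Ck_on k S (\<lambda>x. f' x v)"
    using Suc.prems(1) by (rule Ck_on_SucE) blast
  obtain g' where g': "\<And>x. x \<in> S \<Longrightarrow> (g has_derivative g' x) (at x within S)" "\<And>v. Ck_on k S (\<lambda>x. g' x v)"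
    using Suc.prems(2) by (rule Ck_on_SucE) blast
  have fg: "Ck_on k S f" "Ck_on k S g"
    using Suc.prems Ck_on_SucD by blast+
  show ?case
    by (rule Ck_on_SucI[OF has_derivative_mult[OF f'(1) g'(1)]
          Ck_on_add[OF Suc.IH[OF fg(1) g'(2)] Suc.IH[OF f'(2) fg(2)]]])
qed

lemma Ck_on_inverse:
  fixes f :: "'a::euclidean_space \<Rightarrow> real"
  assumes "\<And>x. x \<in> S \<Longrightarrow> f x \<noteq> 0"
  shows "Ck_on k S f \<Longrightarrow> Ck_on k S (\<lambda>x. inverse (f x))"
proof (induction k)
  case 0
  then show ?case using assms by (auto intro: continuous_on_inverse)
next
  case (Suc k)
  obtain f' where f': "\<And>x. x \<in> S \<Longrightarrow> (f has_derivative f' x) (at x within S)" "\<And>v. Ck_on k S (\<lambda>x. f' x v)"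
    using Suc.prems(1) by (rule Ck_on_SucE) blast
  have i: "Ck_on k S (\<lambda>x. inverse (f x))"
    using Suc Ck_on_SucD by blast
  have "Ck_on k S (\<lambda>x. (- 1) * (inverse (f x) * f' x v * inverse (f x)))" for v
    by (intro Ck_on_mult Ck_on_const i f')
  then have **: "Ck_on k S (\<lambda>x. - (inverse (f x) * f' x v * inverse (f x)))" for v
    by simp
  show ?case
    by (rule Ck_on_SucI[OF Deriv.has_derivative_inverse[OF _ f'(1)]]) (use assms ** in auto)
qed

lemma Ck_on_subset: "Ck_on k S f \<Longrightarrow> T \<subseteq> S \<Longrightarrow> Ck_on k T f"
proof (induction k arbitrary: f)
  case 0
  then show ?case by (auto intro: continuous_on_subset)
next
  case (Suc k)
  obtain f' where f': "\<And>x. x \<in> S \<Longrightarrow> (f has_derivative f' x) (at x within S)" "\<And>v. Ck_on k S (\<lambda>x. f' x v)"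
    using Suc.prems(1) by (rule Ck_on_SucE) blast
  show ?case
    by (rule Ck_on_SucI[OF has_derivative_subset[OF f'(1)] Suc.IH[OF f'(2)]]) (use Suc.prems in auto)
qed

lemma smooth_on_cong: "smooth_on S f \<Longrightarrow> (\<And>x. x \<in> S \<Longrightarrow> f x = g x) \<Longrightarrow> smooth_on S g"
  unfolding smooth_on_def using Ck_on_cong by blast

lemma smooth_on_subset: "smooth_on S f \<Longrightarrow> T \<subseteq> S \<Longrightarrow> smooth_on T f"
  unfolding smooth_on_def using Ck_on_subset by blast

lemma smooth_on_const: "smooth_on S (\<lambda>x. c)"
  by (simp add: smooth_on_def Ck_on_const)

lemma smooth_on_add: "smooth_on S f \<Longrightarrow> smooth_on S g \<Longrightarrow> smooth_on S (\<lambda>x. f x + g x)"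
  by (simp add: smooth_on_def Ck_on_add)

lemma smooth_on_mult:
  fixes f g :: "'a::euclidean_space \<Rightarrow> real"
  shows "smooth_on S f \<Longrightarrow> smooth_on S g \<Longrightarrow> smooth_on S (\<lambda>x. f x * g x)"
  by (simp add: smooth_on_def Ck_on_mult)

lemma smooth_on_inverse:
  fixes f :: "'a::euclidean_space \<Rightarrow> real"
  shows "smooth_on S f \<Longrightarrow> (\<And>x. x \<in> S \<Longrightarrow> f x \<noteq> 0) \<Longrightarrow> smooth_on S (\<lambda>x. inverse (f x))"
  by (simp add: smooth_on_def Ck_on_inverse)

lemma smooth_on_sum: "(\<And>i. i \<in> A \<Longrightarrow> smooth_on S (f i)) \<Longrightarrow> smooth_on S (\<lambda>x. \<Sum>i\<in>A. f i x)"
  by (induction A rule: infinite_finite_induct) (auto intro: smooth_on_const smooth_on_add)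

lemma smooth_on_prod:
  fixes f :: "'i \<Rightarrow> 'a::euclidean_space \<Rightarrow> real"
  shows "(\<And>i. i \<in> A \<Longrightarrow> smooth_on S (f i)) \<Longrightarrow> smooth_on S (\<lambda>x. \<Prod>i\<in>A. f i x)"
  by (induction A rule: infinite_finite_induct) (auto intro: smooth_on_const smooth_on_mult)

lemma smooth_on_derivative:
  assumes "smooth_on S f"
  obtains f' where "\<And>x. x \<in> S \<Longrightarrow> (f has_derivative f' x) (at x within S)"
proof -
  have "Ck_on (Suc 0) S f" using assms by (simp only: smooth_on_def)
  then show thesis using that by auto
qed

text \<open>The second difference is symmetric in \<open>v\<close> and \<open>w\<close>, which gives the symmetry of second derivatives.\<close>

lemma second_difference:
  fixes f :: "'a::euclidean_space \<Rightarrow> real"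
  assumes f': "\<And>y. y \<in> ball x r \<Longrightarrow> (f has_derivative f' y) (at y)"
    and p': "\<And>y. y \<in> ball x r \<Longrightarrow> ((\<lambda>y. f' y v) has_derivative p' y) (at y)"
    and h: "h > 0" "h * (norm v + norm w) < r"
  shows "\<exists>y\<in>ball x r. f (x + h *\<^sub>R v + h *\<^sub>R w) - f (x + h *\<^sub>R v) - f (x + h *\<^sub>R w) + f x = h * (h * p' y w)"
proof -
  have inb: "x + s *\<^sub>R v + u *\<^sub>R w \<in> ball x r" if "0 \<le> s" "s \<le> h" "0 \<le> u" "u \<le> h" for s u
  proof -
    have "norm (s *\<^sub>R v + u *\<^sub>R w) \<le> s * norm v + u * norm w"
      using that by (intro order_trans[OF norm_triangle_ineq]) simp
    also have "\<dots> \<le> h * norm v + h * norm w"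
      using that by (intro add_mono mult_right_mono) auto
    also have "\<dots> < r" using h by (simp add: distrib_left)
    finally have n: "norm (s *\<^sub>R v + u *\<^sub>R w) < r" .
    have "dist x (x + c) = norm c" for c
      by (simp add: dist_norm)
    from this[of "s *\<^sub>R v + u *\<^sub>R w"] n show ?thesis
      by (simp add: add.assoc)
  qed
  \<comment> \<open>The mean value theorem is applied twice: in direction \<open>v\<close> to the
    increment of \<open>f\<close> along \<open>w\<close>, then in direction \<open>w\<close> to the
    derivative along \<open>v\<close>.\<close>
  define a where "a s = f (x + s *\<^sub>R v + h *\<^sub>R w) - f (x + s *\<^sub>R v)" for s
  have "DERIV a s :> f' (x + s *\<^sub>R v + h *\<^sub>R w) v - f' (x + s *\<^sub>R v) v" if s: "0 \<le> s" "s \<le> h" for s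
  proof -
    have 1: "((\<lambda>s. f (x + s *\<^sub>R v + u *\<^sub>R w)) has_derivative (\<lambda>d. f' (x + s *\<^sub>R v + u *\<^sub>R w) (d *\<^sub>R v))) (at s)"
      if "0 \<le> u" "u \<le> h" for u
    proof -
      have "((\<lambda>s. x + s *\<^sub>R v + u *\<^sub>R w) has_derivative (\<lambda>d. d *\<^sub>R v)) (at s)"
        by (auto intro!: derivative_eq_intros)
      from has_derivative_compose[OF this f'[OF inb[OF s that]]] show ?thesis .
    qed
    have "linear (f' y)" if "y \<in> ball x r" for y
      using f'[OF that] by (rule has_derivative_linear)
    then have 2: "f' y (d *\<^sub>R v) = d * f' y v" if "y \<in> ball x r" for y d
      using that by (simp add: linear_cmul)
    have "(a has_derivative (\<lambda>d. f' (x + s *\<^sub>R v + h *\<^sub>R w) (d *\<^sub>R v) - f' (x + s *\<^sub>R v) (d *\<^sub>R v))) (at s)"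
      unfolding a_def using has_derivative_diff[OF 1[of h] 1[of 0]] h by simp
    then show ?thesis
      unfolding has_field_derivative_def
      using 2[OF inb[OF s, of h]] 2[OF inb[OF s, of 0]] h by (simp add: right_diff_distrib[symmetric] mult_commute_abs)
  qed
  from MVT2[OF \<open>h > 0\<close> this] obtain s where s: "0 < s" "s < h"
    and as: "a h - a 0 = h * (f' (x + s *\<^sub>R v + h *\<^sub>R w) v - f' (x + s *\<^sub>R v) v)"
    by (auto simp: mult.commute)
  have "DERIV (\<lambda>u. f' (x + s *\<^sub>R v + u *\<^sub>R w) v) u :> p' (x + s *\<^sub>R v + u *\<^sub>R w) w" if u: "0 \<le> u" "u \<le> h" for u
  proof -
    have b: "x + s *\<^sub>R v + u *\<^sub>R w \<in> ball x r" using inb s u by auto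
    have "((\<lambda>u. x + s *\<^sub>R v + u *\<^sub>R w) has_derivative (\<lambda>d. d *\<^sub>R w)) (at u)"
      by (auto intro!: derivative_eq_intros)
    from has_derivative_compose[OF this p'[OF b]]
    have "((\<lambda>u. f' (x + s *\<^sub>R v + u *\<^sub>R w) v) has_derivative (\<lambda>d. p' (x + s *\<^sub>R v + u *\<^sub>R w) (d *\<^sub>R w))) (at u)" .
    moreover have "p' (x + s *\<^sub>R v + u *\<^sub>R w) (d *\<^sub>R w) = d * p' (x + s *\<^sub>R v + u *\<^sub>R w) w" for d
      using has_derivative_linear[OF p'[OF b]] by (simp add: linear_cmul)
    ultimately show ?thesis
      unfolding has_field_derivative_def by (simp add: mult_commute_abs)
  qed
  from MVT2[OF \<open>h > 0\<close> this] obtain u where u: "0 < u" "u < h"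
    and "f' (x + s *\<^sub>R v + h *\<^sub>R w) v - f' (x + s *\<^sub>R v + 0 *\<^sub>R w) v = h * p' (x + s *\<^sub>R v + u *\<^sub>R w) w"
    by (auto simp: mult.commute)
  then have "a h - a 0 = h * (h * p' (x + s *\<^sub>R v + u *\<^sub>R w) w)"
    using as by simp
  then show ?thesis
    unfolding a_def using inb[of s u] s u by (intro bexI[of _ "x + s *\<^sub>R v + u *\<^sub>R w"]) auto
qed

text \<open>The same second difference is h^2 times either mixed derivative, each taken at some
  point near \<open>x\<close>. By continuity the values at \<open>x\<close> cannot differ.\<close>

lemma mixed_partials_commute:
  fixes f :: "'a::euclidean_space \<Rightarrow> real"
  assumes S: "open S" "x \<in> S"
    and f': "\<And>y. y \<in> S \<Longrightarrow> (f has_derivative f' y) (at y)"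
    and p': "\<And>y. y \<in> S \<Longrightarrow> ((\<lambda>y. f' y v) has_derivative p' y) (at y)"
    and q': "\<And>y. y \<in> S \<Longrightarrow> ((\<lambda>y. f' y w) has_derivative q' y) (at y)"
    and cont: "continuous_on S (\<lambda>y. p' y w)" "continuous_on S (\<lambda>y. q' y v)"
  shows "p' x w = q' x v"
proof (rule ccontr)
  assume ne: "p' x w \<noteq> q' x v"
  \<comment> \<open>Half of the gap: values within \<open>e\<close> of the two numbers cannot
    coincide.\<close>
  define e where "e = \<bar>p' x w - q' x v\<bar> / 2"
  have e: "e > 0" using ne by (simp add: e_def)
  have "isCont (\<lambda>y. p' y w) x" "isCont (\<lambda>y. q' y v) x"
    using cont S continuous_on_eq_continuous_at by blast+
  then obtain d1 d2 where d: "d1 > 0" "\<And>y. dist y x < d1 \<Longrightarrow> dist (p' y w) (p' x w) < e"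
     "d2 > 0" "\<And>y. dist y x < d2 \<Longrightarrow> dist (q' y v) (q' x v) < e"
    unfolding continuous_at_eps_delta using e by metis
  obtain r0 where r0: "r0 > 0" "ball x r0 \<subseteq> S"
    using S open_contains_ball by blast
  define r where "r = min r0 (min d1 d2)"
  have r: "r > 0" "ball x r \<subseteq> S" "r \<le> d1" "r \<le> d2"
    using r0 d by (auto simp: r_def)
  \<comment> \<open>The summand 1 keeps the denominator positive when both vectors vanish and makes
    the inequality strict.\<close>
  define h where "h = r / (norm v + norm w + 1)"
  have h: "h > 0" "h * (norm v + norm w) < r"
  proof -
    have pos: "norm v + norm w + 1 > 0"
      using norm_ge_zero[of v] norm_ge_zero[of w] by linarith
    then show "h > 0" using r by (simp add: h_def)
    have "h * (norm v + norm w + 1) = r" using pos by (simp add: h_def)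
    then show "h * (norm v + norm w) < r" using \<open>h > 0\<close> by (simp add: distrib_left)
  qed
  obtain y where y: "y \<in> ball x r"
     "f (x + h *\<^sub>R v + h *\<^sub>R w) - f (x + h *\<^sub>R v) - f (x + h *\<^sub>R w) + f x = h * (h * p' y w)"
    using second_difference[of x r f f' v p' h w] f' p' r(2) h by blast
  obtain z where z: "z \<in> ball x r"
     "f (x + h *\<^sub>R w + h *\<^sub>R v) - f (x + h *\<^sub>R w) - f (x + h *\<^sub>R v) + f x = h * (h * q' z v)"
    using second_difference[of x r f f' w q' h v] f' q' r(2) h unfolding add.commute[of "norm w"] by blast
  have "h * (h * p' y w) = h * (h * q' z v)"
    using y(2) z(2) by (simp add: algebra_simps)
  then have "p' y w = q' z v" using h by simp
  moreover have "dist (p' y w) (p' x w) < e" "dist (q' z v) (q' x v) < e"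
    using d(2)[of y] d(4)[of z] y(1) z(1) r(3,4) by (simp_all add: dist_commute)
  ultimately show False
    unfolding e_def dist_real_def by (simp add: abs_if split: if_splits)
qed

section \<open>Jets of smooth functions of space and time\<close>

text \<open>An interval with interior points has no isolated points, so time derivatives within
  \<open>I\<close> are unique even at its endpoints.\<close>

locale spacetime =
  fixes I :: "real set" and U :: "(real ^ 'n::finite) set"
  assumes interval: "is_interval I" and interior_I: "interior I \<noteq> {}" and open_U: "open U"
begin

definition smooth_st :: "(real \<Rightarrow> real ^ 'n \<Rightarrow> real) \<Rightarrow> bool" where
  "smooth_st F \<longleftrightarrow> smooth_on (I \<times> U) (\<lambda>(t, x). F t x)"

text \<open>The direction \<open>None\<close> is time.\<close>

definition st_deriv :: "'n option \<Rightarrow> (real \<Rightarrow> real ^ 'n \<Rightarrow> real) \<Rightarrow> real \<Rightarrow> real ^ 'n \<Rightarrow> real" where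
  "st_deriv j F t x = (case j of None \<Rightarrow> vector_derivative (\<lambda>s. F s x) (at t within I) | Some i \<Rightarrow> pd i (F t) x)"

definition direction :: "'n option \<Rightarrow> real \<times> (real ^ 'n)" where
  "direction j = (case j of None \<Rightarrow> (1, 0) | Some i \<Rightarrow> (0, axis i 1))"

lemma at_I_not_bot: "t \<in> I \<Longrightarrow> at t within I \<noteq> bot"
proof -
  assume t: "t \<in> I"
  have "I \<noteq> {s}" for s
    using interior_I by auto
  then have "t islimpt I"
    using connected_imp_perfect[of I t] interval t by (auto simp: is_interval_connected)
  then show ?thesis by (simp add: trivial_limit_within)
qed

text \<open>Restricting the total derivative to a time line or a spatial slice shows that both kinds
  of partial derivative are its values in fixed directions. The rules for \<open>st_deriv\<close>
  then follow from those for \<open>has_derivative\<close>.\<close>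

lemma st_deriv_eq:
  assumes "t \<in> I" "x \<in> U" "((\<lambda>(t, x). F t x) has_derivative F') (at (t, x) within I \<times> U)"
  shows "st_deriv j F t x = F' (direction j)"
proof (cases j)
  case None
  have "((\<lambda>s. (s, x)) has_derivative (\<lambda>h. (h, 0))) (at t within I)"
    by (auto intro!: derivative_eq_intros)
  moreover have "((\<lambda>(t, x). F t x) has_derivative F') (at (t, x) within (\<lambda>s. (s, x)) ` I)"
    using assms by (auto intro: has_derivative_subset)
  ultimately have "((\<lambda>s. F s x) has_derivative (\<lambda>h. F' (h, 0))) (at t within I)"
    using has_derivative_in_compose by fastforce
  moreover have "(\<lambda>h. F' (h, 0)) = (\<lambda>h. h *\<^sub>R F' (1, 0))"
  proof
    fix h show "F' (h, 0) = h *\<^sub>R F' (1, 0)"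
      using linear_cmul[OF has_derivative_linear[OF assms(3)], of h "(1, 0)"] by simp
  qed
  ultimately have "((\<lambda>s. F s x) has_vector_derivative F' (1, 0)) (at t within I)"
    unfolding has_vector_derivative_def by simp
  then show ?thesis
    using None at_I_not_bot[OF assms(1)] by (simp add: st_deriv_def direction_def vector_derivative_within)
next
  case (Some i)
  have "((\<lambda>y. (t, y)) has_derivative (\<lambda>h. (0, h))) (at x within U)"
    by (auto intro!: derivative_eq_intros)
  moreover have "((\<lambda>(t, x). F t x) has_derivative F') (at (t, x) within (\<lambda>y. (t, y)) ` U)"
    using assms by (auto intro: has_derivative_subset)
  ultimately have "(F t has_derivative (\<lambda>h. F' (0, h))) (at x within U)"
    using has_derivative_in_compose by fastforce
  then have "(F t has_derivative (\<lambda>h. F' (0, h))) (at x)"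
    unfolding at_within_open[OF assms(2) open_U] .
  from frechet_derivative_at[OF this, symmetric] show ?thesis
    by (simp add: Some st_deriv_def direction_def pd_def)
qed

lemma smooth_st_derivative:
  assumes "smooth_st F"
  obtains F' where "\<And>p. p \<in> I \<times> U \<Longrightarrow> ((\<lambda>(t, x). F t x) has_derivative F' p) (at p within I \<times> U)"
    "\<And>j p. p \<in> I \<times> U \<Longrightarrow> (\<lambda>(t, x). st_deriv j F t x) p = F' p (direction j)"
proof -
  obtain F' where F': "\<And>p. p \<in> I \<times> U \<Longrightarrow> ((\<lambda>(t, x). F t x) has_derivative F' p) (at p within I \<times> U)"
    using assms smooth_on_derivative unfolding smooth_st_def by blast
  then have "(\<lambda>(t, x). st_deriv j F t x) p = F' p (direction j)" if "p \<in> I \<times> U" for j p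
    using st_deriv_eq[OF _ _ F'] that by auto
  then show thesis using that F' by blast
qed

lemma smooth_st_st_deriv:
  assumes "smooth_st F"
  shows "smooth_st (st_deriv j F)"
  unfolding smooth_st_def smooth_on_def
proof
  fix k
  have "Ck_on (Suc k) (I \<times> U) (\<lambda>(t, x). F t x)"
    using assms unfolding smooth_st_def smooth_on_def by blast
  then obtain F' where F': "\<And>p. p \<in> I \<times> U \<Longrightarrow> ((\<lambda>(t, x). F t x) has_derivative F' p) (at p within I \<times> U)"
    "\<And>v. Ck_on k (I \<times> U) (\<lambda>p. F' p v)"
    by (rule Ck_on_SucE) blast
  show "Ck_on k (I \<times> U) (\<lambda>(t, x). st_deriv j F t x)"
    by (rule Ck_on_cong[OF F'(2)[of "direction j"]]) (auto simp: st_deriv_eq[OF _ _ F'(1)])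
qed

lemma smooth_st_cong: "smooth_st F \<Longrightarrow> (\<And>t x. t \<in> I \<Longrightarrow> x \<in> U \<Longrightarrow> F t x = G t x) \<Longrightarrow> smooth_st G"
  unfolding smooth_st_def by (erule smooth_on_cong) auto

lemma st_deriv_cong:
  assumes "smooth_st F" "\<And>t x. t \<in> I \<Longrightarrow> x \<in> U \<Longrightarrow> F t x = G t x" "t \<in> I" "x \<in> U"
  shows "st_deriv j F t x = st_deriv j G t x"
proof -
  obtain F' where F': "((\<lambda>(t, x). F t x) has_derivative F') (at (t, x) within I \<times> U)"
    using assms by (metis SigmaI smooth_st_derivative)
  have "((\<lambda>(t, x). G t x) has_derivative F') (at (t, x) within I \<times> U)"
    by (rule has_derivative_transform[OF _ _ F']) (use assms in auto)
  then show ?thesis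
    using st_deriv_eq[OF assms(3,4)] F' by simp
qed

lemma st_deriv_const: "t \<in> I \<Longrightarrow> x \<in> U \<Longrightarrow> st_deriv j (\<lambda>t x. c) t x = 0"
  by (subst st_deriv_eq[where F' = "\<lambda>_. 0"]) (auto simp: case_prod_unfold)

lemma smooth_st_const: "smooth_st (\<lambda>t x. c)"
  unfolding smooth_st_def case_prod_unfold by (rule smooth_on_const)

lemma smooth_st_add: "smooth_st F \<Longrightarrow> smooth_st G \<Longrightarrow> smooth_st (\<lambda>t x. F t x + G t x)"
  unfolding smooth_st_def case_prod_unfold by (rule smooth_on_add)

lemma smooth_st_mult: "smooth_st F \<Longrightarrow> smooth_st G \<Longrightarrow> smooth_st (\<lambda>t x. F t x * G t x)"
  unfolding smooth_st_def case_prod_unfold by (rule smooth_on_mult)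

lemma st_deriv_add:
  assumes "smooth_st F" "smooth_st G" "t \<in> I" "x \<in> U"
  shows "st_deriv j (\<lambda>t x. F t x + G t x) t x = st_deriv j F t x + st_deriv j G t x"
proof -
  obtain F' G' where d: "((\<lambda>(t, x). F t x) has_derivative F') (at (t, x) within I \<times> U)"
    "((\<lambda>(t, x). G t x) has_derivative G') (at (t, x) within I \<times> U)"
    using assms by (metis SigmaI smooth_st_derivative)
  have "((\<lambda>(t, x). F t x + G t x) has_derivative (\<lambda>h. F' h + G' h)) (at (t, x) within I \<times> U)"
    using has_derivative_add[OF d] by (simp add: case_prod_unfold)
  then show ?thesis
    using st_deriv_eq[OF assms(3,4)] d by simp
qed

lemma st_deriv_mult:
  assumes "smooth_st F" "smooth_st G" "t \<in> I" "x \<in> U"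
  shows "st_deriv j (\<lambda>t x. F t x * G t x) t x = st_deriv j F t x * G t x + F t x * st_deriv j G t x"
proof -
  obtain F' G' where d: "((\<lambda>(t, x). F t x) has_derivative F') (at (t, x) within I \<times> U)"
    "((\<lambda>(t, x). G t x) has_derivative G') (at (t, x) within I \<times> U)"
    using assms by (metis SigmaI smooth_st_derivative)
  have "((\<lambda>(t, x). F t x * G t x) has_derivative (\<lambda>h. F t x * G' h + F' h * G t x)) (at (t, x) within I \<times> U)"
    using has_derivative_mult[OF d] by (simp add: case_prod_unfold)
  then show ?thesis
    using st_deriv_eq[OF assms(3,4)] d by simp
qed

text \<open>At an endpoint of the time interval, the symmetry follows by continuity from the interior.\<close>

lemma st_deriv_commute:
  assumes F: "smooth_st F" and tx: "t \<in> I" "x \<in> U"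
  shows "st_deriv i (st_deriv j F) t x = st_deriv j (st_deriv i F) t x"
proof -
  define S where "S = interior I \<times> U"
  have S: "open S" "S \<subseteq> I \<times> U"
    unfolding S_def using interior_subset open_U by (auto intro: open_Times)
  obtain F' where F': "\<And>p. p \<in> I \<times> U \<Longrightarrow> ((\<lambda>(t, x). F t x) has_derivative F' p) (at p within I \<times> U)"
    "\<And>j p. p \<in> I \<times> U \<Longrightarrow> (\<lambda>(t, x). st_deriv j F t x) p = F' p (direction j)"
    by (rule smooth_st_derivative[OF F]) blast
  have int: "st_deriv a (st_deriv b F) t x = st_deriv b (st_deriv a F) t x" if p: "(t, x) \<in> S" for a b t x
  proof -
    have second: "\<exists>P. (\<forall>p\<in>S. ((\<lambda>p. F' p (direction b)) has_derivative P p) (at p)) \<and>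
        (\<forall>p\<in>S. P p (direction a) = (\<lambda>(t, x). st_deriv a (st_deriv b F) t x) p) \<and> continuous_on S (\<lambda>p. P p (direction a))" for a b
    proof -
      obtain P where P: "\<And>p. p \<in> I \<times> U \<Longrightarrow> ((\<lambda>(t, x). st_deriv b F t x) has_derivative P p) (at p within I \<times> U)"
        "\<And>j p. p \<in> I \<times> U \<Longrightarrow> (\<lambda>(t, x). st_deriv j (st_deriv b F) t x) p = P p (direction j)"
        by (rule smooth_st_derivative[OF smooth_st_st_deriv[OF F]]) blast
      have "((\<lambda>p. F' p (direction b)) has_derivative P p) (at p)" if "p \<in> S" for p
      proof -
        have "((\<lambda>(t, x). st_deriv b F t x) has_derivative P p) (at p)"
          using P(1)[of p] at_within_open_subset[of p S "I \<times> U"] S that by auto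
        then show ?thesis
          by (rule has_derivative_transform_within_open[OF _ S(1) that]) (use F'(2) S(2) in blast)
      qed
      moreover have "continuous_on S (\<lambda>p. P p (direction a))"
      proof -
        have "continuous_on (I \<times> U) (\<lambda>(t, x). st_deriv a (st_deriv b F) t x)"
          using smooth_st_st_deriv[OF smooth_st_st_deriv[OF F]] unfolding smooth_st_def smooth_on_def
          using Ck_on_continuous by blast
        then have "continuous_on S (\<lambda>(t, x). st_deriv a (st_deriv b F) t x)"
          using S(2) continuous_on_subset by blast
        then show ?thesis
          using P(2)[of _ a] S(2) by (subst continuous_on_cong[OF refl, of S _ "\<lambda>(t, x). st_deriv a (st_deriv b F) t x"]) auto
      qed
      ultimately show ?thesis
        using P(2)[of _ a] S(2) by (intro exI[of _ P]) auto
    qed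
    obtain P where P: "\<And>p. p \<in> S \<Longrightarrow> ((\<lambda>p. F' p (direction b)) has_derivative P p) (at p)"
      "\<And>p. p \<in> S \<Longrightarrow> P p (direction a) = (\<lambda>(t, x). st_deriv a (st_deriv b F) t x) p" "continuous_on S (\<lambda>p. P p (direction a))"
      using second[of b a] by blast
    obtain Q where Q: "\<And>p. p \<in> S \<Longrightarrow> ((\<lambda>p. F' p (direction a)) has_derivative Q p) (at p)"
      "\<And>p. p \<in> S \<Longrightarrow> Q p (direction b) = (\<lambda>(t, x). st_deriv b (st_deriv a F) t x) p" "continuous_on S (\<lambda>p. Q p (direction b))"
      using second[of a b] by blast
    have "((\<lambda>(t, x). F t x) has_derivative F' p) (at p)" if "p \<in> S" for p
      using F'(1)[of p] at_within_open_subset[of p S "I \<times> U"] S that by auto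
    from mixed_partials_commute[OF S(1) p this P(1) Q(1) P(3) Q(3)]
    show ?thesis using P(2)[OF p] Q(2)[OF p] by simp
  qed
  define Z where "Z = {s \<in> I. st_deriv i (st_deriv j F) s x - st_deriv j (st_deriv i F) s x = 0}"
  have cont: "continuous_on I (\<lambda>s. st_deriv a (st_deriv b F) s x)" for a b
  proof -
    have "continuous_on (I \<times> U) (\<lambda>(t, x). st_deriv a (st_deriv b F) t x)"
      using smooth_st_st_deriv[OF smooth_st_st_deriv[OF F]] unfolding smooth_st_def smooth_on_def
      using Ck_on_continuous by blast
    then have "continuous_on I ((\<lambda>(t, x). st_deriv a (st_deriv b F) t x) \<circ> (\<lambda>s. (s, x)))"
      using tx by (intro continuous_on_compose continuous_intros) (auto intro: continuous_on_subset)
    then show ?thesis by (simp add: o_def)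
  qed
  have "closedin (top_of_set I) Z"
    unfolding Z_def by (intro continuous_closedin_preimage_constant continuous_on_diff cont)
  then obtain T where T: "closed T" "Z = I \<inter> T"
    by (auto simp: closedin_closed)
  have "interior I \<subseteq> Z"
    using int[of _ x i j] tx interior_subset by (auto simp: Z_def S_def)
  then have "closure (interior I) \<subseteq> T"
    using T by (intro closure_minimal) auto
  moreover have "t \<in> closure (interior I)"
    using convex_closure_interior[of I] interval interior_I tx(1) closure_subset[of I]
    by (auto simp: is_interval_convex)
  ultimately have "t \<in> Z" using T tx by auto
  then show ?thesis by (simp add: Z_def)
qed

section \<open>Iterated derivatives in space and time and the Leibniz rule\<close>

primrec st_derivs :: "'n option list \<Rightarrow> (real \<Rightarrow> real ^ 'n \<Rightarrow> real) \<Rightarrow> real \<Rightarrow> real ^ 'n \<Rightarrow> real" where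
  "st_derivs [] F = F"
| "st_derivs (j # w) F = st_derivs w (st_deriv j F)"

lemma st_derivs_append: "st_derivs (u @ w) F = st_derivs w (st_derivs u F)"
  by (induction u arbitrary: F) simp_all

lemma smooth_st_st_derivs: "smooth_st F \<Longrightarrow> smooth_st (st_derivs w F)"
  by (induction w arbitrary: F) (simp_all add: smooth_st_st_deriv)

lemma st_derivs_cong:
  assumes "smooth_st F" "\<And>t x. t \<in> I \<Longrightarrow> x \<in> U \<Longrightarrow> F t x = G t x" "t \<in> I" "x \<in> U"
  shows "st_derivs w F t x = st_derivs w G t x"
  using assms(1,2)
proof (induction w arbitrary: F G)
  case Nil
  then show ?case using assms by simp
next
  case (Cons j w)
  show ?case
    unfolding st_derivs.simps by (rule Cons.IH) (use Cons.prems in \<open>auto intro: smooth_st_st_deriv st_deriv_cong\<close>)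
qed

lemma st_derivs_add:
  assumes "smooth_st F" "smooth_st G" "t \<in> I" "x \<in> U"
  shows "st_derivs w (\<lambda>t x. F t x + G t x) t x = st_derivs w F t x + st_derivs w G t x"
  using assms(1,2)
proof (induction w arbitrary: F G)
  case (Cons j w)
  have "st_derivs (j # w) (\<lambda>t x. F t x + G t x) t x = st_derivs w (\<lambda>t x. st_deriv j F t x + st_deriv j G t x) t x"
    unfolding st_derivs.simps
    by (rule st_derivs_cong) (use assms Cons.prems in \<open>auto intro: smooth_st_st_deriv smooth_st_add st_deriv_add\<close>)
  then show ?case
    using Cons by (simp add: smooth_st_st_deriv)
qed simp

lemma st_derivs_mult:
  assumes "smooth_st F" "smooth_st G" "t \<in> I" "x \<in> U"
  shows "st_derivs w (\<lambda>t x. F t x * G t x) t x = shuffle (\<lambda>w. st_derivs w F t x) (\<lambda>w. st_derivs w G t x) w"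
  using assms(1,2)
proof (induction w arbitrary: F G)
  case (Cons j w)
  have "st_derivs (j # w) (\<lambda>t x. F t x * G t x) t x = st_derivs w (\<lambda>t x. st_deriv j F t x * G t x + F t x * st_deriv j G t x) t x"
    unfolding st_derivs.simps
    by (rule st_derivs_cong) (use assms Cons.prems in \<open>auto intro: smooth_st_st_deriv smooth_st_mult st_deriv_mult\<close>)
  also have "\<dots> = st_derivs w (\<lambda>t x. st_deriv j F t x * G t x) t x + st_derivs w (\<lambda>t x. F t x * st_deriv j G t x) t x"
    by (rule st_derivs_add) (use assms Cons.prems in \<open>auto intro: smooth_st_st_deriv smooth_st_mult\<close>)
  finally show ?case
    using Cons by (simp add: smooth_st_st_deriv)
qed simp

lemma st_derivs_const: "t \<in> I \<Longrightarrow> x \<in> U \<Longrightarrow> st_derivs w (\<lambda>t x. c) t x = (if w = [] then c else 0)"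
proof (induction w arbitrary: c)
  case (Cons j w)
  have "st_derivs w (st_deriv j (\<lambda>t x. c)) t x = st_derivs w (\<lambda>t x. 0) t x"
    by (rule st_derivs_cong) (use Cons.prems in \<open>auto intro: smooth_st_st_deriv smooth_st_const st_deriv_const\<close>)
  then show ?case using Cons by simp
qed simp

lemma st_derivs_symmetric:
  assumes "smooth_st F" "t \<in> I" "x \<in> U"
  shows "jet_symmetric (\<lambda>w. st_derivs w F t x)"
  unfolding jet_symmetric_def
proof (intro allI)
  fix u i j v
  have "st_derivs v (st_deriv j (st_deriv i (st_derivs u F))) t x = st_derivs v (st_deriv i (st_deriv j (st_derivs u F))) t x"
    by (rule st_derivs_cong) (use assms in \<open>auto intro: smooth_st_st_deriv smooth_st_st_derivs st_deriv_commute\<close>)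
  then show "st_derivs (u @ i # j # v) F t x = st_derivs (u @ j # i # v) F t x"
    by (simp add: st_derivs_append)
qed

end

locale spacetime_point = spacetime I U for I :: "real set" and U :: "(real ^ 'n::finite) set" +
  fixes t0 :: real and x0 :: "real ^ 'n"
  assumes t0: "t0 \<in> I" and x0: "x0 \<in> U"
begin

text \<open>A relation rather than a function: its introduction rules follow the definition of a
  geometric quantity term by term and carry joint smoothness along with the jet.\<close>

definition has_jet :: "(real \<Rightarrow> real ^ 'n \<Rightarrow> real) \<Rightarrow> 'n option jet \<Rightarrow> bool" where
  "has_jet F a \<longleftrightarrow> smooth_st F \<and> Rep_jet a = (\<lambda>w. st_derivs w F t0 x0)"

lemma has_jet_exists: "smooth_st F \<Longrightarrow> \<exists>a. has_jet F a"
  unfolding has_jet_def using st_derivs_symmetric[of F, OF _ t0 x0] Abs_jet_inverse by blast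

lemma has_jet_unique: "has_jet F a \<Longrightarrow> has_jet F b \<Longrightarrow> a = b"
  unfolding has_jet_def using Rep_jet_inject by metis

lemma has_jet_cong: "has_jet F a \<Longrightarrow> (\<And>t x. t \<in> I \<Longrightarrow> x \<in> U \<Longrightarrow> F t x = G t x) \<Longrightarrow> has_jet G a"
  unfolding has_jet_def using smooth_st_cong st_derivs_cong[OF _ _ t0 x0] by metis

text \<open>Equality on all of \<open>I \<times> U\<close> gives equality of all derivatives at the
  point. Through this rule the hypotheses on the metric, the form and the flow become assumptions of
  the algebraic locales.\<close>

lemma has_jet_eq: "has_jet F a \<Longrightarrow> has_jet G b \<Longrightarrow> (\<And>t x. t \<in> I \<Longrightarrow> x \<in> U \<Longrightarrow> F t x = G t x) \<Longrightarrow> a = b"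
  using has_jet_cong has_jet_unique by blast

lemma has_jet_value: "has_jet F a \<Longrightarrow> F t0 x0 = jet_value a"
  by (simp add: has_jet_def jet_value.rep_eq)

lemma has_jet_st_deriv: "has_jet F a \<Longrightarrow> has_jet (st_deriv j F) (jet_deriv j a)"
  by (simp add: has_jet_def jet_deriv.rep_eq smooth_st_st_deriv)

lemma has_jet_pd: "has_jet F a \<Longrightarrow> has_jet (\<lambda>t x. pd i (\<lambda>y. F t y) x) (jet_deriv (Some i) a)"
  using has_jet_st_deriv[of F a "Some i"] by (simp add: st_deriv_def[abs_def])

lemma has_jet_add: "has_jet F a \<Longrightarrow> has_jet G b \<Longrightarrow> has_jet (\<lambda>t x. F t x + G t x) (a + b)"
  by (simp add: has_jet_def plus_jet.rep_eq smooth_st_add st_derivs_add t0 x0)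

lemma has_jet_mult: "has_jet F a \<Longrightarrow> has_jet G b \<Longrightarrow> has_jet (\<lambda>t x. F t x * G t x) (a * b)"
  by (simp add: has_jet_def times_jet.rep_eq smooth_st_mult st_derivs_mult t0 x0)

lemma has_jet_const: "has_jet (\<lambda>t x. c) (c *\<^sub>R 1)"
  by (simp add: has_jet_def smooth_st_const st_derivs_const t0 x0 scaleR_jet.rep_eq one_jet.rep_eq fun_eq_iff)

lemma has_jet_0: "has_jet (\<lambda>t x. 0) 0" and has_jet_1: "has_jet (\<lambda>t x. 1) 1"
  using has_jet_const[of 0] has_jet_const[of 1] by simp_all

lemma has_jet_cmult: "has_jet F a \<Longrightarrow> has_jet (\<lambda>t x. c * F t x) (c *\<^sub>R a)"
  using has_jet_mult[OF has_jet_const[of c]] by simp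

lemma has_jet_minus: "has_jet F a \<Longrightarrow> has_jet (\<lambda>t x. - F t x) (- a)"
  using has_jet_cmult[of F a "- 1"] by simp

lemma has_jet_diff: "has_jet F a \<Longrightarrow> has_jet G b \<Longrightarrow> has_jet (\<lambda>t x. F t x - G t x) (a - b)"
  using has_jet_add[OF _ has_jet_minus] by fastforce

lemma has_jet_sum: "(\<And>i. i \<in> A \<Longrightarrow> has_jet (F i) (a i)) \<Longrightarrow> has_jet (\<lambda>t x. \<Sum>i\<in>A. F i t x) (\<Sum>i\<in>A. a i)"
  by (induction A rule: infinite_finite_induct) (auto intro: has_jet_0 has_jet_add)

end

section \<open>Jets of the geometric quantities\<close>

lemma matrix_inv_works:
  fixes A :: "'a::semiring_1 ^ 'n ^ 'n"
  assumes "invertible A"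
  shows "A ** matrix_inv A = mat 1" "matrix_inv A ** A = mat 1"
  using someI_ex[OF assms[unfolded invertible_def]] unfolding matrix_inv_def by auto

lemma matrix_inv_symmetric:
  fixes A :: "real ^ 'n::finite ^ 'n"
  assumes "invertible A" "transpose A = A"
  shows "transpose (matrix_inv A) = matrix_inv A"
proof -
  have "transpose (matrix_inv A) ** A = mat 1"
    using arg_cong[OF matrix_inv_works(1)[OF assms(1)], of transpose] assms(2)
    by (simp add: matrix_transpose_mul)
  then have "transpose (matrix_inv A) ** A ** matrix_inv A = matrix_inv A"
    by simp
  then show ?thesis
    by (simp add: matrix_mul_assoc[symmetric] matrix_inv_works(1)[OF assms(1)])
qed

text \<open>Smoothness of the inverse metric is read off from Cramer's rule.\<close>

lemma matrix_inv_cramer: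
  fixes A :: "real ^ 'n::finite ^ 'n"
  assumes "invertible A"
  shows "matrix_inv A $ i $ j = det (\<chi> a b. if b = i then (if a = j then 1 else 0) else A $ a $ b) * inverse (det A)"
proof -
  have "det A \<noteq> 0" using assms invertible_det_nz by blast
  have "A *v (matrix_inv A *v axis j 1) = axis j 1"
    by (simp add: matrix_vector_mul_assoc matrix_inv_works[OF assms])
  then have "matrix_inv A *v axis j 1 = (\<chi> k. det (\<chi> a b. if b = k then axis j 1 $ a else A $ a $ b) / det A)"
    using cramer[OF \<open>det A \<noteq> 0\<close>] by blast
  then have "(matrix_inv A *v axis j 1) $ i = det (\<chi> a b. if b = i then axis j 1 $ a else A $ a $ b) / det A"
    by simp
  moreover have "(matrix_inv A *v axis j 1) $ i = matrix_inv A $ i $ j"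
    by (simp add: matrix_vector_mult_def axis_def if_distrib cong: if_cong)
  ultimately show ?thesis
    by (simp add: axis_def divide_inverse eq_commute[of j] cong: if_cong)
qed

lemma tensor_inner_0: "tensor_inner G 0 S T = S [] * T []"
  by (simp add: tensor_inner_def)

text \<open>A list of length \<open>Suc k\<close> is a head and a list of length \<open>k\<close>.
  Together with \<open>tensor_inner_0\<close> this is the recursion of
  \<open>form_dot\<close>.\<close>

lemma tensor_inner_Suc:
  "tensor_inner G (Suc k) S T =
     (\<Sum>i\<in>UNIV. \<Sum>j\<in>UNIV. matrix_inv G $ i $ j * tensor_inner G k (\<lambda>v. S (i # v)) (\<lambda>v. T (j # v)))"
  for S T :: "'n::finite list \<Rightarrow> real"
proof -
  have lists: "(\<Sum>v | length v = Suc k. F v) = (\<Sum>i\<in>UNIV. \<Sum>v | length v = k. F (i # v))"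
    for F :: "'n list \<Rightarrow> real"
  proof -
    have "(\<Sum>v | length v = Suc k. F v) = (\<Sum>(i, v)\<in>UNIV \<times> {v. length v = k}. F (i # v))"
      by (rule sum.reindex_bij_witness[of _ "\<lambda>(i, v). i # v" "\<lambda>v. (hd v, tl v)"]) (auto simp: length_Suc_conv)
    then show ?thesis by (simp add: sum.cartesian_product)
  qed
  have "tensor_inner G (Suc k) S T = (\<Sum>i\<in>UNIV. \<Sum>v | length v = k. \<Sum>j\<in>UNIV. \<Sum>w | length w = k.
      (\<Prod>r<Suc k. matrix_inv G $ ((i # v) ! r) $ ((j # w) ! r)) * S (i # v) * T (j # w))"
    unfolding tensor_inner_def lists ..
  also have "\<dots> = (\<Sum>i\<in>UNIV. \<Sum>j\<in>UNIV. \<Sum>v | length v = k. \<Sum>w | length w = k.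
      (\<Prod>r<Suc k. matrix_inv G $ ((i # v) ! r) $ ((j # w) ! r)) * S (i # v) * T (j # w))"
    by (intro sum.cong refl sum.swap)
  also have "\<dots> = (\<Sum>i\<in>UNIV. \<Sum>j\<in>UNIV. matrix_inv G $ i $ j * tensor_inner G k (\<lambda>v. S (i # v)) (\<lambda>v. T (j # v)))"
    by (simp add: tensor_inner_def prod.lessThan_Suc_shift sum_distrib_left mult.assoc del: prod.lessThan_Suc)
  finally show ?thesis .
qed

lemma cov_deriv_Nil: "cov_deriv g T x m [] = pd m (\<lambda>y. T y []) x"
  by (simp add: cov_deriv_def)

lemma cov_deriv_Cons:
  "cov_deriv g T x m (i # v) =
     cov_deriv g (\<lambda>y v. T y (i # v)) x m v - (\<Sum>l\<in>UNIV. christoffel g l m i x * T x (l # v))"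
  by (simp add: cov_deriv_def sum.lessThan_Suc_shift del: sum.lessThan_Suc)

text \<open>Splitting off the summand \<open>r = 0\<close> shifts the remaining signs, which gives
  the recursion of \<open>wedge\<close>.\<close>

lemma alternating_sum_Cons:
  fixes B :: "'n \<Rightarrow> 'n list \<Rightarrow> real"
  shows "(\<Sum>r<length (i # v). (- 1) ^ r * B ((i # v) ! r) (take r (i # v) @ drop (Suc r) (i # v))) =
    B i v - (\<Sum>r<length v. (- 1) ^ r * B (v ! r) (i # (take r v @ drop (Suc r) v)))"
  by (simp add: sum.lessThan_Suc_shift sum_negf del: sum.lessThan_Suc)

context spacetime_point
begin

lemma smooth_st_sum: "(\<And>i. i \<in> A \<Longrightarrow> smooth_st (F i)) \<Longrightarrow> smooth_st (\<lambda>t x. \<Sum>i\<in>A. F i t x)"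
  unfolding smooth_st_def case_prod_unfold by (rule smooth_on_sum)

lemma smooth_st_prod: "(\<And>i. i \<in> A \<Longrightarrow> smooth_st (F i)) \<Longrightarrow> smooth_st (\<lambda>t x. \<Prod>i\<in>A. F i t x)"
  unfolding smooth_st_def case_prod_unfold by (rule smooth_on_prod)

lemma smooth_st_inverse:
  "smooth_st F \<Longrightarrow> (\<And>t x. t \<in> I \<Longrightarrow> x \<in> U \<Longrightarrow> F t x \<noteq> 0) \<Longrightarrow> smooth_st (\<lambda>t x. inverse (F t x))"
  unfolding smooth_st_def case_prod_unfold by (rule smooth_on_inverse) auto

lemma smooth_st_det:
  fixes A :: "real \<Rightarrow> real ^ 'n \<Rightarrow> real ^ 'm::finite ^ 'm"
  assumes "\<And>i j. smooth_st (\<lambda>t x. A t x $ i $ j)"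
  shows "smooth_st (\<lambda>t x. det (A t x))"
  unfolding det_def by (intro smooth_st_sum smooth_st_mult smooth_st_const smooth_st_prod assms)

end

section \<open>Jets of a smooth family of metrics, its curvature and its operators on forms\<close>

locale riemannian_jets = spacetime_point I U t0 x0
  for I :: "real set" and U :: "(real ^ 'n::finite) set" and t0 x0 +
  fixes G :: "real \<Rightarrow> 'n lmetric"
  assumes smooth_G: "smooth_st (\<lambda>t x. G t x $ i $ j)"
    and G_sym: "t \<in> I \<Longrightarrow> x \<in> U \<Longrightarrow> transpose (G t x) = G t x"
    and G_inv: "t \<in> I \<Longrightarrow> x \<in> U \<Longrightarrow> invertible (G t x)"
begin

lemma smooth_matrix_inv: "smooth_st (\<lambda>t x. matrix_inv (G t x) $ i $ j)"
proof -
  have "smooth_st (\<lambda>t x. det (\<chi> a b. if b = i then (if a = j then 1 else 0) else G t x $ a $ b) * inverse (det (G t x)))"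
  proof (intro smooth_st_mult smooth_st_det smooth_st_inverse smooth_G)
    show "smooth_st (\<lambda>t x. (\<chi> a b. if b = i then (if a = j then 1 else 0) else G t x $ a $ b) $ k $ l)" for k l
      by (cases "k = j"; cases "l = i") (simp_all add: smooth_G smooth_st_const)
    show "det (G t x) \<noteq> 0" if "t \<in> I" "x \<in> U" for t x
      using G_inv[OF that] invertible_det_nz by blast
  qed
  then show ?thesis
    by (rule smooth_st_cong) (simp add: matrix_inv_cramer G_inv)
qed

definition gg :: "'n \<Rightarrow> 'n \<Rightarrow> 'n option jet" where
  "gg i j = (SOME a. has_jet (\<lambda>t x. G t x $ i $ j) a)"

definition qq :: "'n \<Rightarrow> 'n \<Rightarrow> 'n option jet" where
  "qq i j = (SOME a. has_jet (\<lambda>t x. matrix_inv (G t x) $ i $ j) a)"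

lemma has_jet_gg: "has_jet (\<lambda>t x. G t x $ i $ j) (gg i j)"
  unfolding gg_def by (rule someI_ex[OF has_jet_exists[OF smooth_G]])

lemma has_jet_qq: "has_jet (\<lambda>t x. matrix_inv (G t x) $ i $ j) (qq i j)"
  unfolding qq_def by (rule someI_ex[OF has_jet_exists[OF smooth_matrix_inv]])

sublocale metric_algebra "\<lambda>i. jet_deriv (Some i)" gg qq
proof
  fix i j :: 'n and a :: "'n option jet"
  show "derivation (jet_deriv (Some i))" by (rule derivation_jet_deriv)
  show "jet_deriv (Some i) (jet_deriv (Some j) a) = jet_deriv (Some j) (jet_deriv (Some i) a)"
    by (rule jet_deriv_commute)
  show "gg i j = gg j i"
  proof (rule has_jet_eq[OF has_jet_gg has_jet_gg])
    fix t x assume "t \<in> I" "x \<in> U"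
    then have "transpose (G t x) $ i $ j = G t x $ i $ j" by (simp add: G_sym)
    then show "G t x $ i $ j = G t x $ j $ i" by (simp add: transpose_def)
  qed
  show "qq i j = qq j i"
  proof (rule has_jet_eq[OF has_jet_qq has_jet_qq])
    fix t x assume "t \<in> I" "x \<in> U"
    then have "transpose (matrix_inv (G t x)) $ i $ j = matrix_inv (G t x) $ i $ j"
      by (simp add: G_sym G_inv matrix_inv_symmetric)
    then show "matrix_inv (G t x) $ i $ j = matrix_inv (G t x) $ j $ i" by (simp add: transpose_def)
  qed
  have "has_jet (\<lambda>t x. \<Sum>k\<in>UNIV. matrix_inv (G t x) $ i $ k * G t x $ k $ j) (\<Sum>k\<in>UNIV. qq i k * gg k j)"
    by (intro has_jet_sum has_jet_mult has_jet_gg has_jet_qq)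
  moreover have "has_jet (\<lambda>t x. if i = j then 1 else 0) (if i = j then 1 else 0)"
    by (simp add: has_jet_0 has_jet_1)
  ultimately show "(\<Sum>k\<in>UNIV. qq i k * gg k j) = (if i = j then 1 else 0)"
  proof (rule has_jet_eq)
    fix t x assume tx: "t \<in> I" "x \<in> U"
    have "(matrix_inv (G t x) ** G t x) $ i $ j = mat 1 $ i $ j"
      by (simp add: matrix_inv_works(2)[OF G_inv[OF tx]])
    then show "(\<Sum>k\<in>UNIV. matrix_inv (G t x) $ i $ k * G t x $ k $ j) = (if i = j then 1 else 0)"
      by (simp add: matrix_matrix_mult_def mat_def)
  qed
qed

lemma has_jet_christoffel: "has_jet (\<lambda>t x. christoffel (G t) k i j x) (Gam k i j)"
  unfolding christoffel_def Gam_def by (intro has_jet_cmult has_jet_sum has_jet_mult has_jet_diff has_jet_add has_jet_pd has_jet_gg has_jet_qq)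

lemma has_jet_ricci: "has_jet (\<lambda>t x. ricci (G t) x j k) (Ric j k)"
  unfolding ricci_def riemann_def Ric_def Riem_def
  by (intro has_jet_sum has_jet_mult has_jet_diff has_jet_add has_jet_pd has_jet_christoffel)

lemma has_jet_scalar_curvature: "has_jet (\<lambda>t x. scalar_curvature (G t) x) Scal"
  unfolding scalar_curvature_def Scal_def contract_def by (intro has_jet_sum has_jet_mult has_jet_ricci has_jet_qq)

lemma has_jet_hessian:
  assumes "has_jet F f"
  shows "has_jet (\<lambda>t x. hessian (G t) (F t) x i j) (nabla (nabla (\<lambda>v. f)) [i, j])"
proof -
  have "has_jet (\<lambda>t x. hessian (G t) (F t) x i j)
     (jet_deriv (Some i) (jet_deriv (Some j) f) - (\<Sum>l\<in>UNIV. Gam l i j * jet_deriv (Some l) f))"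
    unfolding hessian_def by (intro has_jet_sum has_jet_mult has_jet_diff has_jet_pd has_jet_christoffel assms)
  then show ?thesis by (simp add: cov_Cons cov_Nil)
qed

lemma has_jet_laplacian:
  assumes "has_jet F f"
  shows "has_jet (\<lambda>t x. laplacian (G t) (F t) x) (Lap f)"
  unfolding laplacian_def Lap_def divg_def contract_def by (intro has_jet_sum has_jet_mult has_jet_hessian has_jet_qq assms)

lemma has_jet_gradient:
  assumes "has_jet F f"
  shows "has_jet (\<lambda>t x. gradient (G t) (F t) x $ i) (\<Sum>j\<in>UNIV. qq i j * jet_deriv (Some j) f)"
  unfolding gradient_def vec_lambda_beta by (intro has_jet_sum has_jet_mult has_jet_pd has_jet_qq assms)

text \<open>Lowering one of the two gradients by \<open>sum_qg\<close> turns the norm of the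
  gradient vector into the dual norm of the differential.\<close>

lemma has_jet_vec_normsq_gradient:
  assumes "has_jet F f"
  shows "has_jet (\<lambda>t x. vec_normsq (G t x) (gradient (G t) (F t) x)) (contract (\<lambda>i j. jet_deriv (Some i) f * jet_deriv (Some j) f))"
proof -
  let ?X = "\<lambda>i. \<Sum>j\<in>UNIV. qq i j * jet_deriv (Some j) f"
  have "has_jet (\<lambda>t x. vec_normsq (G t x) (gradient (G t) (F t) x)) (\<Sum>i\<in>UNIV. \<Sum>j\<in>UNIV. gg i j * ?X i * ?X j)"
    unfolding vec_normsq_def by (intro has_jet_sum has_jet_mult has_jet_gradient has_jet_gg assms)
  also have "(\<Sum>i\<in>UNIV. \<Sum>j\<in>UNIV. gg i j * ?X i * ?X j) = (\<Sum>i\<in>UNIV. ?X i * (\<Sum>j\<in>UNIV. ?X j * gg j i))"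
  proof -
    have "(\<Sum>i\<in>UNIV. \<Sum>j\<in>UNIV. gg i j * X i * X j) = (\<Sum>i\<in>UNIV. X i * (\<Sum>j\<in>UNIV. X j * gg j i))" for X
      by (simp add: sum_distrib_left mult_ac g_sym)
    then show ?thesis .
  qed
  also have "\<dots> = contract (\<lambda>i j. jet_deriv (Some i) f * jet_deriv (Some j) f)"
    unfolding sum_qg by (simp add: contract_def sum_distrib_left sum_distrib_right mult_ac)
  finally show ?thesis .
qed

lemma has_jet_tensor_inner:
  assumes "\<And>v. has_jet (\<lambda>t x. S t x v) (s v)" "\<And>v. has_jet (\<lambda>t x. T t x v) (u v)"
  shows "has_jet (\<lambda>t x. tensor_inner (G t x) k (S t x) (T t x)) (form_dot k s u)"
  using assms
proof (induction k arbitrary: S T s u)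
  case 0
  then show ?case by (simp add: tensor_inner_0 has_jet_mult)
next
  case (Suc k)
  show ?case
    unfolding tensor_inner_Suc form_dot.simps contract_def
    by (intro has_jet_sum has_jet_mult has_jet_qq Suc.IH Suc.prems)
qed

lemma has_jet_form_inner:
  assumes "\<And>v. has_jet (\<lambda>t x. S t x v) (s v)" "\<And>v. has_jet (\<lambda>t x. T t x v) (u v)"
  shows "has_jet (\<lambda>t x. form_inner (G t x) (S t x) (T t x)) (\<Sum>k\<le>CARD('n). form_dot k s u)"
  unfolding form_inner_def by (intro has_jet_sum has_jet_tensor_inner assms)

lemma has_jet_form_square:
  assumes "\<And>v. has_jet (\<lambda>t x. S t x v) (s v)"
  shows "has_jet (\<lambda>t x. form_square (G t x) (S t x) i j) (\<Sum>k\<le>CARD('n). form_dot k (\<lambda>w. s (i # w)) (\<lambda>w. s (j # w)))"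
proof -
  have *: "interior_product (axis i 1) T = (\<lambda>w. T (i # w))" for i and T :: "'n list \<Rightarrow> real"
    by (rule ext) (simp add: interior_product_def axis_def if_distrib[of "\<lambda>x. x * _"] cong: if_cong)
  show ?thesis
    unfolding form_square_def * by (intro has_jet_form_inner assms)
qed

lemma has_jet_cov_deriv:
  assumes "\<And>v. has_jet (\<lambda>t x. T t x v) (s v)"
  shows "has_jet (\<lambda>t x. cov_deriv (G t) (T t) x m v) (cov m s v)"
  using assms
proof (induction v arbitrary: T s)
  case Nil
  show ?case
    unfolding cov_deriv_Nil cov_Nil by (intro has_jet_pd Nil)
next
  case (Cons i v)
  show ?case
    unfolding cov_deriv_Cons cov_Cons by (intro has_jet_diff has_jet_sum has_jet_mult has_jet_christoffel Cons)
qed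

lemma has_jet_codiff:
  assumes "\<And>v. has_jet (\<lambda>t x. T t x v) (s v)"
  shows "has_jet (\<lambda>t x. codiff (G t) (T t) x v) (- divg s v)"
  unfolding codiff_def divg_def contract_def nabla.simps by (intro has_jet_minus has_jet_sum has_jet_mult has_jet_qq has_jet_cov_deriv assms)

lemma has_jet_alternating_sum:
  assumes "\<And>l w. has_jet (\<lambda>t x. B t x l w) (b l w)"
  shows "has_jet (\<lambda>t x. \<Sum>r<length v. (- 1) ^ r * B t x (v ! r) (take r v @ drop (Suc r) v)) (wedge b v)"
  using assms
proof (induction v arbitrary: B b)
  case Nil
  show ?case by (simp add: has_jet_0)
next
  case (Cons i v)
  have "has_jet (\<lambda>t x. B t x i v - (\<Sum>r<length v. (- 1) ^ r * B t x (v ! r) (i # (take r v @ drop (Suc r) v)))) (wedge b (i # v))"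
    unfolding wedge.simps
    by (intro has_jet_diff Cons.prems Cons.IH[of "\<lambda>t x l w. B t x l (i # w)" "\<lambda>l w. b l (i # w)"])
  then show ?case
    by (rule has_jet_cong) (rule alternating_sum_Cons[symmetric])
qed

lemma has_jet_ext_deriv:
  assumes "\<And>v. has_jet (\<lambda>t x. T t x v) (s v)"
  shows "has_jet (\<lambda>t x. ext_deriv (T t) x v) (wedge (\<lambda>l w. jet_deriv (Some l) (s w)) v)"
  unfolding ext_deriv_def
  by (rule has_jet_alternating_sum[of "\<lambda>t x l w. pd l (\<lambda>y. T t y w) x"]) (intro has_jet_pd assms)

text \<open>For a closed form the summand d^* d has jet 0, which leaves - d d^*.\<close>

lemma has_jet_hodge_laplacian:
  assumes "\<And>v. has_jet (\<lambda>t x. T t x v) (s v)"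
    and closed: "\<And>v. wedge (\<lambda>l w. jet_deriv (Some l) (s w)) v = 0"
  shows "has_jet (\<lambda>t x. hodge_laplacian (G t) (T t) x v) (- wedge (\<lambda>l w. jet_deriv (Some l) (- divg s w)) v)"
proof -
  have "has_jet (\<lambda>t x. hodge_laplacian (G t) (T t) x v)
     (- (wedge (\<lambda>l w. jet_deriv (Some l) (- divg s w)) v + - divg (wedge (\<lambda>l w. jet_deriv (Some l) (s w))) v))"
    unfolding hodge_laplacian_def
    by (intro has_jet_minus has_jet_add has_jet_ext_deriv has_jet_codiff assms)
  moreover have "divg (wedge (\<lambda>l w. jet_deriv (Some l) (s w))) v = 0"
    unfolding closed[abs_def] divg_def by (simp add: closed cov_0 contract_0)
  ultimately show ?thesis by simp
qed

lemma has_jet_interior_gradient: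
  assumes "has_jet F f" "\<And>v. has_jet (\<lambda>t x. T t x v) (s v)"
  shows "has_jet (\<lambda>t x. interior_product (gradient (G t) (F t) x) (T t x) v)
     (contract (\<lambda>i j. jet_deriv (Some i) f * s (j # v)))"
proof -
  have "has_jet (\<lambda>t x. interior_product (gradient (G t) (F t) x) (T t x) v)
     (\<Sum>i\<in>UNIV. (\<Sum>j\<in>UNIV. qq i j * jet_deriv (Some j) f) * s (i # v))"
    unfolding interior_product_def by (intro has_jet_sum has_jet_mult has_jet_gradient assms)
  also have "(\<Sum>i\<in>UNIV. (\<Sum>j\<in>UNIV. qq i j * jet_deriv (Some j) f) * s (i # v)) =
     contract (\<lambda>i j. jet_deriv (Some j) f * s (i # v))"
    by (simp add: contract_def sum_distrib_right mult.assoc)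
  also have "\<dots> = contract (\<lambda>i j. jet_deriv (Some i) f * s (j # v))"
    by (rule contract_transpose)
  finally show ?thesis .
qed

lemma has_jet_twisted_scalar_curvature:
  assumes "has_jet F f" "\<And>v. has_jet (\<lambda>t x. T t x v) (s v)"
  shows "has_jet (\<lambda>t x. twisted_scalar_curvature (G t) (T t) (F t) x)
    (Scal - (1/4) *\<^sub>R (\<Sum>k=1..CARD('n). (1 / real k) *\<^sub>R form_dot k s s) + 2 *\<^sub>R Lap f
      - contract (\<lambda>i j. jet_deriv (Some i) f * jet_deriv (Some j) f))"
  unfolding twisted_scalar_curvature_def
  by (intro has_jet_diff has_jet_add has_jet_cmult has_jet_sum has_jet_scalar_curvature has_jet_tensor_inner has_jet_laplacian has_jet_vec_normsq_gradient assms)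

end

section \<open>Charts\<close>

lemma Ck_on_component:
  fixes f :: "'a::euclidean_space \<Rightarrow> real ^ 'n::finite"
  shows "Ck_on k S f \<Longrightarrow> Ck_on k S (\<lambda>x. f x $ j)"
proof (induction k arbitrary: f)
  case 0
  then show ?case by (auto intro: continuous_on_component)
next
  case (Suc k)
  obtain f' where f': "\<And>x. x \<in> S \<Longrightarrow> (f has_derivative f' x) (at x within S)" "\<And>v. Ck_on k S (\<lambda>x. f' x v)"
    using Suc.prems(1) by (rule Ck_on_SucE) blast
  show ?case
    by (rule Ck_on_SucI[OF bounded_linear.has_derivative[OF bounded_linear_vec_nth f'(1)] Suc.IH[OF f'(2)]])
qed

lemma smooth_on_component:
  fixes f :: "'a::euclidean_space \<Rightarrow> real ^ 'n::finite"
  shows "smooth_on S f \<Longrightarrow> smooth_on S (\<lambda>x. f x $ j)"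
  by (simp add: smooth_on_def Ck_on_component)

lemma pd_eq: "(f has_derivative f') (at x) \<Longrightarrow> pd i f x = f' (axis i 1)"
  by (simp add: pd_def frechet_derivative_at[symmetric])

lemma smooth_near_lincomb:
  assumes "smooth_near A p f" "smooth_near A p h"
  shows "smooth_near A p (\<lambda>q. a * f q + b * h q)"
  unfolding smooth_near_def
proof (intro ballI impI)
  fix d assume d: "d \<in> A" "p \<in> fst d"
  obtain V W where "open V" "snd d p \<in> V" "V \<subseteq> chart_image d" "smooth_on V (f \<circ> chart_inv d)"
    "open W" "snd d p \<in> W" "W \<subseteq> chart_image d" "smooth_on W (h \<circ> chart_inv d)"
    using assms d unfolding smooth_near_def by metis
  then show "\<exists>W. open W \<and> snd d p \<in> W \<and> W \<subseteq> chart_image d \<and> smooth_on W ((\<lambda>q. a * f q + b * h q) \<circ> chart_inv d)"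
    unfolding o_def
    by (intro exI[of _ "V \<inter> W"] conjI smooth_on_add smooth_on_mult smooth_on_const)
      (auto intro: smooth_on_subset)
qed

lemma smooth_near_mult:
  assumes "smooth_near A p f" "smooth_near A p h"
  shows "smooth_near A p (\<lambda>q. f q * h q)"
  unfolding smooth_near_def
proof (intro ballI impI)
  fix d assume d: "d \<in> A" "p \<in> fst d"
  obtain V W where "open V" "snd d p \<in> V" "V \<subseteq> chart_image d" "smooth_on V (f \<circ> chart_inv d)"
    "open W" "snd d p \<in> W" "W \<subseteq> chart_image d" "smooth_on W (h \<circ> chart_inv d)"
    using assms d unfolding smooth_near_def by metis
  then show "\<exists>W. open W \<and> snd d p \<in> W \<and> W \<subseteq> chart_image d \<and> smooth_on W ((\<lambda>q. f q * h q) \<circ> chart_inv d)"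
    unfolding o_def
    by (intro exI[of _ "V \<inter> W"] conjI smooth_on_mult)
      (auto intro: smooth_on_subset)
qed

lemma smooth_near_derivative:
  assumes "smooth_near A p f" "c \<in> A" "p \<in> fst c"
  shows "\<exists>f'. ((f \<circ> chart_inv c) has_derivative f') (at (snd c p))"
proof -
  obtain W where W: "open W" "snd c p \<in> W" "smooth_on W (f \<circ> chart_inv c)"
    using assms unfolding smooth_near_def by blast
  obtain f' where "\<And>x. x \<in> W \<Longrightarrow> ((f \<circ> chart_inv c) has_derivative f' x) (at x within W)"
    using smooth_on_derivative[OF W(3)] by blast
  then show ?thesis
    using W(2) unfolding at_within_open[OF W(2,1), symmetric] by blast
qed

lemma tangent_space_tcomb:
  assumes "v \<in> tangent_space A p" "w \<in> tangent_space A p"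
  shows "tcomb a v b w \<in> tangent_space A p"
  using assms unfolding tangent_space_def tcomb_def by (auto simp: algebra_simps)

lemma zero_in_tangent_space: "(\<lambda>f. 0) \<in> tangent_space A p"
  by (simp add: tangent_space_def)

section \<open>The coordinate frame at a point and components of metrics and forms\<close>

locale chart_point =
  fixes M :: "'m topology" and A :: "('m, 'n::finite) chart set" and c :: "('m, 'n) chart" and x :: "real ^ 'n"
  assumes manifold: "smooth_manifold M A" and c: "c \<in> A" and x: "x \<in> chart_image c"
begin

abbreviation p :: 'm where "p \<equiv> chart_inv c x"

abbreviation e :: "'n \<Rightarrow> 'm tvec" where "e \<equiv> coord_vec A c p"

lemma p_chart: "p \<in> fst c" "snd c p = x"
  using x by (auto simp: chart_image_def chart_inv_def inv_into_into f_inv_into_f)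

lemma p_topspace: "p \<in> topspace M"
  using manifold c p_chart unfolding smooth_manifold_def by blast

lemma coord_vec_tangent: "e i \<in> tangent_space A p"
proof -
  have lin: "e i (\<lambda>q. a * f q + b * h q) = a * e i f + b * e i h" if fh: "smooth_near A p f" "smooth_near A p h" for f h a b
  proof -
    obtain f' h' where d: "((f \<circ> chart_inv c) has_derivative f') (at x)" "((h \<circ> chart_inv c) has_derivative h') (at x)"
      using smooth_near_derivative[OF fh(1) c p_chart(1)] smooth_near_derivative[OF fh(2) c p_chart(1)]
      unfolding p_chart(2) by blast
    have "(((\<lambda>q. a * f q + b * h q) \<circ> chart_inv c) has_derivative (\<lambda>v. a * f' v + b * h' v)) (at x)"
      using has_derivative_add[OF has_derivative_mult_right[OF d(1), of a] has_derivative_mult_right[OF d(2), of b]]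
      by (simp add: o_def)
    then show ?thesis
      using fh d smooth_near_lincomb[OF fh] by (simp add: coord_vec_def p_chart pd_eq)
  qed
  have prod: "e i (\<lambda>q. f q * h q) = f p * e i h + h p * e i f" if fh: "smooth_near A p f" "smooth_near A p h" for f h
  proof -
    obtain f' h' where d: "((f \<circ> chart_inv c) has_derivative f') (at x)" "((h \<circ> chart_inv c) has_derivative h') (at x)"
      using smooth_near_derivative[OF fh(1) c p_chart(1)] smooth_near_derivative[OF fh(2) c p_chart(1)]
      unfolding p_chart(2) by blast
    have "(((\<lambda>q. f q * h q) \<circ> chart_inv c) has_derivative (\<lambda>v. f p * h' v + f' v * h p)) (at x)"
      using has_derivative_mult[OF d] by (simp add: o_def)
    then show ?thesis
      using fh d smooth_near_mult[OF fh] by (simp add: coord_vec_def p_chart pd_eq)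
  qed
  show ?thesis
    unfolding tangent_space_def mem_Collect_eq
    by (intro conjI allI impI lin prod) (simp add: coord_vec_def)
qed

text \<open>Read in another chart, a coordinate function is a component of the transition
  map.\<close>

lemma coordinate_smooth_near: "smooth_near A p (\<lambda>q. snd c q $ j)"
  unfolding smooth_near_def
proof (intro ballI impI)
  fix d assume d: "d \<in> A" "p \<in> fst d"
  let ?W = "snd d ` (fst d \<inter> fst c)"
  have hom: "homeomorphic_map (subtopology M (fst d)) (top_of_set (chart_image d)) (snd d)"
    and op: "open (chart_image d)" "openin M (fst d)" "openin M (fst c)"
    and sm: "smooth_on ?W (snd c \<circ> chart_inv d)"
    using manifold d c unfolding smooth_manifold_def by blast+
  have "openin (subtopology M (fst d)) (fst d \<inter> fst c)"
    using op by (simp add: openin_subtopology_Int2)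
  then have "openin (top_of_set (chart_image d)) ?W"
    using homeomorphic_imp_open_map[OF hom] unfolding open_map_def by blast
  then have "open ?W"
    using op(1) openin_open_eq by blast
  moreover have "smooth_on ?W ((\<lambda>q. snd c q $ j) \<circ> chart_inv d)"
    using smooth_on_component[OF sm] by (simp add: o_def)
  moreover have "snd d p \<in> ?W" "?W \<subseteq> chart_image d"
    using d p_chart by (auto simp: chart_image_def)
  ultimately show "\<exists>W. open W \<and> snd d p \<in> W \<and> W \<subseteq> chart_image d \<and> smooth_on W ((\<lambda>q. snd c q $ j) \<circ> chart_inv d)"
    by blast
qed

text \<open>Coordinate functions are dual to the coordinate vectors; this recovers the coefficients
  of \<open>comb\<close> and so gives linear independence.\<close>

lemma coord_vec_coordinate: "e i (\<lambda>q. snd c q $ j) = (if i = j then 1 else 0)"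
proof -
  have "((\<lambda>y. y $ j) has_derivative (\<lambda>v. v $ j)) (at x)"
    by (rule bounded_linear_imp_has_derivative) (rule bounded_linear_vec_nth)
  moreover have "open (chart_image c)"
    using manifold c unfolding smooth_manifold_def by blast
  ultimately have "(((\<lambda>q. snd c q $ j) \<circ> chart_inv c) has_derivative (\<lambda>v. v $ j)) (at x)"
    by (rule has_derivative_transform_within_open[OF _ _ x])
      (simp add: chart_image_def chart_inv_def f_inv_into_f)
  then show ?thesis
    using coordinate_smooth_near by (simp add: coord_vec_def p_chart pd_eq axis_def)
qed

definition comb :: "real ^ 'n \<Rightarrow> 'n set \<Rightarrow> 'm tvec" where
  "comb v S = (\<lambda>f. \<Sum>i\<in>S. v $ i * e i f)"

lemma comb_insert: "i \<notin> S \<Longrightarrow> comb v (insert i S) = tcomb (v $ i) (e i) 1 (comb v S)"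
  by (simp add: comb_def tcomb_def)

lemma comb_tangent: "comb v S \<in> tangent_space A p"
proof (induction S rule: infinite_finite_induct)
  case (insert i S)
  then show ?case by (simp add: comb_insert tangent_space_tcomb coord_vec_tangent)
qed (simp_all add: comb_def zero_in_tangent_space)

lemma inner_product_comb:
  assumes b: "inner_product_on (tangent_space A p) b" and w: "w \<in> tangent_space A p"
  shows "b (comb v S) w = (\<Sum>i\<in>S. v $ i * b (e i) w)"
proof -
  have lin: "b (tcomb r u s u') w = r * b u w + s * b u' w"
    if "u \<in> tangent_space A p" "u' \<in> tangent_space A p" for u u' r s
    using b w that unfolding inner_product_on_def by blast
  have "b (\<lambda>f. 0) w = 0"
    using lin[OF zero_in_tangent_space zero_in_tangent_space, of 0 0] by (simp add: tcomb_def)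
  then show ?thesis
  proof (induction S rule: infinite_finite_induct)
    case (insert i S)
    then show ?case
      by (simp add: comb_insert lin coord_vec_tangent comb_tangent)
  qed (simp_all add: comb_def)
qed

text \<open>A kernel vector of the matrix gives a tangent vector orthogonal to every coordinate
  vector, hence to itself. It vanishes by positivity, and evaluating it at the coordinate functions
  returns its coefficients.\<close>

lemma metric_in_invertible:
  assumes b: "inner_product_on (tangent_space A p) (g p)"
  shows "transpose (metric_in A c g x) = metric_in A c g x" "invertible (metric_in A c g x)"
proof -
  have sym: "g p u v = g p v u" if "u \<in> tangent_space A p" "v \<in> tangent_space A p" for u v
    using b that unfolding inner_product_on_def by blast
  show "transpose (metric_in A c g x) = metric_in A c g x"
    unfolding metric_in_def transpose_def by (simp add: vec_eq_iff sym coord_vec_tangent)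
  have "v = 0" if v: "metric_in A c g x *v v = 0" for v
  proof -
    let ?w = "comb v UNIV"
    have "g p (e i) ?w = 0" for i
    proof -
      have "g p (e i) ?w = (\<Sum>j\<in>UNIV. v $ j * g p (e j) (e i))"
        by (simp add: sym[OF coord_vec_tangent comb_tangent] inner_product_comb[OF b coord_vec_tangent])
      also have "\<dots> = (metric_in A c g x *v v) $ i"
        by (simp add: matrix_vector_mult_def metric_in_def mult.commute sym[OF coord_vec_tangent[of i] coord_vec_tangent])
      finally show ?thesis by (simp add: v)
    qed
    then have "g p ?w ?w = 0"
      by (simp add: inner_product_comb[OF b comb_tangent])
    moreover have "?w \<noteq> (\<lambda>f. 0) \<longrightarrow> g p ?w ?w > 0"
      using b comb_tangent unfolding inner_product_on_def by blast
    ultimately have "?w = (\<lambda>f. 0)" by force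
    then have "?w (\<lambda>q. snd c q $ j) = 0" for j by simp
    then show "v = 0"
      by (simp add: comb_def coord_vec_coordinate vec_eq_iff if_distrib cong: if_cong)
  qed
  then show "invertible (metric_in A c g x)"
    unfolding invertible_left_inverse matrix_left_invertible_ker by blast
qed

text \<open>Polarization: expand the form on a repeated argument, the sum of the two coordinate
  vectors.\<close>

lemma form_in_swap:
  assumes alternating: "alternating_form_on (tangent_space A p) (\<omega> p)"
  shows "form_in A c \<omega> x (u @ i # j # v) = - form_in A c \<omega> x (u @ j # i # v)"
proof -
  let ?T = "tangent_space A p"
  define F where "F a b = \<omega> p (map e u @ a # b # map e v)" for a b
  have sub: "set (map e u @ a # b # map e v) \<subseteq> ?T" if "a \<in> ?T" "b \<in> ?T" for a b
    using that coord_vec_tangent by auto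
  have multi: "\<omega> p (vs[r := tcomb a y b z]) = a * \<omega> p (vs[r := y]) + b * \<omega> p (vs[r := z])"
    if "set vs \<subseteq> ?T" "r < length vs" "y \<in> ?T" "z \<in> ?T" for vs r y z a b
    using alternating that unfolding alternating_form_on_def by blast
  have left: "F (tcomb 1 y 1 z) b = F y b + F z b" if "y \<in> ?T" "z \<in> ?T" "b \<in> ?T" for y z b
    using multi[OF sub[OF that(1,3)], of "length u" y z 1 1] that unfolding F_def
    by (simp add: list_update_append)
  have right: "F a (tcomb 1 y 1 z) = F a y + F a z" if "y \<in> ?T" "z \<in> ?T" "a \<in> ?T" for y z a
    using multi[OF sub[OF that(3,1)], of "Suc (length u)" y z 1 1] that unfolding F_def
    by (simp add: list_update_append)
  have diag: "F a a = 0" if "a \<in> ?T" for a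
  proof -
    let ?vs = "map e u @ a # a # map e v"
    have "?vs ! length u = ?vs ! Suc (length u)" "Suc (length u) < length ?vs"
      by (simp_all add: nth_append)
    then show ?thesis
      using alternating sub[OF that that] unfolding F_def alternating_form_on_def by blast
  qed
  let ?s = "tcomb 1 (e i) 1 (e j)"
  have "?s \<in> ?T" by (simp add: tangent_space_tcomb coord_vec_tangent)
  then have "F ?s ?s = F (e i) (e i) + F (e i) (e j) + (F (e j) (e i) + F (e j) (e j))"
    by (simp add: left right coord_vec_tangent)
  then have "F (e i) (e j) + F (e j) (e i) = 0"
    using \<open>?s \<in> ?T\<close> by (simp add: diag coord_vec_tangent)
  then show ?thesis
    by (simp add: form_in_def F_def eq_neg_iff_add_eq_0)
qed

text \<open>More indices than the dimension must repeat, and an alternating form vanishes on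
  repeated arguments.\<close>

lemma form_in_top:
  assumes alternating: "alternating_form_on (tangent_space A p) (\<omega> p)" and len: "length v = Suc CARD('n)"
  shows "form_in A c \<omega> x v = 0"
proof -
  have "\<not> distinct v"
  proof
    assume "distinct v"
    then have "card (set v) = Suc CARD('n)" using len by (simp add: distinct_card)
    then show False using card_mono[of "UNIV :: 'n set" "set v"] by simp
  qed
  then obtain r s where rs: "r < s" "s < length v" "v ! r = v ! s"
    unfolding distinct_conv_nth by (metis linorder_neqE_nat)
  then have "map e v ! r = map e v ! s" "s < length (map e v)"
    by auto
  moreover have "set (map e v) \<subseteq> tangent_space A p"
    using coord_vec_tangent by auto
  ultimately show ?thesis
    using alternating rs(1) unfolding form_in_def alternating_form_on_def by blast
qed

end

theorem proposition2p11:
  fixes M :: "'m topology"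
    and A :: "('m, 'n::finite) chart set"
    and I :: "real set"
    and g :: "real \<Rightarrow> 'm \<Rightarrow> 'm tvec \<Rightarrow> 'm tvec \<Rightarrow> real"
    and H :: "real \<Rightarrow> 'm \<Rightarrow> 'm tvec list \<Rightarrow> real"
    and \<phi> :: "real \<Rightarrow> 'm \<Rightarrow> real"
  assumes manifold: "smooth_manifold M A"
    and interval: "is_interval I" "interior I \<noteq> {}"
    and g: "smooth_metric_family M A I g"
    and H: "smooth_form_family M A I H"
    and H_no_degree_0: "\<And>t p. t \<in> I \<Longrightarrow> p \<in> topspace M \<Longrightarrow> H t p [] = 0"
    and phi: "smooth_function_family A I \<phi>"
    and H_closed: "\<And>c t x is. c \<in> A \<Longrightarrow> t \<in> I \<Longrightarrow> x \<in> chart_image c \<Longrightarrow>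
          ext_deriv (form_in A c (H t)) x is = 0"
    and flow_g: "\<And>c t x i j. c \<in> A \<Longrightarrow> t \<in> I \<Longrightarrow> x \<in> chart_image c \<Longrightarrow>
          ((\<lambda>s. metric_in A c (g s) x $ i $ j) has_vector_derivative
             - 2 * ricci (metric_in A c (g t)) x i j
             + (1/2) * form_square (metric_in A c (g t) x) (form_in A c (H t) x) i j)
          (at t within I)"
    and flow_H: "\<And>c t x is. c \<in> A \<Longrightarrow> t \<in> I \<Longrightarrow> x \<in> chart_image c \<Longrightarrow>
          ((\<lambda>s. form_in A c (H s) x is) has_vector_derivative
             hodge_laplacian (metric_in A c (g t)) (form_in A c (H t)) x is)
          (at t within I)"
    and flow_phi: "\<And>c t x. c \<in> A \<Longrightarrow> t \<in> I \<Longrightarrow> x \<in> chart_image c \<Longrightarrow>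
          heat_operator I (\<lambda>s. metric_in A c (g s)) (\<lambda>s. scalar_in c (\<phi> s)) t x =
          (1/4) * (\<Sum>k=1..CARD('n). ((real k - 1) / real k) *
             tensor_inner (metric_in A c (g t) x) k (form_in A c (H t) x) (form_in A c (H t) x))"
  shows "\<forall>c\<in>A. \<forall>t\<in>I. \<forall>x\<in>chart_image c.
          heat_operator I (\<lambda>s. metric_in A c (g s))
            (\<lambda>s. twisted_scalar_curvature
               (metric_in A c (g s)) (form_in A c (H s)) (scalar_in c (\<phi> s))) t x
          = (let G = metric_in A c (g t); \<omega> = form_in A c (H t); f = scalar_in c (\<phi> t);
                 T = (\<lambda>is. ricci G x (is ! 0) (is ! 1)
                        - (1/4) * form_square (G x) (\<omega> x) (is ! 0) (is ! 1)
                        + hessian G f x (is ! 0) (is ! 1));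
                 W = (\<lambda>is. codiff G \<omega> x is + interior_product (gradient G f x) (\<omega> x) is)
             in 2 * tensor_inner (G x) 2 T T + (1/2) * form_inner (G x) W W)"
proof (intro ballI)
  fix c t0 x0 assume c: "c \<in> A" and t0: "t0 \<in> I" and x0: "x0 \<in> chart_image c"
  define U where "U = chart_image c"
  define G where "G t = metric_in A c (g t)" for t
  define \<omega> where "\<omega> t = form_in A c (H t)" for t
  define f where "f t = scalar_in c (\<phi> t)" for t
  have open_U: "open U"
    using manifold c unfolding smooth_manifold_def U_def by blast
  interpret spacetime_point I U t0 x0
    by unfold_locales (use interval open_U t0 x0 in \<open>auto simp: U_def\<close>)
  have cp: "chart_point M A c x" if "x \<in> U" for x
    using manifold c that by (simp add: chart_point_def U_def)
  \<comment> \<open>This fact is the inner product property of \<open>g\<close> on tangent spaces;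
    it is unrelated to the contraction of forms in the algebra.\<close>
  have form_dot: "inner_product_on (tangent_space A (chart_inv c x)) (g t (chart_inv c x))" if "t \<in> I" "x \<in> U" for t x
    using g that chart_point.p_topspace[OF cp[OF that(2)]] unfolding smooth_metric_family_def by blast
  have al: "alternating_form_on (tangent_space A (chart_inv c x)) (H t (chart_inv c x))" if "t \<in> I" "x \<in> U" for t x
    using H that chart_point.p_topspace[OF cp[OF that(2)]] unfolding smooth_form_family_def by blast
  interpret riemannian_jets I U t0 x0 G
  proof
    show "smooth_st (\<lambda>t x. G t x $ i $ j)" for i j
      using g c unfolding smooth_metric_family_def smooth_st_def unfolding G_def U_def by blast
    show "transpose (G t x) = G t x" "invertible (G t x)" if "t \<in> I" "x \<in> U" for t x
      unfolding G_def using chart_point.metric_in_invertible[OF cp[OF that(2)], of "g t", OF form_dot[OF that]] .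
  qed
  have smooth_\<omega>: "smooth_st (\<lambda>t x. \<omega> t x v)" for v
    using H c unfolding smooth_form_family_def smooth_st_def unfolding \<omega>_def U_def by blast
  define h where "h v = (SOME a. has_jet (\<lambda>t x. \<omega> t x v) a)" for v
  have has_jet_h: "has_jet (\<lambda>t x. \<omega> t x v) (h v)" for v
    unfolding h_def by (rule someI_ex[OF has_jet_exists[OF smooth_\<omega>]])
  have "smooth_st (\<lambda>t x. f t x)"
    using phi c unfolding smooth_function_family_def smooth_st_def unfolding f_def U_def by blast
  then obtain y where has_jet_y: "has_jet f y"
    using has_jet_exists by blast
  \<comment> \<open>Established before the interpretation because the jet of the Hodge Laplacian in
    \<open>d_H\<close> already depends on it.\<close>
  have closed: "wedge (\<lambda>l w. jet_deriv (Some l) (h w)) v = 0" for v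
    by (rule has_jet_eq[OF has_jet_ext_deriv[OF has_jet_h] has_jet_0]) (simp add: H_closed[OF c] \<omega>_def U_def)
  interpret generalized_flow "\<lambda>i. jet_deriv (Some i)" gg qq "jet_deriv None" h y "CARD('n)"
  proof
    show "derivation (jet_deriv None)" by (rule derivation_jet_deriv)
    show "jet_deriv None (jet_deriv (Some i) a) = jet_deriv (Some i) (jet_deriv None a)" for i a
      by (rule jet_deriv_commute)
    show "alternating h"
      unfolding alternating_def
    proof (intro allI)
      fix u i j v
      show "h (u @ i # j # v) = - h (u @ j # i # v)"
      proof (rule has_jet_eq[OF has_jet_h has_jet_minus[OF has_jet_h]])
        fix t x assume tx: "t \<in> I" "x \<in> U"
        show "\<omega> t x (u @ i # j # v) = - \<omega> t x (u @ j # i # v)"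
          unfolding \<omega>_def by (rule chart_point.form_in_swap[OF cp[OF tx(2)], of "H t", OF al[OF tx]])
      qed
    qed
    show "wedge (\<lambda>l w. jet_deriv (Some l) (h w)) v = 0" for v by (rule closed)
    show "h v = 0" if "length v = Suc CARD('n)" for v
    proof (rule has_jet_eq[OF has_jet_h has_jet_0])
      fix t x assume tx: "t \<in> I" "x \<in> U"
      show "\<omega> t x v = 0"
        unfolding \<omega>_def by (rule chart_point.form_in_top[OF cp[OF tx(2)], of "H t", OF al[OF tx] that])
    qed
    show "jet_deriv None (gg i j) = (- 2) *\<^sub>R Ric i j
        + (1/2) *\<^sub>R (\<Sum>k\<le>CARD('n). form_dot k (\<lambda>w. h (i # w)) (\<lambda>w. h (j # w)))" for i j
    \<comment> \<open>Equality of jets requires the flow equation at every time in \<open>I\<close>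
      and every point of \<open>U\<close>, not only at (t0, x0).\<close>
    proof (rule has_jet_eq[OF has_jet_st_deriv[OF has_jet_gg] has_jet_add[OF has_jet_cmult[OF has_jet_ricci] has_jet_cmult[OF has_jet_form_square[OF has_jet_h]]]])
      fix t x assume tx: "t \<in> I" "x \<in> U"
      show "st_deriv None (\<lambda>t x. G t x $ i $ j) t x = - 2 * ricci (G t) x i j + 1 / 2 * form_square (G t x) (\<omega> t x) i j"
        unfolding st_deriv_def option.case G_def \<omega>_def
        by (rule vector_derivative_within[OF at_I_not_bot[OF tx(1)] flow_g[OF c tx(1) tx(2)[unfolded U_def]]])
    qed
    show "jet_deriv None (h v) = - wedge (\<lambda>l w. jet_deriv (Some l) (- divg h w)) v" for v
    proof (rule has_jet_eq[OF has_jet_st_deriv[OF has_jet_h] has_jet_hodge_laplacian[OF has_jet_h closed]])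
      fix t x assume tx: "t \<in> I" "x \<in> U"
      show "st_deriv None (\<lambda>t x. \<omega> t x v) t x = hodge_laplacian (G t) (\<omega> t) x v"
        unfolding st_deriv_def option.case G_def \<omega>_def
        by (rule vector_derivative_within[OF at_I_not_bot[OF tx(1)] flow_H[OF c tx(1) tx(2)[unfolded U_def]]])
    qed
    have "has_jet (\<lambda>t x. (1/4) * (\<Sum>k=1..CARD('n). ((real k - 1) / real k) * tensor_inner (G t x) k (\<omega> t x) (\<omega> t x)))
       ((1/4) *\<^sub>R (\<Sum>k=1..CARD('n). ((real k - 1) / real k) *\<^sub>R form_dot k h h))"
      by (intro has_jet_cmult has_jet_sum has_jet_tensor_inner has_jet_h)
    then show "jet_deriv None y - Lap y = (1/4) *\<^sub>R (\<Sum>k=1..CARD('n). ((real k - 1) / real k) *\<^sub>R form_dot k h h)"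
    proof (rule has_jet_eq[OF has_jet_diff[OF has_jet_st_deriv[OF has_jet_y] has_jet_laplacian[OF has_jet_y]]])
      fix t x assume tx: "t \<in> I" "x \<in> U"
      show "st_deriv None f t x - laplacian (G t) (f t) x =
         (1/4) * (\<Sum>k=1..CARD('n). ((real k - 1) / real k) * tensor_inner (G t x) k (\<omega> t x) (\<omega> t x))"
        using flow_phi[OF c tx(1) tx(2)[unfolded U_def]]
        unfolding heat_operator_def st_deriv_def option.case G_def \<omega>_def f_def .
    qed
  qed
  have has_jet_u: "has_jet (\<lambda>t x. twisted_scalar_curvature (G t) (\<omega> t) (f t) x) twisted"
    unfolding twisted_def grad_dot_def by (rule has_jet_twisted_scalar_curvature[OF has_jet_y has_jet_h])
  have has_jet_T: "has_jet (\<lambda>t x. ricci (G t) x (v ! 0) (v ! 1) - (1/4) * form_square (G t x) (\<omega> t x) (v ! 0) (v ! 1)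
      + hessian (G t) (f t) x (v ! 0) (v ! 1)) (soliton v)" for v
    unfolding soliton_def by (intro has_jet_diff has_jet_add has_jet_cmult has_jet_ricci has_jet_form_square has_jet_hessian has_jet_h has_jet_y)
  have has_jet_W: "has_jet (\<lambda>t x. codiff (G t) (\<omega> t) x v + interior_product (gradient (G t) (f t) x) (\<omega> t x) v) (W v)" for v
    unfolding W_def iota_def by (intro has_jet_add has_jet_codiff has_jet_interior_gradient has_jet_h has_jet_y)
  show "heat_operator I (\<lambda>s. metric_in A c (g s))
            (\<lambda>s. twisted_scalar_curvature
               (metric_in A c (g s)) (form_in A c (H s)) (scalar_in c (\<phi> s))) t0 x0
          = (let G = metric_in A c (g t0); \<omega> = form_in A c (H t0); f = scalar_in c (\<phi> t0);
                 T = (\<lambda>is. ricci G x0 (is ! 0) (is ! 1)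
                        - (1/4) * form_square (G x0) (\<omega> x0) (is ! 0) (is ! 1)
                        + hessian G f x0 (is ! 0) (is ! 1));
                 W = (\<lambda>is. codiff G \<omega> x0 is + interior_product (gradient G f x0) (\<omega> x0) is)
             in 2 * tensor_inner (G x0) 2 T T + (1/2) * form_inner (G x0) W W)"
    \<comment> \<open>Both sides are jets evaluated at (t0, x0): \<open>has_jet_value\<close>
      replaces the constant terms in the algebraic identity by the values of the corresponding
      functions.\<close>
    unfolding Let_def
    using heat_operator_twisted[of jet_value, OF jet_value_add jet_value_scaleR]
      has_jet_value[OF has_jet_st_deriv[OF has_jet_u, of None]] has_jet_value[OF has_jet_laplacian[OF has_jet_u]]
      has_jet_value[OF has_jet_tensor_inner[OF has_jet_T has_jet_T, of 2]] has_jet_value[OF has_jet_form_inner[OF has_jet_W has_jet_W]]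
    by (simp add: heat_operator_def st_deriv_def G_def \<omega>_def f_def)
qed

end
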